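(* Let $\varepsilon\ge 0$ and let $\mathcal{U}=\{U_0,\ldots,U_n\}$ be a finite collection of finite simplicial filtrations $U_i=(U_i^\alpha)_{\alpha\ge 0}$, where all the $U_i^\alpha$ are subcomplexes of one sufficiently large simplicial complex. Let $\mathcal{W}=(W^\alpha)_{\alpha\ge 0}$ with $W^\alpha=\bigcup_{i=0}^n U_i^\alpha$. If $\mathcal{U}$ is an $\varepsilon$-good cover filtration of $\mathcal{W}$, then for all integers $K\ge 0$, $$\mathrm{d}_B\big(\mathrm{Dgm}_K(\mathcal{W}),\mathrm{Dgm}_K(\mathrm{Nrv}\,\mathcal{U})\big)\le (K+1)\varepsilon .$$
   Context: All homology is taken with coefficients in $\mathbb{Z}/2\mathbb{Z}$. A finite simplicial filtration is a family $(F^\alpha)_{\alpha\ge 0}$ of finite simplicial complexes, indexed by real $\alpha\ge 0$, with $F^\alpha\subseteq F^\beta$ whenever $\alpha\le\beta$. Write $[n]=\{0,\ldots,n\}$. For non-empty $v\subseteq[n]$ put $U_v^\alpha=\bigcap_{i\in v}U_i^\alpha$. Let $\mathcal{U}^\alpha=\{U_0^\alpha,\ldots,U_n^\alpha\}$; it is a cover of $W^\alpha$. The nerve is the abstract simplicial complex $\mathrm{Nrv}\,\mathcal{U}^\alpha=\{\emptyset\ne\sigma\subseteq[n] : \bigcap_{i\in\sigma}U_i^\alpha\neq\emptyset\}$, and the nerve filtration is $\mathrm{Nrv}\,\mathcal{U}=(\mathrm{Nrv}\,\mathcal{U}^\alpha)_{\alpha\ge 0}$. $\mathcal{U}$ is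 an $\varepsilon$-good cover (filtration) of $\mathcal{W}$ if for every non-empty $v\subseteq[n]$ and every $\alpha\ge 0$ the inclusion $U_v^\alpha\hookrightarrow U_v^{\alpha+\varepsilon}$ induces the zero map on reduced homology $\tilde H_k$ in every degree $k\ge 0$ (in particular there is no condition when $U_v^\alpha=\emptyset$). For a filtration $\mathcal{F}$ with pointwise finite-dimensional homology, $\mathrm{Dgm}_K(\mathcal{F})$ is the persistence diagram of the persistence module $(H_K(F^\alpha))_{\alpha\ge 0}$ with maps induced by inclusions: the multiset of (birth, death) points together with all diagonal points $(x,x)$, each with infinite multiplicity. The bottleneck distance is $\mathrm{d}_B(D,D')=\inf_{\phi}\sup_{p\in D}\|p-\phi(p)\|_\infty$ over all bijections $\phi:D\to D'$ (for finite diagrams, a min of max). *)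

theory Defs
  imports
    "HOL-Library.Z2"
    "HOL-Library.Extended_Nat"
    "HOL-Library.Extended_Real"
    "HOL-Algebra.AbelCoset"
    "Jordan_Normal_Form.VS_Connect"
begin

section \<open>Simplicial complexes and filtrations\<close>

text \<open>Simplices are non-empty, so a complex (in particular an intersection of complexes) is
  empty exactly if it is the empty set.\<close>

definition simplicial_complex :: "'v set set \<Rightarrow> bool" where
  "simplicial_complex X \<longleftrightarrow>
     (\<forall>\<sigma>\<in>X. finite \<sigma> \<and> \<sigma> \<noteq> {} \<and> (\<forall>\<tau>. \<tau> \<subseteq> \<sigma> \<and> \<tau> \<noteq> {} \<longrightarrow> \<tau> \<in> X))"

definition subcomplex :: "'v set set \<Rightarrow> 'v set set \<Rightarrow> bool" where
  "subcomplex Y X \<longleftrightarrow> simplicial_complex Y \<and> Y \<subseteq> X"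

text \<open>Filtrations are total functions on the reals; only the values at \<open>\<alpha> \<ge> 0\<close> are ever used.\<close>

definition finite_simplicial_filtration :: "(real \<Rightarrow> 'v set set) \<Rightarrow> bool" where
  "finite_simplicial_filtration F \<longleftrightarrow>
     (\<forall>\<alpha>\<ge>0. finite (F \<alpha>) \<and> simplicial_complex (F \<alpha>)) \<and>
     (\<forall>\<alpha> \<beta>. 0 \<le> \<alpha> \<and> \<alpha> \<le> \<beta> \<longrightarrow> F \<alpha> \<subseteq> F \<beta>)"

definition nerve :: "nat \<Rightarrow> (nat \<Rightarrow> real \<Rightarrow> 'v set set) \<Rightarrow> real \<Rightarrow> nat set set" where
  "nerve n U \<alpha> = {\<sigma>. \<sigma> \<noteq> {} \<and> \<sigma> \<subseteq> {..n} \<and> (\<Inter>i\<in>\<sigma>. U i \<alpha>) \<noteq> {}}"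


section \<open>Simplicial homology with coefficients in the field of two elements\<close>

definition function_space :: "('a \<Rightarrow> 'k::field) set \<Rightarrow> ('k, 'a \<Rightarrow> 'k) module" where
  "function_space S =
     \<lparr>carrier = S, mult = undefined, one = undefined, zero = (\<lambda>_. 0),
      add = (\<lambda>f g x. f x + g x), smult = (\<lambda>a f x. a * f x)\<rparr>"

definition quotient_space :: "('k, 'a) module \<Rightarrow> 'a set \<Rightarrow> ('k, 'a set) module" where
  "quotient_space V S =
     \<lparr>carrier = a_rcosets\<^bsub>V\<^esub> S, mult = undefined, one = undefined, zero = S,
      add = set_add V, smult = (\<lambda>a C. \<Union>x\<in>C. S +>\<^bsub>V\<^esub> (a \<odot>\<^bsub>V\<^esub> x))\<rparr>"

definition simplicial_chains :: "nat \<Rightarrow> 'v set set \<Rightarrow> ('v set \<Rightarrow> bit) set" where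
  "simplicial_chains k X = {c. finite {\<sigma>. c \<sigma> \<noteq> 0} \<and> (\<forall>\<sigma>. c \<sigma> \<noteq> 0 \<longrightarrow> \<sigma> \<in> X \<and> card \<sigma> = k + 1)}"

text \<open>The boundary of a vertex is the empty simplex, so this is the boundary operator of the
  augmented chain complex; its value at \<open>{}\<close> on a 0-chain is the augmentation.\<close>

definition bd :: "('v set \<Rightarrow> bit) \<Rightarrow> 'v set \<Rightarrow> bit" where
  "bd c = (\<lambda>\<tau>. \<Sum>\<sigma> | c \<sigma> \<noteq> 0. c \<sigma> * (\<Sum>x\<in>\<sigma>. of_bool (\<sigma> - {x} = \<tau>)))"

definition cycles :: "nat \<Rightarrow> 'v set set \<Rightarrow> ('v set \<Rightarrow> bit) set" where
  "cycles k X = {c \<in> simplicial_chains k X. k = 0 \<or> bd c = (\<lambda>_. 0)}"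

definition reduced_cycles :: "nat \<Rightarrow> 'v set set \<Rightarrow> ('v set \<Rightarrow> bit) set" where
  "reduced_cycles k X = {c \<in> simplicial_chains k X. bd c = (\<lambda>_. 0)}"

definition boundaries :: "nat \<Rightarrow> 'v set set \<Rightarrow> ('v set \<Rightarrow> bit) set" where
  "boundaries k X = bd ` simplicial_chains (k + 1) X"

definition homology :: "nat \<Rightarrow> 'v set set \<Rightarrow> (bit, ('v set \<Rightarrow> bit) set) module" where
  "homology k X = quotient_space (function_space (cycles k X)) (boundaries k X)"

definition reduced_homology :: "nat \<Rightarrow> 'v set set \<Rightarrow> (bit, ('v set \<Rightarrow> bit) set) module" where
  "reduced_homology k X =
     quotient_space (function_space (reduced_cycles k X)) (boundaries k X)"

text \<open>The map induced in degree \<open>k\<close>, on homology as well as on reduced homology, by the inclusion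
  of a subcomplex into \<open>Y\<close>: the class of a cycle \<open>z\<close> is sent to the coset of \<open>z\<close> modulo the
  boundaries of \<open>Y\<close>.\<close>

definition inclusion_map :: "nat \<Rightarrow> 'v set set \<Rightarrow> ('v set \<Rightarrow> bit) set \<Rightarrow> ('v set \<Rightarrow> bit) set" where
  "inclusion_map k Y C = boundaries k Y <+>\<^bsub>function_space UNIV\<^esub> C"

definition eps_good_cover :: "real \<Rightarrow> nat \<Rightarrow> (nat \<Rightarrow> real \<Rightarrow> 'v set set) \<Rightarrow> bool" where
  "eps_good_cover \<epsilon> n U \<longleftrightarrow>
     (\<forall>v \<alpha> k. v \<noteq> {} \<and> v \<subseteq> {..n} \<and> 0 \<le> \<alpha> \<longrightarrow>
        (\<forall>C \<in> carrier (reduced_homology k (\<Inter>i\<in>v. U i \<alpha>)).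
           inclusion_map k (\<Inter>i\<in>v. U i (\<alpha> + \<epsilon>)) C
             = \<zero>\<^bsub>reduced_homology k (\<Inter>i\<in>v. U i (\<alpha> + \<epsilon>))\<^esub>))"


section \<open>Persistence diagrams\<close>

text \<open>A persistence module is given by spaces \<open>M \<alpha>\<close> and maps \<open>f \<alpha> \<beta> : M \<alpha> \<rightarrow> M \<beta>\<close> for
  \<open>0 \<le> \<alpha> \<le> \<beta>\<close>. It is extended by the zero space to \<open>\<alpha> < 0\<close> and to \<open>\<beta> = \<infinity>\<close>.\<close>

definition pm_rank ::
    "(real \<Rightarrow> ('k::field, 'a) module) \<Rightarrow> (real \<Rightarrow> real \<Rightarrow> 'a \<Rightarrow> 'a) \<Rightarrow> real \<Rightarrow> ereal \<Rightarrow> nat" where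
  "pm_rank M f \<alpha> \<beta> =
     (if 0 \<le> \<alpha> \<and> ereal \<alpha> \<le> \<beta> \<and> \<beta> \<noteq> \<infinity>
      then vectorspace.dim class_ring
             ((M (real_of_ereal \<beta>)) \<lparr>carrier := f \<alpha> (real_of_ereal \<beta>) ` carrier (M \<alpha>)\<rparr>)
      else 0)"

text \<open>The number of classes that are born between \<open>a\<close> and \<open>a'\<close> and die between \<open>c\<close> and \<open>c'\<close>
  (with \<open>a < a' < c < c'\<close>): those alive from \<open>a'\<close> to \<open>c\<close> but not already from \<open>a\<close>, minus those of
  them that are still alive at \<open>c'\<close>. None of the truncated subtractions goes below zero.\<close>

definition pm_rectangle ::
    "(real \<Rightarrow> ('k::field, 'a) module) \<Rightarrow> (real \<Rightarrow> real \<Rightarrow> 'a \<Rightarrow> 'a) \<Rightarrow>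
     real \<Rightarrow> real \<Rightarrow> real \<Rightarrow> ereal \<Rightarrow> nat" where
  "pm_rectangle M f a a' c c' =
     (pm_rank M f a' (ereal c) - pm_rank M f a (ereal c)) - (pm_rank M f a' c' - pm_rank M f a c')"

text \<open>The number of classes with birth \<open>b\<close> and death \<open>d > b\<close> is the count over all sufficiently
  small rectangles around \<open>(b, d)\<close>, i.e. the minimum over all rectangles that contain \<open>(b, d)\<close> in
  their interior; for \<open>d = \<infinity>\<close> the upper side is \<open>c' = \<infinity>\<close>. It does not depend on whether the
  lifetimes contain their endpoints. For pointwise finite-dimensional modules this is the number of intervals with
  infimum \<open>b\<close> and supremum \<open>d\<close> in an interval decomposition (Chazal, de Silva, Glisse, Oudot,
  The Structure and Stability of Persistence Modules).\<close>

definition pm_multiplicity ::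
    "(real \<Rightarrow> ('k::field, 'a) module) \<Rightarrow> (real \<Rightarrow> real \<Rightarrow> 'a \<Rightarrow> 'a) \<Rightarrow> real \<Rightarrow> ereal \<Rightarrow> nat" where
  "pm_multiplicity M f b d =
     Inf {pm_rectangle M f a a' c c' | a a' c c'.
            a < b \<and> b < a' \<and> a' < c \<and> ereal c < d \<and> (d < c' \<or> d = \<infinity> \<and> c' = \<infinity>)}"

type_synonym diagram = "real \<times> ereal \<Rightarrow> enat"

definition pm_diagram ::
    "(real \<Rightarrow> ('k::field, 'a) module) \<Rightarrow> (real \<Rightarrow> real \<Rightarrow> 'a \<Rightarrow> 'a) \<Rightarrow> diagram" where
  "pm_diagram M f = (\<lambda>(b, d).
     if d = ereal b then \<infinity> else if ereal b < d then enat (pm_multiplicity M f b d) else 0)"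

definition Dgm :: "nat \<Rightarrow> (real \<Rightarrow> 'v set set) \<Rightarrow> diagram" where
  "Dgm K F = pm_diagram (\<lambda>\<alpha>. homology K (F \<alpha>)) (\<lambda>\<alpha> \<beta>. inclusion_map K (F \<beta>))"


section \<open>Bottleneck distance\<close>

text \<open>The elements of a multiset of points, copies being told apart by their index.\<close>

definition diagram_points :: "diagram \<Rightarrow> ((real \<times> ereal) \<times> nat) set" where
  "diagram_points D = {(p, i). enat i < D p}"

text \<open>The \<open>\<ell>\<^sub>\<infinity>\<close> distance, where two infinite deaths are at distance 0
  (for type \<^typ>\<open>ereal\<close>, \<open>\<bar>\<infinity> - \<infinity>\<bar> = \<infinity>\<close>).\<close>

fun linf_dist :: "real \<times> ereal \<Rightarrow> real \<times> ereal \<Rightarrow> ereal" where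
  "linf_dist (b, d) (b', d') = max (ereal \<bar>b - b'\<bar>) (if d = d' then 0 else \<bar>d - d'\<bar>)"

definition bottleneck_dist :: "diagram \<Rightarrow> diagram \<Rightarrow> ereal" where
  "bottleneck_dist D D' =
     (INF \<phi> \<in> {\<phi>. bij_betw \<phi> (diagram_points D) (diagram_points D')}.
        SUP x \<in> diagram_points D. linf_dist (fst x) (fst (\<phi> x)))"

end

theory Submission
  imports Defs "HOL-Library.Countable_Set"
begin

text \<open>The blowup complex \<open>J\<close> has the vertices of the nerve and of the cover, and its simplices are
  the joins of \<open>v\<close> and \<open>\<tau>\<close> with \<open>\<tau> \<in> U\<^sub>v\<close>, together with those of the nerve and of the cover. Pushing a
  chain off the cover vertices, starting with the largest cover parts, is possible since the link
  of a simplex \<open>\<tau>\<close> in the nerve vertices is a full simplex; so the inclusion of the nerve into \<open>J\<close> is a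
  homology isomorphism. Pushing a chain off the nerve vertices means filling reduced cycles of the
  \<open>U\<^sub>v\<close>, starting with the largest \<open>v\<close>; each dimension but the lowest costs \<open>\<epsilon>\<close>. So in degree \<open>K\<close> kernel and
  cokernel of \<open>H\<^sub>K(W) \<rightarrow> H\<^sub>K(J)\<close> vanish after a shift by \<open>(K + 1)\<epsilon>\<close>.

  The bottleneck distance is then bounded in the manner of Bauer and Lesnick's induced matchings,
  with ranks in place of interval decompositions. The bars of the image of \<open>H\<^sub>K(W) \<rightarrow> H\<^sub>K(J)\<close> with a
  given birth are matched with those of \<open>H\<^sub>K(W)\<close> with the same birth, in the order of their deaths, and
  the bars of the image with a given death are matched with those of \<open>H\<^sub>K(J)\<close> with the same death, in the
  order of their births. All of the required inequalities between ranks follow from the single fact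
  \<open>quotient_rank_exchange\<close>.\<close>

section \<open>Bars of a rank function\<close>

text \<open>The constant comes from counting vertices. A relative cycle whose simplices have m
  vertices is pushed off the nerve vertices in m rounds. In the first round the cycles to be filled
  are multiples of the empty simplex, which is bounded by any vertex of a non-empty intersection;
  each of the remaining m - 1 rounds fills honest reduced cycles and costs \<epsilon>. Surjectivity
  in degree K concerns cycles, with m = K + 1; injectivity concerns the chains that they bound, with
  m = K + 2, and this gives (K + 1)\<epsilon>. Goodness provides fillings but no natural choice of
  them, so no map from the homology of the blowup complex back to that of the cover is constructed.
  The one natural map between the two is factored through its image instead. This does not double
  the error: passing from the image to the cover changes deaths only, passing to the blowup complex
  changes births only, and the distance is the maximum over the two coordinates.\<close>

definition beyond :: "ereal \<Rightarrow> ereal \<Rightarrow> bool" where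
  "beyond d c' \<longleftrightarrow> d < c' \<or> d = \<infinity> \<and> c' = \<infinity>"

lemma beyond_le: "beyond d c' \<Longrightarrow> d \<le> c'"
  by (auto simp: beyond_def)

lemma beyond_min: "beyond d c \<Longrightarrow> beyond d c' \<Longrightarrow> beyond d (min c c')"
  by (auto simp: beyond_def)

lemma Inf_nat_le: "(x::nat) \<in> A \<Longrightarrow> Inf A \<le> x"
  by (rule cInf_lower) auto

lemma Sup_nat_attained:
  fixes A :: "nat set"
  assumes "A \<noteq> {}" "\<And>x. x \<in> A \<Longrightarrow> x \<le> m"
  shows "Sup A \<in> A" "x \<in> A \<Longrightarrow> x \<le> Sup A"
proof -
  have "finite A" using assms(2) finite_nat_set_iff_bounded_le by blast
  then show "Sup A \<in> A" "x \<in> A \<Longrightarrow> x \<le> Sup A"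
    using assms(1) by (auto simp: Sup_nat_def Max_in)
qed

text \<open>\<open>pm_multiplicity\<close> with the rank function as its argument. The image of the
  homology of the cover in that of the blowup complex enters only through its ranks, and in this
  form it has bars as well.\<close>

definition rank_multiplicity :: "(real \<Rightarrow> ereal \<Rightarrow> nat) \<Rightarrow> real \<Rightarrow> ereal \<Rightarrow> nat" where
  "rank_multiplicity r b d =
     Inf {(r a' (ereal c) - r a (ereal c)) - (r a' c' - r a c') | a a' c c'.
            a < b \<and> b < a' \<and> a' < c \<and> ereal c < d \<and> beyond d c'}"

definition rank_points :: "(real \<Rightarrow> ereal \<Rightarrow> nat) \<Rightarrow> ((real \<times> ereal) \<times> nat) set" where
  "rank_points r = {((b, d), i). ereal b < d \<and> i < rank_multiplicity r b d}"

text \<open>The number of bars with death \<open>d\<close> and birth at most \<open>b\<close>.\<close>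

definition bars_dying :: "(real \<Rightarrow> ereal \<Rightarrow> nat) \<Rightarrow> ereal \<Rightarrow> real \<Rightarrow> nat" where
  "bars_dying r d b =
     Inf {r b' (ereal c) - r b' c' | b' c c'. b < b' \<and> b' < c \<and> ereal c < d \<and> beyond d c'}"

text \<open>The number of bars with birth \<open>b\<close> and death at least \<open>d\<close>.\<close>

definition bars_born :: "(real \<Rightarrow> ereal \<Rightarrow> nat) \<Rightarrow> real \<Rightarrow> ereal \<Rightarrow> nat" where
  "bars_born r b d =
     Inf {r a' (ereal c) - r a (ereal c) | a a' c. a < b \<and> b < a' \<and> a' < c \<and> ereal c < d}"

text \<open>Bars with death \<open>d\<close> are numbered in the order of their births: the supremum
  is the number of those born before \<open>b\<close>, and copies of one point take consecutive
  numbers.\<close>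

definition death_code :: "(real \<Rightarrow> ereal \<Rightarrow> nat) \<Rightarrow> (real \<times> ereal) \<times> nat \<Rightarrow> ereal \<times> nat" where
  "death_code r = (\<lambda>((b, d), i). (d, Sup (bars_dying r d ` {..<b}) + i))"

text \<open>Here longer bars come first, since the supremum counts the bars born at \<open>b\<close>
  that die after \<open>d\<close>. For \<open>d = \<infinity>\<close> it is taken over the empty
  set, which gives 0.\<close>

definition birth_code :: "(real \<Rightarrow> ereal \<Rightarrow> nat) \<Rightarrow> (real \<times> ereal) \<times> nat \<Rightarrow> real \<times> nat" where
  "birth_code r = (\<lambda>((b, d), i). (b, Sup (bars_born r b ` {d<..}) + i))"

text \<open>The last condition says that no rectangle in the birth-death plane contains a negative
  number of bars. With one side moved to where the rank is zero, it becomes monotonicity in either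
  argument.\<close>

locale rank_function =
  fixes r :: "real \<Rightarrow> ereal \<Rightarrow> nat"
  assumes rank_neg: "s < 0 \<Longrightarrow> r s t = 0"
    and rank_infinity: "r s \<infinity> = 0"
    and rank_rectangle:
      "s \<le> s' \<Longrightarrow> ereal s' \<le> t \<Longrightarrow> t \<le> t' \<Longrightarrow> r s t + r s' t' \<le> r s' t + r s t'"
begin

lemma rank_mono: "s \<le> s' \<Longrightarrow> ereal s' \<le> t \<Longrightarrow> r s t \<le> r s' t"
  using rank_rectangle[of s s' t \<infinity>] by (simp add: rank_infinity)

lemma rank_antimono:
  assumes "ereal s \<le> t" "t \<le> t'"
  shows "r s t' \<le> r s t"
  using rank_rectangle[of "min s (-1)" s t t'] assms by (simp add: rank_neg)

text \<open>The bars on the left are born by \<open>x\<close> and die between \<open>c\<close> and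
  \<open>c'\<close>, so they are among those on the right. Shrinking a strip thus never raises its
  count, which makes the infimum in \<open>bars_dying\<close> the common value of all sufficiently
  small strips.\<close>

lemma strip_dying_mono:
  assumes "x \<le> y" "ereal y \<le> c0" "c0 \<le> c" "c \<le> c'" "c' \<le> c0'"
  shows "r x c - r x c' \<le> r y c0 - r y c0'"
proof -
  have "ereal y \<le> c" "ereal y \<le> c'" using assms by order+
  then have "r x c + r y c' \<le> r y c + r x c'" "r y c \<le> r y c0" "r y c0' \<le> r y c'"
    using assms by (auto intro!: rank_rectangle rank_antimono)
  then show ?thesis by linarith
qed

lemma strip_born_mono:
  assumes "x0 \<le> x" "x \<le> y" "y \<le> y0" "ereal y0 \<le> c0" "c0 \<le> c"
  shows "r y c - r x c \<le> r y0 c0 - r x0 c0"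
proof -
  have le: "ereal y \<le> c0" "ereal y \<le> c" "ereal x \<le> c0"
    using assms by (auto elim!: order_trans[rotated] simp flip: ereal_less_eq(3))
  then have "r x c0 + r y c \<le> r y c0 + r x c" "r x0 c0 \<le> r x c0" "r y c0 \<le> r y0 c0"
    using assms by (auto intro!: rank_rectangle rank_mono)
  then show ?thesis by linarith
qed

section \<open>Counts of bars as values on small strips and rectangles\<close>

lemma bars_dying_le:
  assumes "b < b'" "b' < c" "ereal c < d" "beyond d c'"
  shows "bars_dying r d b \<le> r b' (ereal c) - r b' c'"
  unfolding bars_dying_def using assms by (intro Inf_nat_le) blast

lemma bars_dying_attained:
  assumes "ereal b < d"
  obtains b' c c' where "b < b'" "b' < c" "ereal c < d" "beyond d c'"
    "bars_dying r d b = r b' (ereal c) - r b' c'"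
proof -
  obtain c where c: "b < c" "ereal c < d"
    using ereal_dense2[OF assms] by auto
  obtain b' where "b < b'" "b' < c" using c(1) dense by blast
  moreover have "beyond d \<infinity>" by (cases d) (auto simp: beyond_def)
  ultimately have "{r b' (ereal c) - r b' c' | b' c c'.
      b < b' \<and> b' < c \<and> ereal c < d \<and> beyond d c'} \<noteq> {}" using c by blast
  from Inf_nat_def1[OF this] show thesis using that unfolding bars_dying_def by blast
qed

lemma bars_born_le:
  assumes "a < b" "b < a'" "a' < c" "ereal c < d"
  shows "bars_born r b d \<le> r a' (ereal c) - r a (ereal c)"
  unfolding bars_born_def using assms by (intro Inf_nat_le) blast

lemma bars_born_attained:
  assumes "ereal b < d"
  obtains a a' c where "a < b" "b < a'" "a' < c" "ereal c < d"
    "bars_born r b d = r a' (ereal c) - r a (ereal c)"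
proof -
  obtain c where c: "b < c" "ereal c < d"
    using ereal_dense2[OF assms] by auto
  obtain b' where "b < b'" "b' < c" using c(1) dense by blast
  moreover obtain a where "a < b" using lt_ex by blast
  ultimately have "{r a' (ereal c) - r a (ereal c) | a a' c.
      a < b \<and> b < a' \<and> a' < c \<and> ereal c < d} \<noteq> {}" using c by blast
  from Inf_nat_def1[OF this] show thesis using that unfolding bars_born_def by blast
qed

lemma bars_dying_mono:
  assumes "a \<le> b" "ereal b < d"
  shows "bars_dying r d a \<le> bars_dying r d b"
proof -
  obtain b' c c' where "b < b'" "b' < c" "ereal c < d" "beyond d c'"
    "bars_dying r d b = r b' (ereal c) - r b' c'"
    using bars_dying_attained[OF assms(2)] by blast
  then show ?thesis using bars_dying_le[of a b' c d c'] assms(1) by auto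
qed

lemma bars_born_antimono:
  assumes "ereal b < d" "d \<le> d'"
  shows "bars_born r b d' \<le> bars_born r b d"
proof -
  obtain a a' c where "a < b" "b < a'" "a' < c" "ereal c < d"
    "bars_born r b d = r a' (ereal c) - r a (ereal c)"
    using bars_born_attained[OF assms(1)] by blast
  then show ?thesis using bars_born_le[of a b a' c d'] assms(2) by auto
qed

text \<open>A non-empty bounded set of natural numbers has a maximum, so the left limit of the
  monotone function \<open>bars_dying r d\<close> at \<open>b\<close> is a value taken before
  \<open>b\<close>.\<close>

lemma bars_dying_before:
  assumes "ereal b < d"
  shows "Sup (bars_dying r d ` {..<b}) \<in> bars_dying r d ` {..<b}"
    and "a < b \<Longrightarrow> bars_dying r d a \<le> Sup (bars_dying r d ` {..<b})"
  using assms bars_dying_mono less_imp_le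
  by (intro Sup_nat_attained[where m = "bars_dying r d b"]; fastforce)+

lemma bars_born_after:
  assumes "ereal b < d" "d \<noteq> \<infinity>"
  shows "Sup (bars_born r b ` {d<..}) \<in> bars_born r b ` {d<..}"
    and "d < d' \<Longrightarrow> bars_born r b d' \<le> Sup (bars_born r b ` {d<..})"
proof -
  have ne: "bars_born r b ` {d<..} \<noteq> {}" using assms by auto
  have bd: "x \<le> bars_born r b d" if "x \<in> bars_born r b ` {d<..}" for x
    using assms that bars_born_antimono less_imp_le by fastforce
  show "Sup (bars_born r b ` {d<..}) \<in> bars_born r b ` {d<..}"
    using Sup_nat_attained(1)[OF ne bd] .
  show "bars_born r b d' \<le> Sup (bars_born r b ` {d<..})" if "d < d'"
    using Sup_nat_attained(2)[OF ne bd] that by auto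
qed

text \<open>The five rank inequalities ensure that none of the truncated subtractions is cut off at
  zero; the counts then add up as integers.\<close>

lemma rectangle_split:
  assumes "a \<le> a'" "ereal a' \<le> c" "c \<le> c'"
  shows "(r a' c - r a c) - (r a' c' - r a c') + (r a c - r a c') = r a' c - r a' c'"
    and "(r a' c - r a c) - (r a' c' - r a c') + (r a' c' - r a c') = r a' c - r a c"
proof -
  have *: "ereal a \<le> c" using assms(1,2) by (meson ereal_less_eq(3) order_trans)
  have "r a c \<le> r a' c" "r a c' \<le> r a' c'" "r a c' \<le> r a c" "r a' c' \<le> r a' c"
    "r a c + r a' c' \<le> r a' c + r a c'"
    using assms * by (auto intro!: rank_mono rank_antimono rank_rectangle)
  then show "(r a' c - r a c) - (r a' c' - r a c') + (r a c - r a c') = r a' c - r a' c'"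
    and "(r a' c - r a c) - (r a' c' - r a c') + (r a' c' - r a c') = r a' c - r a c"
    by linarith+
qed

text \<open>The four inner lines cut the outer rectangle into nine. Each of the first nine
  inequalities says that one of these has a non-negative count, and the eight outer counts add up to
  the difference of the two sides.\<close>

lemma rectangle_antimono:
  assumes "a \<le> a1" "a1 \<le> a1'" "a1' \<le> a'" "ereal a' \<le> c" "c \<le> c1" "c1 \<le> c1'" "c1' \<le> c'"
  shows "(r a1' c1 - r a1 c1) - (r a1' c1' - r a1 c1') \<le> (r a' c - r a c) - (r a' c' - r a c')"
proof -
  have le: "ereal a1' \<le> c" "ereal a1 \<le> c" "ereal a \<le> c"
    using assms by (meson ereal_less_eq(3) order_trans)+
  have "r a1 c1 + r a1' c1' \<le> r a1' c1 + r a1 c1'" "r a c + r a1 c1 \<le> r a1 c + r a c1"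
    "r a1 c + r a1' c1 \<le> r a1' c + r a1 c1" "r a1' c + r a' c1 \<le> r a' c + r a1' c1"
    "r a c1 + r a1 c1' \<le> r a1 c1 + r a c1'"
    "r a1' c1 + r a' c1' \<le> r a' c1 + r a1' c1'"
    "r a c1' + r a1 c' \<le> r a1 c1' + r a c'"
    "r a1 c1' + r a1' c' \<le> r a1' c1' + r a1 c'"
    "r a1' c1' + r a' c' \<le> r a' c1' + r a1' c'"
    using assms le by (auto intro!: rank_rectangle elim: order_trans)
  moreover have "r a c \<le> r a' c" "r a c' \<le> r a' c'" "r a1 c1 \<le> r a1' c1" "r a1 c1' \<le> r a1' c1'"
    using assms le by (auto intro!: rank_mono elim: order_trans)
  ultimately show ?thesis using assms by linarith
qed

lemma multiplicity_le:
  assumes "a < b" "b < a'" "a' < c" "ereal c < d" "beyond d c'"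
  shows "rank_multiplicity r b d \<le> (r a' (ereal c) - r a (ereal c)) - (r a' c' - r a c')"
  unfolding rank_multiplicity_def using assms by (intro Inf_nat_le) blast

lemma multiplicity_attained:
  assumes "ereal b < d"
  obtains a a' c c' where "a < b" "b < a'" "a' < c" "ereal c < d" "beyond d c'"
    "rank_multiplicity r b d = (r a' (ereal c) - r a (ereal c)) - (r a' c' - r a c')"
proof -
  obtain c where c: "b < c" "ereal c < d"
    using ereal_dense2[OF assms] by auto
  obtain b' where "b < b'" "b' < c" using c(1) dense by blast
  moreover have "beyond d \<infinity>" by (cases d) (auto simp: beyond_def)
  moreover obtain a where "a < b" using lt_ex by blast
  ultimately have "{(r a' (ereal c) - r a (ereal c)) - (r a' c' - r a c') | a a' c c'.
            a < b \<and> b < a' \<and> a' < c \<and> ereal c < d \<and> beyond d c'} \<noteq> {}" using c by blast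
  from Inf_nat_def1[OF this] show thesis using that unfolding rank_multiplicity_def by blast
qed

text \<open>A small rectangle attains the infimum in all three of the counts at once.\<close>

lemma multiplicity_dying:
  assumes "ereal b < d"
  shows "rank_multiplicity r b d + Sup (bars_dying r d ` {..<b}) = bars_dying r d b"
proof -
  obtain a a' c c' where R: "a < b" "b < a'" "a' < c" "ereal c < d" "beyond d c'"
    "rank_multiplicity r b d = (r a' (ereal c) - r a (ereal c)) - (r a' c' - r a c')"
    using multiplicity_attained[OF assms] by blast
  obtain x where x: "x < b" "bars_dying r d x = Sup (bars_dying r d ` {..<b})"
    using bars_dying_before(1)[OF assms] by auto
  \<comment> \<open>Far enough to the right to stay within the attaining rectangle and to keep the
    value of \<open>bars_dying r d\<close> at \<open>x\<close>, which is already the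
    supremum.\<close>
  define a0 where "a0 = max a x"
  have a0: "a0 < b" "a \<le> a0" "ereal a0 < d"
    using R(1) x(1) assms le_less_trans[of "ereal a0" "ereal b" d] by (auto simp: a0_def)
  have pa0: "bars_dying r d a0 = Sup (bars_dying r d ` {..<b})"
    using bars_dying_before(2)[OF assms a0(1)] bars_dying_mono[of x a0 d] x a0
    by (auto simp: a0_def)
  obtain b1 c1 c1' where 1: "b < b1" "b1 < c1" "ereal c1 < d" "beyond d c1'"
    "bars_dying r d b = r b1 (ereal c1) - r b1 c1'" using bars_dying_attained[OF assms] by blast
  obtain b2 c2 c2' where 2: "a0 < b2" "b2 < c2" "ereal c2 < d" "beyond d c2'"
    "bars_dying r d a0 = r b2 (ereal c2) - r b2 c2'" using bars_dying_attained[OF a0(3)] by blast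
  define C C' where "C = max c (max c1 c2)" and "C' = min c' (min c1' c2')"
  define B where "B = min a' b1"
  \<comment> \<open>The left side must lie strictly to the right of \<open>a0\<close>, as the strips
    counted in \<open>bars_dying r d a0\<close> do, and still to the left of
    \<open>b\<close>.\<close>
  obtain A where A: "a0 < A" "A < min b b2" using a0(1) 2(1) dense by (metis min_less_iff_conj)
  have C: "ereal C < d" "beyond d C'" "c \<le> C" "c1 \<le> C" "c2 \<le> C" "C' \<le> c'" "C' \<le> c1'" "C' \<le> c2'"
    using R 1 2 unfolding C_def C'_def
    by (auto intro!: beyond_min simp: max_def intro: min.coboundedI1 min.coboundedI2)
  have CC': "ereal C \<le> C'" using C(1) beyond_le[OF C(2)] by order
  have B: "b < B" "B \<le> a'" "B \<le> b1" "B < C" using R 1 C unfolding B_def by auto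
  have e1: "r B (ereal C) - r B C' = bars_dying r d b"
    using bars_dying_le[OF B(1,4) C(1,2)] strip_dying_mono[of B b1 "ereal c1" "ereal C" C' c1']
      1 B C CC' by auto
  have e2: "r A (ereal C) - r A C' = Sup (bars_dying r d ` {..<b})"
    using bars_dying_le[OF A(1) _ C(1,2)] strip_dying_mono[of A b2 "ereal c2" "ereal C" C' c2']
      2 A B C CC' pa0 by auto
  have "rank_multiplicity r b d \<le> (r B (ereal C) - r A (ereal C)) - (r B C' - r A C')"
    by (rule multiplicity_le[OF _ B(1,4) C(1,2)]) (use A in auto)
  moreover have "(r B (ereal C) - r A (ereal C)) - (r B C' - r A C') \<le> rank_multiplicity r b d"
    unfolding R(6) using R(3) A B C CC' a0 by (intro rectangle_antimono) auto
  ultimately have "rank_multiplicity r b d = (r B (ereal C) - r A (ereal C)) - (r B C' - r A C')"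
    by simp
  then show ?thesis
    using rectangle_split(1)[of A B "ereal C" C'] A B CC' e1 e2 by simp
qed

lemma multiplicity_born:
  assumes "ereal b < d"
  shows "rank_multiplicity r b d + Sup (bars_born r b ` {d<..}) = bars_born r b d"
proof -
  obtain a a' c c' where R: "a < b" "b < a'" "a' < c" "ereal c < d" "beyond d c'"
    "rank_multiplicity r b d = (r a' (ereal c) - r a (ereal c)) - (r a' c' - r a c')"
    using multiplicity_attained[OF assms] by blast
  obtain a1 a1' c1 where 1: "a1 < b" "b < a1'" "a1' < c1" "ereal c1 < d"
    "bars_born r b d = r a1' (ereal c1) - r a1 (ereal c1)"
    using bars_born_attained[OF assms] by blast
  \<comment> \<open>\<open>C'\<close> is so close above \<open>d\<close> that the bars born at
    \<open>b\<close> and alive at \<open>C'\<close> number those that die after \<open>d\<close>.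
    The last clause keeps this true when the vertical sides are moved closer to
    \<open>b\<close>.\<close>
  obtain a2 a2' C' where 2: "a2 < b" "b < a2'" "beyond d C'" "C' \<le> c'"
    "\<And>x y. a2 \<le> x \<Longrightarrow> x < b \<Longrightarrow> b < y \<Longrightarrow> y \<le> a2' \<Longrightarrow>
       r y C' - r x C' = Sup (bars_born r b ` {d<..})"
  proof (cases "d = \<infinity>")
    \<comment> \<open>Nothing dies after infinity: the upper side is infinity itself, where the rank
      is zero, and so is the supremum of the empty set.\<close>
    case True
    then have "c' = \<infinity>" using R(5) by (auto simp: beyond_def)
    moreover have "{d<..} = {}" using True by auto
    ultimately show thesis using that[of a a' \<infinity>] R True
      by (auto simp: rank_infinity Sup_nat_def beyond_def)
  next
    case False
    then have "d < c'" using R(5) by (auto simp: beyond_def)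
    obtain d1 where d1: "d < d1" "bars_born r b d1 = Sup (bars_born r b ` {d<..})"
      using bars_born_after(1)[OF assms False] by auto
    define d0 where "d0 = min d1 c'"
    have d0: "d < d0" "d0 \<le> c'" "ereal b < d0" using d1 \<open>d < c'\<close> assms by (auto simp: d0_def)
    have p: "bars_born r b d0 = Sup (bars_born r b ` {d<..})"
      using bars_born_after(2)[OF assms False d0(1)] bars_born_antimono[of b d0 d1] d1 d0
      by (auto simp: d0_def)
    obtain a2 a2' c2 where 2: "a2 < b" "b < a2'" "a2' < c2" "ereal c2 < d0"
      "bars_born r b d0 = r a2' (ereal c2) - r a2 (ereal c2)"
      using bars_born_attained[OF d0(3)] by blast
    obtain c3 where c3: "max (ereal c2) d < ereal c3" "ereal c3 < d0"
      using ereal_dense2[of "max (ereal c2) d" d0] 2 d0 by auto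
    have "r y (ereal c3) - r x (ereal c3) = Sup (bars_born r b ` {d<..})"
      if "a2 \<le> x" "x < b" "b < y" "y \<le> a2'" for x y
      using bars_born_le[of x b y c3 d0] c3 2 p that
        strip_born_mono[of a2 x y a2' "ereal c2" "ereal c3"] by auto
    moreover have "beyond d (ereal c3)" "ereal c3 \<le> c'" using c3 d0 by (auto simp: beyond_def)
    ultimately show thesis using that 2 by blast
  qed
  define A B C where "A = max a (max a1 a2)" and "B = min a' (min a1' a2')" and "C = max c c1"
  have C: "ereal C < d" "c \<le> C" "c1 \<le> C" using R 1 unfolding C_def by (auto simp: max_def)
  have CC': "ereal C \<le> C'" using C(1) beyond_le[OF 2(3)] by order
  have B: "b < B" "B \<le> a'" "B \<le> a1'" "B \<le> a2'" "B < C" using R 1 2 C unfolding B_def by auto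
  have A: "A < b" "a \<le> A" "a1 \<le> A" "a2 \<le> A" using R 1 2 unfolding A_def by auto
  have e1: "r B (ereal C) - r A (ereal C) = bars_born r b d"
    using bars_born_le[OF A(1) B(1,5) C(1)] strip_born_mono[of a1 A B a1' "ereal c1" "ereal C"]
      1 A B C by auto
  have e2: "r B C' - r A C' = Sup (bars_born r b ` {d<..})" using 2(5) A B by auto
  have "rank_multiplicity r b d \<le> (r B (ereal C) - r A (ereal C)) - (r B C' - r A C')"
    by (rule multiplicity_le[OF A(1) B(1,5) C(1) 2(3)])
  moreover have "(r B (ereal C) - r A (ereal C)) - (r B C' - r A C') \<le> rank_multiplicity r b d"
    unfolding R(6) using R(3) A B C CC' 2 by (intro rectangle_antimono) auto
  ultimately have "rank_multiplicity r b d = (r B (ereal C) - r A (ereal C)) - (r B C' - r A C')"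
    by simp
  then show ?thesis
    using rectangle_split(2)[of A B "ereal C" C'] A B CC' e1 e2 by simp
qed

section \<open>Numbering the bars with a common death or a common birth\<close>

lemma bars_dying_neg:
  assumes "b < 0" "ereal b < d"
  shows "bars_dying r d b = 0"
proof -
  obtain b' where b': "ereal b < ereal b'" "ereal b' < min 0 d"
    using ereal_dense2[of "ereal b" "min 0 d"] assms by auto
  moreover obtain c where "ereal b' < ereal c" "ereal c < d"
    using ereal_dense2[of "ereal b'" d] b' by auto
  moreover have "beyond d \<infinity>" by (cases d) (auto simp: beyond_def)
  ultimately show ?thesis using bars_dying_le[of b b' c d \<infinity>] by (auto simp: rank_neg)
qed

text \<open>The bar numbered \<open>j\<close> among those with death \<open>d\<close> is born at the
  infimum of the points where the count exceeds \<open>j\<close>. The infimum is finite since no bar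
  is born before 0, and it is itself such a point because \<open>bars_dying\<close> looks at strips
  just to its right.\<close>

lemma bars_dying_point:
  assumes "ereal b < d" "j < bars_dying r d b"
  obtains b0 where "b0 \<le> b" "Sup (bars_dying r d ` {..<b0}) \<le> j" "j < bars_dying r d b0"
proof -
  let ?S = "{x. ereal x < d \<and> j < bars_dying r d x}"
  define b0 where "b0 = Inf ?S"
  have bdd: "bdd_below ?S" using bars_dying_neg by (intro bdd_belowI[of _ 0]) force
  have bS: "b \<in> ?S" using assms by auto
  have le: "b0 \<le> b" unfolding b0_def using bdd bS by (rule cInf_lower[rotated])
  have b0d: "ereal b0 < d" using le assms(1) by (meson ereal_less_eq(3) le_less_trans)
  obtain b' c c' where *: "b0 < b'" "b' < c" "ereal c < d" "beyond d c'"
    "bars_dying r d b0 = r b' (ereal c) - r b' c'" using bars_dying_attained[OF b0d] by blast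
  obtain x where x: "x \<in> ?S" "x < b'"
    using cInf_lessD[of ?S b'] bS *(1) unfolding b0_def by blast
  have "j < bars_dying r d b0" using bars_dying_le[OF x(2) *(2-4)] x(1) *(5) by auto
  moreover have "bars_dying r d a \<le> j" if "a < b0" for a
  proof (rule ccontr)
    assume "\<not> ?thesis"
    then have "a \<in> ?S" using that b0d by (auto intro: less_trans[of "ereal a" "ereal b0"])
    then show False using cInf_lower[OF _ bdd] that unfolding b0_def by force
  qed
  moreover obtain a where "a < b0" "bars_dying r d a = Sup (bars_dying r d ` {..<b0})"
    using bars_dying_before(1)[OF b0d] by auto
  ultimately show thesis using that[OF le] by metis
qed

text \<open>Dually, with the supremum of the deaths, which always exists in the extended reals. It
  is attained because \<open>bars_born\<close> looks strictly below its last argument.\<close>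

lemma bars_born_point:
  assumes "ereal b < d" "j < bars_born r b d"
  obtains d0 where "d \<le> d0" "Sup (bars_born r b ` {d0<..}) \<le> j" "j < bars_born r b d0"
proof -
  let ?S = "{x. ereal b < x \<and> j < bars_born r b x}"
  define d0 where "d0 = Sup ?S"
  have dS: "d \<in> ?S" using assms by auto
  have le: "d \<le> d0" unfolding d0_def using dS by (rule Sup_upper)
  have bd0: "ereal b < d0" using le assms(1) by order
  obtain a a' c where *: "a < b" "b < a'" "a' < c" "ereal c < d0"
    "bars_born r b d0 = r a' (ereal c) - r a (ereal c)" using bars_born_attained[OF bd0] by blast
  obtain x where x: "x \<in> ?S" "ereal c < x"
    using *(4) unfolding d0_def less_Sup_iff by blast
  have "j < bars_born r b d0" using bars_born_le[OF *(1-3) x(2)] x(1) *(5) by auto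
  moreover have "bars_born r b x \<le> j" if "d0 < x" for x
  proof (rule ccontr)
    assume "\<not> ?thesis"
    then have "x \<in> ?S" using that bd0 by auto
    then show False using Sup_upper that unfolding d0_def by (meson not_less)
  qed
  moreover have "Sup (bars_born r b ` {d0<..}) = 0 \<or>
      Sup (bars_born r b ` {d0<..}) \<in> bars_born r b ` {d0<..}"
    using bars_born_after(1)[OF bd0] by (cases "d0 = \<infinity>") (auto simp: Sup_nat_def)
  ultimately show thesis using that[OF le] by fastforce
qed

text \<open>By \<open>multiplicity_dying\<close> the bars from \<open>b\<close> to \<open>d\<close>
  take the numbers from the supremum before \<open>b\<close> up to, but not including,
  \<open>bars_dying r d b\<close>. These intervals are disjoint for different
  \<open>b\<close>.\<close>

lemma inj_on_death_code: "inj_on (death_code r) (rank_points r)"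
proof -
  have *: "b = b'" if "ereal b < d" "i < rank_multiplicity r b d" "ereal b' < d"
    "i' < rank_multiplicity r b' d"
    "Sup (bars_dying r d ` {..<b}) + i = Sup (bars_dying r d ` {..<b'}) + i'" for b d i b' i'
    using multiplicity_dying[OF that(1)] multiplicity_dying[OF that(3)] that
      bars_dying_before(2)[OF that(1), of b'] bars_dying_before(2)[OF that(3), of b]
    by linarith
  show ?thesis
  proof (rule inj_onI)
    fix x y assume xy: "x \<in> rank_points r" "y \<in> rank_points r" "death_code r x = death_code r y"
    obtain b d i b' d' i' where "x = ((b, d), i)" "y = ((b', d'), i')" by (metis surj_pair)
    then show "x = y"
      using xy *[of b d i b' i'] by (auto simp: death_code_def rank_points_def)
  qed
qed

lemma inj_on_birth_code: "inj_on (birth_code r) (rank_points r)"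
proof -
  have *: "d = d'" if h: "ereal b < d" "i < rank_multiplicity r b d" "ereal b < d'"
    "i' < rank_multiplicity r b d'"
    "Sup (bars_born r b ` {d<..}) + i = Sup (bars_born r b ` {d'<..}) + i'" for b d i d' i'
  proof (rule ccontr)
    assume "d \<noteq> d'"
    then consider "d < d'" "d \<noteq> \<infinity>" | "d' < d" "d' \<noteq> \<infinity>" by (metis ereal_infty_less(1) linorder_cases)
    then show False
    proof cases
      case 1
      then show ?thesis
        using multiplicity_born[OF h(1)] multiplicity_born[OF h(3)] h bars_born_after(2)[OF h(1) 1(2,1)]
        by linarith
    next
      case 2
      then show ?thesis
        using multiplicity_born[OF h(1)] multiplicity_born[OF h(3)] h bars_born_after(2)[OF h(3) 2(2,1)]
        by linarith
    qed
  qed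
  show ?thesis
  proof (rule inj_onI)
    fix x y assume xy: "x \<in> rank_points r" "y \<in> rank_points r" "birth_code r x = birth_code r y"
    obtain b d i b' d' i' where "x = ((b, d), i)" "y = ((b', d'), i')" by (metis surj_pair)
    then show "x = y"
      using xy *[of b d i d' i'] by (auto simp: birth_code_def rank_points_def)
  qed
qed

text \<open>The intervals of numbers leave no gap, so the numbers in use for each death form an
  initial segment. Containment between the codes of two rank functions is thereby a comparison of
  counts.\<close>

lemma death_code_image:
  "death_code r ` rank_points r = {(d, j). \<exists>b. ereal b < d \<and> j < bars_dying r d b}"
proof (intro equalityI subsetI)
  fix x assume "x \<in> death_code r ` rank_points r"
  then obtain b d i where "x = death_code r ((b, d), i)" "ereal b < d" "i < rank_multiplicity r b d"
    by (auto simp: rank_points_def)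
  then show "x \<in> {(d, j). \<exists>b. ereal b < d \<and> j < bars_dying r d b}"
    using multiplicity_dying[of b d] by (auto simp: death_code_def intro!: exI[of _ b])
next
  fix x assume "x \<in> {(d, j). \<exists>b. ereal b < d \<and> j < bars_dying r d b}"
  then obtain d j b where x: "x = (d, j)" "ereal b < d" "j < bars_dying r d b" by auto
  obtain b0 where b0: "b0 \<le> b" "Sup (bars_dying r d ` {..<b0}) \<le> j" "j < bars_dying r d b0"
    using bars_dying_point[OF x(2,3)] .
  have "ereal b0 < d" using b0(1) x(2) by (meson ereal_less_eq(3) le_less_trans)
  then have "((b0, d), j - Sup (bars_dying r d ` {..<b0})) \<in> rank_points r"
    using multiplicity_dying[of b0 d] b0 by (auto simp: rank_points_def)
  moreover have "death_code r ((b0, d), j - Sup (bars_dying r d ` {..<b0})) = x"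
    using b0 x(1) by (auto simp: death_code_def)
  ultimately show "x \<in> death_code r ` rank_points r" by (metis imageI)
qed

lemma birth_code_image:
  "birth_code r ` rank_points r = {(b, j). \<exists>d. ereal b < d \<and> j < bars_born r b d}"
proof (intro equalityI subsetI)
  fix x assume "x \<in> birth_code r ` rank_points r"
  then obtain b d i where "x = birth_code r ((b, d), i)" "ereal b < d" "i < rank_multiplicity r b d"
    by (auto simp: rank_points_def)
  then show "x \<in> {(b, j). \<exists>d. ereal b < d \<and> j < bars_born r b d}"
    using multiplicity_born[of b d] by (auto simp: birth_code_def intro!: exI[of _ d])
next
  fix x assume "x \<in> {(b, j). \<exists>d. ereal b < d \<and> j < bars_born r b d}"
  then obtain d j b where x: "x = (b, j)" "ereal b < d" "j < bars_born r b d" by auto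
  obtain d0 where d0: "d \<le> d0" "Sup (bars_born r b ` {d0<..}) \<le> j" "j < bars_born r b d0"
    using bars_born_point[OF x(2,3)] .
  have "ereal b < d0" using d0(1) x(2) by order
  then have "((b, d0), j - Sup (bars_born r b ` {d0<..})) \<in> rank_points r"
    using multiplicity_born[of b d0] d0 by (auto simp: rank_points_def)
  moreover have "birth_code r ((b, d0), j - Sup (bars_born r b ` {d0<..})) = x"
    using d0 x(1) by (auto simp: birth_code_def)
  ultimately show "x \<in> birth_code r ` rank_points r" by (metis imageI)
qed

text \<open>The birth is recovered from the code as the least point before \<open>d\<close> where
  the count exceeds the number. Comparisons of counts thus turn into comparisons of the births of
  bars with equal code.\<close>

lemma death_code_bounds:
  assumes "((b, d), i) \<in> rank_points r" "death_code r ((b, d), i) = (d', j)"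
  shows "d' = d" "j < bars_dying r d b" "ereal x < d \<Longrightarrow> j < bars_dying r d x \<Longrightarrow> b \<le> x"
proof -
  have h: "ereal b < d" "i < rank_multiplicity r b d" "j = Sup (bars_dying r d ` {..<b}) + i" "d' = d"
    using assms by (auto simp: rank_points_def death_code_def)
  show "d' = d" by fact
  show "j < bars_dying r d b" using h multiplicity_dying[OF h(1)] by simp
  show "b \<le> x" if "ereal x < d" "j < bars_dying r d x"
  proof (rule ccontr)
    assume "\<not> b \<le> x"
    then show False using bars_dying_before(2)[OF h(1), of x] that h(3) by simp
  qed
qed

lemma birth_code_bounds:
  assumes "((b, d), i) \<in> rank_points r" "birth_code r ((b, d), i) = (b', j)"
  shows "b' = b" "j < bars_born r b d" "ereal b < x \<Longrightarrow> j < bars_born r b x \<Longrightarrow> x \<le> d"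
proof -
  have h: "ereal b < d" "i < rank_multiplicity r b d" "j = Sup (bars_born r b ` {d<..}) + i" "b' = b"
    using assms by (auto simp: rank_points_def birth_code_def)
  show "b' = b" by fact
  show "j < bars_born r b d" using h multiplicity_born[OF h(1)] by simp
  show "x \<le> d" if "ereal b < x" "j < bars_born r b x"
  proof (rule ccontr)
    assume "\<not> x \<le> d"
    then have "d < x" "d \<noteq> \<infinity>" by auto
    then show False using bars_born_after(2)[OF h(1), of x] that h(3) by simp
  qed
qed

end

section \<open>The induced matching\<close>

definition diagonal_points :: "((real \<times> ereal) \<times> nat) set" where
  "diagonal_points = {((b, d), i). d = ereal b}"

lemma bij_betw_fibres:
  assumes "\<And>b. bij_betw (\<psi> b) {x \<in> A. p x = b} {y \<in> B. p' y = b}"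
  shows "bij_betw (\<lambda>x. \<psi> (p x) x) A B"
    and "x \<in> A \<Longrightarrow> p' (\<psi> (p x) x) = p x"
proof -
  have mem: "\<psi> (p x) x \<in> B \<and> p' (\<psi> (p x) x) = p x" if "x \<in> A" for x
    using bij_betwE[OF assms[of "p x"]] that by blast
  then show "x \<in> A \<Longrightarrow> p' (\<psi> (p x) x) = p x" by blast
  show "bij_betw (\<lambda>x. \<psi> (p x) x) A B"
    unfolding bij_betw_def
  proof (intro conjI inj_onI equalityI subsetI)
    fix x y assume xy: "x \<in> A" "y \<in> A" "\<psi> (p x) x = \<psi> (p y) y"
    then have "p x = p y" using mem by metis
    then show "x = y"
      by (intro inj_onD[OF bij_betw_imp_inj_on[OF assms[of "p x"]]]) (use xy in auto)
  next
    fix y assume "y \<in> B"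
    then have "y \<in> \<psi> (p' y) ` {x \<in> A. p x = p' y}"
      using bij_betw_imp_surj_on[OF assms[of "p' y"]] by simp
    then obtain x where "y = \<psi> (p' y) x" "x \<in> {x \<in> A. p x = p' y}" by (rule imageE)
    then show "y \<in> (\<lambda>x. \<psi> (p x) x) ` A" by (intro image_eqI[of _ _ x]) simp_all
  qed (use mem in auto)
qed

lemma bij_betw_countable_infinite:
  assumes "countable A" "infinite A" "countable B" "infinite B"
  shows "\<exists>f. bij_betw f A B"
proof -
  obtain e e' :: "_ \<Rightarrow> nat" where "bij_betw e A UNIV" "bij_betw e' B UNIV"
    using assms countableE_infinite by metis
  then show ?thesis using bij_betw_trans bij_betw_inv_into by blast
qed

text \<open>\<open>birth_code\<close> embeds the fibre in a copy of the natural numbers. A whole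
  diagram is uncountable because of its diagonal, whence the restriction to one birth.\<close>

lemma (in rank_function) countable_points_fibre:
  "countable {x \<in> rank_points r. fst (fst x) = b}"
proof -
  have "fst (birth_code r x) = fst (fst x)" for x
    by (simp add: birth_code_def case_prod_beta)
  then have "birth_code r ` {x \<in> rank_points r. fst (fst x) = b} \<subseteq> {b} \<times> UNIV"
    by (intro image_subsetI) (simp add: mem_Times_iff)
  then have "countable (birth_code r ` {x \<in> rank_points r. fst (fst x) = b})"
    by (rule countable_subset) simp
  moreover have "inj_on (birth_code r) {x \<in> rank_points r. fst (fst x) = b}"
    using inj_on_birth_code by (rule inj_on_subset) auto
  ultimately show ?thesis by (rule countable_image_inj_on)
qed

lemma linf_dist_le:
  assumes "\<bar>b - b'\<bar> \<le> \<delta>" "d \<le> d' + ereal \<delta>" "d' \<le> d + ereal \<delta>"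
  shows "linf_dist (b, d) (b', d') \<le> ereal \<delta>"
  using assms by (cases d; cases d') auto

text \<open>The rank functions of \<open>M\<close>, of the image of a morphism \<open>f : M \<rightarrow> N\<close> and of \<open>N\<close>, where kernel
  and cokernel of \<open>f\<close> vanish after a shift by \<open>\<delta>\<close>. The rank \<open>rQ s t\<close> is that of \<open>M s \<rightarrow> N t\<close>.\<close>

locale rank_interleaving =
  M: rank_function rM + Q: rank_function rQ + N: rank_function rN for rM rQ rN +
  fixes \<delta> :: real
  assumes delta: "0 \<le> \<delta>"
    and epi: "s \<le> s' \<Longrightarrow> s' \<le> t \<Longrightarrow>
      rQ s' (ereal t) + rM s (ereal t) \<le> rM s' (ereal t) + rQ s (ereal t)"
    and kernel: "s \<le> s' \<Longrightarrow> s' \<le> t \<Longrightarrow>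
      rM s' (ereal (t + \<delta>)) + rQ s (ereal t) \<le> rQ s' (ereal t) + rM s (ereal (t + \<delta>))"
    and mono: "s \<le> t \<Longrightarrow> ereal t \<le> t' \<Longrightarrow>
      rQ s (ereal t) + rN s t' \<le> rN s (ereal t) + rQ s t'"
    and cokernel: "s + \<delta> \<le> t \<Longrightarrow> ereal t \<le> t' \<Longrightarrow>
      rN s (ereal t) + rQ (s + \<delta>) t' \<le> rQ (s + \<delta>) (ereal t) + rN s t'"
begin

lemma bars_born_epi:
  assumes "ereal b < d"
  shows "bars_born rQ b d \<le> bars_born rM b d"
proof -
  obtain a a' c where "a < b" "b < a'" "a' < c" "ereal c < d"
    "bars_born rM b d = rM a' (ereal c) - rM a (ereal c)"
    using M.bars_born_attained[OF assms] by blast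
  then show ?thesis using Q.bars_born_le[of a b a' c d] epi[of a a' c] by auto
qed

text \<open>A strip of the image with its side at \<open>c\<close> is compared with the strip of
  \<open>M\<close> with its side at \<open>c + \<delta>\<close>, by which time the kernel has
  died.\<close>

lemma bars_born_kernel:
  assumes "ereal b < d"
  shows "bars_born rM b (d + ereal \<delta>) \<le> bars_born rQ b d"
proof -
  obtain a a' c where *: "a < b" "b < a'" "a' < c" "ereal c < d"
    "bars_born rQ b d = rQ a' (ereal c) - rQ a (ereal c)"
    using Q.bars_born_attained[OF assms] by blast
  moreover have "ereal (c + \<delta>) < d + ereal \<delta>" using *(4) by (cases d) auto
  ultimately show ?thesis
    using M.bars_born_le[of a b a' "c + \<delta>" "d + ereal \<delta>"] kernel[of a a' c] delta by auto
qed

lemma bars_dying_mono: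
  assumes "ereal b < d"
  shows "bars_dying rQ d b \<le> bars_dying rN d b"
proof -
  obtain b' c c' where *: "b < b'" "b' < c" "ereal c < d" "beyond d c'"
    "bars_dying rN d b = rN b' (ereal c) - rN b' c'"
    using N.bars_dying_attained[OF assms] by blast
  moreover have "ereal c \<le> c'" using *(3) beyond_le[OF *(4)] by order
  ultimately show ?thesis using Q.bars_dying_le[of b b' c d c'] mono[of b' c c'] by auto
qed

text \<open>A strip of the image at \<open>b'\<close> is compared with the strip of \<open>N\<close>
  at \<open>b' - \<delta>\<close>: what is present in \<open>N\<close> at that time lies in the
  image after the shift.\<close>

lemma bars_dying_cokernel:
  assumes "ereal (b + \<delta>) < d"
  shows "bars_dying rN d b \<le> bars_dying rQ d (b + \<delta>)"
proof -
  obtain b' c c' where *: "b + \<delta> < b'" "b' < c" "ereal c < d" "beyond d c'"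
    "bars_dying rQ d (b + \<delta>) = rQ b' (ereal c) - rQ b' c'"
    using Q.bars_dying_attained[OF assms] by blast
  moreover have "ereal c \<le> c'" using *(3) beyond_le[OF *(4)] by order
  ultimately show ?thesis
    using N.bars_dying_le[of b "b' - \<delta>" c d c'] cokernel[of "b' - \<delta>" c c'] delta by auto
qed

definition to_M :: "(real \<times> ereal) \<times> nat \<Rightarrow> (real \<times> ereal) \<times> nat" where
  "to_M q = inv_into (rank_points rM) (birth_code rM) (birth_code rQ q)"

definition to_N :: "(real \<times> ereal) \<times> nat \<Rightarrow> (real \<times> ereal) \<times> nat" where
  "to_N q = inv_into (rank_points rN) (death_code rN) (death_code rQ q)"

lemma birth_code_subset: "birth_code rQ ` rank_points rQ \<subseteq> birth_code rM ` rank_points rM"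
  unfolding Q.birth_code_image M.birth_code_image
  using bars_born_epi by (auto intro: less_le_trans)

lemma death_code_subset: "death_code rQ ` rank_points rQ \<subseteq> death_code rN ` rank_points rN"
  unfolding Q.death_code_image N.death_code_image
  using bars_dying_mono by (auto intro: less_le_trans)

lemma to_M:
  assumes "q \<in> rank_points rQ"
  shows "to_M q \<in> rank_points rM" "birth_code rM (to_M q) = birth_code rQ q"
proof -
  have "birth_code rQ q \<in> birth_code rM ` rank_points rM" using assms birth_code_subset by blast
  then show "to_M q \<in> rank_points rM" "birth_code rM (to_M q) = birth_code rQ q"
    unfolding to_M_def by (auto intro: inv_into_into f_inv_into_f)
qed

lemma to_N:
  assumes "q \<in> rank_points rQ"
  shows "to_N q \<in> rank_points rN" "death_code rN (to_N q) = death_code rQ q"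
proof -
  have "death_code rQ q \<in> death_code rN ` rank_points rN" using assms death_code_subset by blast
  then show "to_N q \<in> rank_points rN" "death_code rN (to_N q) = death_code rQ q"
    unfolding to_N_def by (auto intro: inv_into_into f_inv_into_f)
qed

lemma inj_on_to_M: "inj_on to_M (rank_points rQ)"
  by (rule inj_onI) (metis to_M(2) Q.inj_on_birth_code inj_onD)

lemma inj_on_to_N: "inj_on to_N (rank_points rQ)"
  by (rule inj_onI) (metis to_N(2) Q.inj_on_death_code inj_onD)

text \<open>\<open>to_M\<close> keeps the birth and prolongs the bar by at most \<delta>;
  \<open>to_N\<close> keeps the death and advances the birth by at most \<delta>. Each coordinate is
  moved by only one of the two.\<close>

lemma linf_dist_to_M_to_N:
  assumes q: "q \<in> rank_points rQ"
  shows "linf_dist (fst (to_M q)) (fst (to_N q)) \<le> ereal \<delta>"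
proof -
  obtain b d i where qe: "q = ((b, d), i)" by (metis surj_pair)
  obtain b1 d1 i1 where g: "to_M q = ((b1, d1), i1)" by (metis surj_pair)
  obtain b2 d2 i2 where h: "to_N q = ((b2, d2), i2)" by (metis surj_pair)
  obtain b' j where j: "birth_code rQ q = (b', j)" by (metis surj_pair)
  obtain d' k where k: "death_code rQ q = (d', k)" by (metis surj_pair)
  note Qb = Q.birth_code_bounds[OF q[unfolded qe] j[unfolded qe]]
  note Qd = Q.death_code_bounds[OF q[unfolded qe] k[unfolded qe]]
  note Mb = M.birth_code_bounds[OF to_M(1)[OF q, unfolded g] trans[OF to_M(2)[OF q] j, unfolded g]]
  note Nd = N.death_code_bounds[OF to_N(1)[OF q, unfolded h] trans[OF to_N(2)[OF q] k, unfolded h]]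
  have bd: "ereal b < d" using q qe by (auto simp: rank_points_def)
  have eq: "b1 = b" "d2 = d" "b' = b" "d' = d" using Qb(1) Mb(1) Qd(1) Nd(1) by auto
  have "d \<le> d1" using Mb(3)[of d] bars_born_epi[OF bd] Qb(2) bd eq by auto
  moreover have "d1 \<le> d + ereal \<delta>"
  proof (rule ccontr)
    assume "\<not> ?thesis"
    then have *: "d < d1 - ereal \<delta>" by (cases d; cases d1) auto
    then have "ereal b < d1 - ereal \<delta>" using bd by order
    moreover have "d1 - ereal \<delta> + ereal \<delta> = d1" by (cases d1) auto
    ultimately have "j < bars_born rQ b (d1 - ereal \<delta>)"
      using bars_born_kernel[of b "d1 - ereal \<delta>"] Mb(2) eq by auto
    then show False using Qb(3)[OF \<open>ereal b < d1 - ereal \<delta>\<close>] * by auto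
  qed
  moreover have "b2 \<le> b" using Nd(3)[of b] bars_dying_mono[OF bd] Qd(2) bd eq by auto
  moreover have "b \<le> b2 + \<delta>"
  proof (rule ccontr)
    assume nb: "\<not> b \<le> b2 + \<delta>"
    then have *: "ereal (b2 + \<delta>) < d" using bd less_trans[of "ereal (b2 + \<delta>)" "ereal b" d] by auto
    then show False using bars_dying_cokernel[OF *] Nd(2) Qd(3)[OF *] eq nb by auto
  qed
  moreover have "d \<le> d1 + ereal \<delta>" using \<open>d \<le> d1\<close> delta by (cases d; cases d1) auto
  ultimately show ?thesis unfolding g h fst_conv eq using delta by (intro linf_dist_le) auto
qed

text \<open>If the bar were longer than \<delta>, then by \<open>bars_born_kernel\<close> more than
  \<open>j\<close> bars of the image would be born at \<open>b\<close>, where \<open>j\<close> is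
  the number of the bar; so its code would also be in use in the image.\<close>

lemma unmatched_M:
  assumes p: "((b, d), i) \<in> rank_points rM - to_M ` rank_points rQ"
  shows "d \<le> ereal (b + \<delta>)"
proof (rule ccontr)
  assume "\<not> ?thesis"
  then have *: "ereal b < d - ereal \<delta>" by (cases d) auto
  obtain b' j where j: "birth_code rM ((b, d), i) = (b', j)" by (metis surj_pair)
  have pM: "((b, d), i) \<in> rank_points rM" using p by auto
  note Mb = M.birth_code_bounds[OF pM j]
  have "d - ereal \<delta> + ereal \<delta> = d" by (cases d) auto
  then have "j < bars_born rQ b (d - ereal \<delta>)"
    using bars_born_kernel[OF *] Mb by auto
  then have "birth_code rM ((b, d), i) \<in> birth_code rQ ` rank_points rQ"
    unfolding Q.birth_code_image j using * Mb(1) by auto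
  then obtain q where q: "q \<in> rank_points rQ" "birth_code rQ q = birth_code rM ((b, d), i)" by auto
  then have "to_M q = ((b, d), i)"
    using to_M[OF q(1)] pM by (auto intro: inj_onD[OF M.inj_on_birth_code])
  then show False using p q(1) by (metis DiffD2 imageI)
qed

lemma unmatched_N:
  assumes p: "((b, d), i) \<in> rank_points rN - to_N ` rank_points rQ"
  shows "d \<le> ereal (b + \<delta>)"
proof (rule ccontr)
  assume "\<not> ?thesis"
  then have *: "ereal (b + \<delta>) < d" by simp
  obtain d' j where j: "death_code rN ((b, d), i) = (d', j)" by (metis surj_pair)
  have pN: "((b, d), i) \<in> rank_points rN" using p by auto
  note Nd = N.death_code_bounds[OF pN j]
  have "j < bars_dying rQ d (b + \<delta>)"
    using bars_dying_cokernel[OF *] Nd by auto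
  then have "death_code rN ((b, d), i) \<in> death_code rQ ` rank_points rQ"
    unfolding Q.death_code_image j using * Nd(1) by auto
  then obtain q where q: "q \<in> rank_points rQ" "death_code rQ q = death_code rN ((b, d), i)" by auto
  then have "to_N q = ((b, d), i)"
    using to_N[OF q(1)] pN by (auto intro: inj_onD[OF N.inj_on_death_code])
  then show False using p q(1) by (metis DiffD2 imageI)
qed

text \<open>Every remaining point, on the diagonal or not, dies at most \<delta> after its birth, so
  any bijection that keeps births will do. One exists because for each birth both sides are
  countable, and infinite thanks to the copies of the diagonal point.\<close>

lemma unmatched_bijection:
  "\<exists>\<psi>. bij_betw \<psi> (rank_points rM - to_M ` rank_points rQ \<union> diagonal_points)
      (rank_points rN - to_N ` rank_points rQ \<union> diagonal_points) \<and>
    (\<forall>x \<in> rank_points rM - to_M ` rank_points rQ \<union> diagonal_points.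
      linf_dist (fst x) (fst (\<psi> x)) \<le> ereal \<delta>)"
proof -
  let ?A = "rank_points rM - to_M ` rank_points rQ \<union> diagonal_points"
  let ?B = "rank_points rN - to_N ` rank_points rQ \<union> diagonal_points"
  have diag: "{x \<in> diagonal_points. fst (fst x) = b} = range (\<lambda>i. ((b, ereal b), i))" for b
    by (auto simp: diagonal_points_def)
  have inf: "infinite (range (\<lambda>i::nat. ((b, ereal b), i)))" for b
    by (rule range_inj_infinite) (auto intro: injI)
  have split: "{x \<in> P - P' \<union> diagonal_points. fst (fst x) = b} =
    {x \<in> P. fst (fst x) = b} - P' \<union> range (\<lambda>i. ((b, ereal b), i))" for P P' b
    using diag by auto
  have cnt: "countable ({x \<in> P. fst (fst x) = b} - P' \<union> range (\<lambda>i::nat. ((b, ereal b), i)))"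
    if "countable {x \<in> P. fst (fst x) = b}" for P P' and b :: real
    by (intro countable_Un countable_Diff that) simp
  have infU: "infinite (S \<union> range (\<lambda>i::nat. ((b, ereal b), i)))" for S b
    by (rule infinite_super[OF Un_upper2 inf])
  have "\<exists>f. bij_betw f {x \<in> ?A. fst (fst x) = b} {y \<in> ?B. fst (fst y) = b}" for b
    unfolding split
    by (rule bij_betw_countable_infinite[OF cnt[OF M.countable_points_fibre] infU
          cnt[OF N.countable_points_fibre] infU])
  then have "\<exists>\<psi>. \<forall>b. bij_betw (\<psi> b) {x \<in> ?A. fst (fst x) = b} {y \<in> ?B. fst (fst y) = b}"
    by (intro choice allI)
  then obtain \<psi> where \<psi>: "bij_betw (\<psi> b) {x \<in> ?A. fst (fst x) = b} {y \<in> ?B. fst (fst y) = b}"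
    for b by (elim exE) (rule that, rule spec)
  note bij = bij_betw_fibres[OF \<psi>]
  have short: "ereal b \<le> d \<and> d \<le> ereal (b + \<delta>)" if "((b, d), i) \<in> ?A \<union> ?B" for b d i
    using that unmatched_M unmatched_N delta
    by (auto simp: diagonal_points_def) (auto simp: rank_points_def less_imp_le)
  have "linf_dist (fst x) (fst (\<psi> (fst (fst x)) x)) \<le> ereal \<delta>" if x: "x \<in> ?A" for x
  proof -
    obtain b d i where xe: "x = ((b, d), i)" by (metis surj_pair)
    obtain b' d' i' where ye: "\<psi> (fst (fst x)) x = ((b', d'), i')" by (metis surj_pair)
    have "((b', d'), i') \<in> ?B" using bij_betwE[OF bij(1)] x ye by metis
    moreover have "b' = b" using bij(2)[OF x] ye xe by simp
    ultimately have "ereal b \<le> d" "d \<le> ereal (b + \<delta>)" "ereal b \<le> d'" "d' \<le> ereal (b + \<delta>)"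
      using short[of b d i] short[of b d' i'] x xe by auto
    then show ?thesis unfolding ye unfolding xe fst_conv \<open>b' = b\<close>
      using delta by (intro linf_dist_le; cases d; cases d') auto
  qed
  then show ?thesis by (intro exI conjI ballI) (rule bij(1))
qed

theorem bottleneck_bijection:
  "\<exists>\<phi>. bij_betw \<phi> (rank_points rM \<union> diagonal_points) (rank_points rN \<union> diagonal_points) \<and>
    (\<forall>x \<in> rank_points rM \<union> diagonal_points. linf_dist (fst x) (fst (\<phi> x)) \<le> ereal \<delta>)"
proof -
  let ?P = "rank_points rQ"
  let ?A = "rank_points rM - to_M ` ?P \<union> diagonal_points"
  let ?B = "rank_points rN - to_N ` ?P \<union> diagonal_points"
  obtain \<psi> where \<psi>: "bij_betw \<psi> ?A ?B"
    "\<And>x. x \<in> ?A \<Longrightarrow> linf_dist (fst x) (fst (\<psi> x)) \<le> ereal \<delta>"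
    using unmatched_bijection by (elim exE conjE) (rule that, assumption, rule bspec)
  let ?\<phi> = "\<lambda>x. if x \<in> to_M ` ?P then (to_N \<circ> inv_into ?P to_M) x else \<psi> x"
  have disj: "p \<notin> diagonal_points" if "p \<in> rank_points rM \<union> rank_points rN" for p
    using that by (auto simp: rank_points_def diagonal_points_def)
  have sub: "to_M ` ?P \<subseteq> rank_points rM" "to_N ` ?P \<subseteq> rank_points rN" using to_M to_N by auto
  have "bij_betw (to_N \<circ> inv_into ?P to_M) (to_M ` ?P) (to_N ` ?P)"
    by (rule bij_betw_trans[OF bij_betw_inv_into[OF inj_on_imp_bij_betw[OF inj_on_to_M]]
          inj_on_imp_bij_betw[OF inj_on_to_N]])
  moreover have "to_M ` ?P \<inter> ?A = {}" "to_N ` ?P \<inter> ?B = {}" using sub disj by blast+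
  ultimately have bij: "bij_betw ?\<phi> (to_M ` ?P \<union> ?A) (to_N ` ?P \<union> ?B)"
    using \<psi>(1) by - (rule bij_betw_disjoint_Un)
  have dist: "linf_dist (fst x) (fst (?\<phi> x)) \<le> ereal \<delta>" if "x \<in> to_M ` ?P \<union> ?A" for x
  proof (cases "x \<in> to_M ` ?P")
    case True
    then obtain q where "q \<in> ?P" "x = to_M q" by auto
    then show ?thesis using linf_dist_to_M_to_N inv_into_f_f[OF inj_on_to_M] True by auto
  next
    case False
    then show ?thesis using \<psi>(2)[of x] that by simp
  qed
  have "to_M ` ?P \<union> ?A = rank_points rM \<union> diagonal_points"
    "to_N ` ?P \<union> ?B = rank_points rN \<union> diagonal_points" using sub by auto
  then show ?thesis using bij dist by (intro exI[of _ ?\<phi>] conjI ballI) simp_all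
qed

end

section \<open>Chains modulo two\<close>

text \<open>These rules would turn sums in \<^typ>\<open>bit\<close> into Boolean conditions.\<close>

declare add_bit_eq_xor [simp del] mult_bit_eq_and [simp del]
  bit_not_zero_iff [simp del] bit_not_one_iff [simp del]

lemma bit_add_self [simp]: "a + a = 0" for a :: bit
  by (cases a) simp_all

text \<open>Chains indexed by the number of vertices, so that the empty simplex is allowed.\<close>

definition card_chains :: "nat \<Rightarrow> 'v set set \<Rightarrow> ('v set \<Rightarrow> bit) set" where
  "card_chains m X = {c. finite {\<sigma>. c \<sigma> \<noteq> 0} \<and> (\<forall>\<sigma>. c \<sigma> \<noteq> 0 \<longrightarrow> \<sigma> \<in> X \<and> finite \<sigma> \<and> card \<sigma> = m)}"

lemma simplicial_chains_eq: "simplicial_chains k X = card_chains (Suc k) X"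
  by (auto simp: simplicial_chains_def card_chains_def card_ge_0_finite)

lemma card_chainsD:
  assumes "c \<in> card_chains m X" "c \<sigma> \<noteq> 0"
  shows "\<sigma> \<in> X" "finite \<sigma>" "card \<sigma> = m"
  using assms by (auto simp: card_chains_def)

lemma card_chains_mono: "X \<subseteq> Y \<Longrightarrow> card_chains m X \<subseteq> card_chains m Y"
  by (auto simp: card_chains_def)

lemma zero_in_chains: "(\<lambda>_. 0) \<in> card_chains m X"
  by (simp add: card_chains_def)

lemma add_in_chains:
  assumes "c \<in> card_chains m X" "d \<in> card_chains m X"
  shows "(\<lambda>\<sigma>. c \<sigma> + d \<sigma>) \<in> card_chains m X"
proof -
  have "{\<sigma>. c \<sigma> + d \<sigma> \<noteq> 0} \<subseteq> {\<sigma>. c \<sigma> \<noteq> 0} \<union> {\<sigma>. d \<sigma> \<noteq> 0}" by auto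
  moreover have "finite \<dots>" using assms by (auto simp: card_chains_def)
  ultimately have "finite {\<sigma>. c \<sigma> + d \<sigma> \<noteq> 0}" by (rule finite_subset)
  moreover have "c \<sigma> \<noteq> 0 \<or> d \<sigma> \<noteq> 0" if "c \<sigma> + d \<sigma> \<noteq> 0" for \<sigma> using that by auto
  ultimately show ?thesis using assms unfolding card_chains_def by blast
qed

section \<open>The boundary operator\<close>

lemma finite_vertices: "c \<in> card_chains m X \<Longrightarrow> finite (\<Union>{\<sigma>. c \<sigma> \<noteq> 0})"
  by (auto simp: card_chains_def)

text \<open>The sum over the simplices of \<open>c\<close> becomes one over the vertices that extend
  \<open>\<tau>\<close>. \<open>A\<close> is left open so that the boundaries of several chains can
  be written over one index set.\<close>

lemma bd_eq_sum:
  assumes c: "c \<in> card_chains m X" and A: "finite A" "\<Union>{\<sigma>. c \<sigma> \<noteq> 0} \<subseteq> A"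
  shows "bd c \<tau> = (\<Sum>x\<in>A - \<tau>. c (insert x \<tau>))"
proof -
  let ?S = "{\<sigma>. c \<sigma> \<noteq> 0}"
  have fin: "finite ?S" using c by (auto simp: card_chains_def)
  have "bd c \<tau> = (\<Sum>\<sigma>\<in>?S. \<Sum>x\<in>\<sigma>. if \<sigma> - {x} = \<tau> then c \<sigma> else 0)"
    unfolding bd_def by (intro sum.cong refl) (auto simp: sum_distrib_left intro!: sum.cong)
  also have "\<dots> = (\<Sum>\<sigma>\<in>?S. \<Sum>x\<in>A. if x \<in> \<sigma> \<and> \<sigma> - {x} = \<tau> then c \<sigma> else 0)"
    using A by (intro sum.cong refl sum.mono_neutral_cong_left) auto
  also have "\<dots> = (\<Sum>x\<in>A. \<Sum>\<sigma>\<in>?S. if x \<in> \<sigma> \<and> \<sigma> - {x} = \<tau> then c \<sigma> else 0)"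
    by (rule sum.swap)
  also have "\<dots> = (\<Sum>x\<in>A. if x \<notin> \<tau> then c (insert x \<tau>) else 0)"
  proof (intro sum.cong refl)
    fix x
    have "(\<Sum>\<sigma>\<in>?S. if x \<in> \<sigma> \<and> \<sigma> - {x} = \<tau> then c \<sigma> else 0) =
      (\<Sum>\<sigma>\<in>?S. if \<sigma> = insert x \<tau> then (if x \<notin> \<tau> then c (insert x \<tau>) else 0) else 0)"
      by (intro sum.cong refl) auto
    then show "(\<Sum>\<sigma>\<in>?S. if x \<in> \<sigma> \<and> \<sigma> - {x} = \<tau> then c \<sigma> else 0) =
      (if x \<notin> \<tau> then c (insert x \<tau>) else 0)"
      using fin by (simp add: sum.delta)
  qed
  also have "\<dots> = (\<Sum>x\<in>A - \<tau>. c (insert x \<tau>))"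
    using A(1) by (intro sum.mono_neutral_cong_right) auto
  finally show ?thesis .
qed

lemma bd_zero: "bd (\<lambda>_. 0) = (\<lambda>_. 0)"
  by (simp add: bd_def)

lemma bd_add:
  assumes c: "c \<in> card_chains m X" and d: "d \<in> card_chains m' X'"
  shows "bd (\<lambda>\<sigma>. c \<sigma> + d \<sigma>) = (\<lambda>\<sigma>. bd c \<sigma> + bd d \<sigma>)"
proof
  fix \<tau>
  let ?A = "\<Union>{\<sigma>. c \<sigma> \<noteq> 0} \<union> \<Union>{\<sigma>. d \<sigma> \<noteq> 0}"
  have A: "finite ?A" using finite_vertices[OF c] finite_vertices[OF d] by simp
  let ?S = "{\<sigma>. c \<sigma> \<noteq> 0} \<union> {\<sigma>. d \<sigma> \<noteq> 0}"
  have "finite ?S" using c d by (auto simp: card_chains_def)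
  then have S: "bd f \<tau> = (\<Sum>\<sigma>\<in>?S. f \<sigma> * (\<Sum>x\<in>\<sigma>. of_bool (\<sigma> - {x} = \<tau>)))"
    if "{\<sigma>. f \<sigma> \<noteq> 0} \<subseteq> ?S" for f
    unfolding bd_def using that by (intro sum.mono_neutral_left) auto
  show "bd (\<lambda>\<sigma>. c \<sigma> + d \<sigma>) \<tau> = bd c \<tau> + bd d \<tau>"
    by (subst (1 2 3) S) (auto simp: sum.distrib distrib_right)
qed

lemma bd_support:
  assumes c: "c \<in> card_chains m X" and "bd c \<tau> \<noteq> 0"
  obtains x where "x \<notin> \<tau>" "c (insert x \<tau>) \<noteq> 0"
proof -
  have "bd c \<tau> = (\<Sum>x\<in>\<Union>{\<sigma>. c \<sigma> \<noteq> 0} - \<tau>. c (insert x \<tau>))"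
    by (rule bd_eq_sum[OF c finite_vertices[OF c] order_refl])
  then obtain x where "x \<in> \<Union>{\<sigma>. c \<sigma> \<noteq> 0} - \<tau>" "c (insert x \<tau>) \<noteq> 0"
    using assms(2) by (metis sum.not_neutral_contains_not_neutral)
  then show thesis using that by blast
qed

lemma bd_in_chains_faces:
  assumes c: "c \<in> card_chains (Suc m) X"
    and faces: "\<And>x \<tau>. x \<notin> \<tau> \<Longrightarrow> insert x \<tau> \<in> X \<Longrightarrow> finite \<tau> \<Longrightarrow> card \<tau> = m \<Longrightarrow> \<tau> \<in> Y"
  shows "bd c \<in> card_chains m Y"
proof -
  have *: "\<tau> \<in> Y \<and> finite \<tau> \<and> card \<tau> = m \<and> \<tau> \<subseteq> \<Union>{\<sigma>. c \<sigma> \<noteq> 0}" if nz: "bd c \<tau> \<noteq> 0" for \<tau>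
  proof -
    obtain x where x: "x \<notin> \<tau>" "c (insert x \<tau>) \<noteq> 0" using bd_support[OF c nz] .
    have "finite \<tau>" "card \<tau> = m" "insert x \<tau> \<in> X" using card_chainsD[OF c x(2)] x(1) by auto
    then show ?thesis using faces x by blast
  qed
  then have "{\<tau>. bd c \<tau> \<noteq> 0} \<subseteq> Pow (\<Union>{\<sigma>. c \<sigma> \<noteq> 0})" by auto
  then have "finite {\<tau>. bd c \<tau> \<noteq> 0}" using finite_vertices[OF c] finite_subset by blast
  then show ?thesis using * by (auto simp: card_chains_def)
qed

lemma bd_in_chains:
  assumes "c \<in> card_chains (Suc (Suc k)) X" "simplicial_complex X"
  shows "bd c \<in> card_chains (Suc k) X"
proof (rule bd_in_chains_faces[OF assms(1)])
  fix x \<tau> assume "insert x \<tau> \<in> X" "card \<tau> = Suc k"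
  then have "\<tau> \<subseteq> insert x \<tau>" "\<tau> \<noteq> {}" by auto
  then show "\<tau> \<in> X"
    using assms(2) \<open>insert x \<tau> \<in> X\<close> unfolding simplicial_complex_def by blast
qed

text \<open>The terms at \<open>(x, y)\<close> and \<open>(y, x)\<close> cancel modulo two. This is
  why the boundary of a boundary vanishes.\<close>

lemma sum_symmetric_bit:
  fixes g :: "'a \<Rightarrow> 'a \<Rightarrow> bit"
  assumes "finite A" "\<And>x y. g x y = g y x" "\<And>x. g x x = 0"
  shows "(\<Sum>x\<in>A. \<Sum>y\<in>A. g x y) = 0"
  using assms(1)
proof induction
  case (insert a A)
  have "(\<Sum>x\<in>A. g x a) = (\<Sum>y\<in>A. g a y)" using assms(2) by (intro sum.cong) auto
  then show ?case using insert assms(3) by (simp add: sum.distrib)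
qed simp

lemma bd_bd:
  assumes c: "c \<in> card_chains m X"
  shows "bd (bd c) = (\<lambda>_. 0)"
proof
  fix \<tau>
  let ?A = "\<Union>{\<sigma>. c \<sigma> \<noteq> 0}"
  have A: "finite ?A" by (rule finite_vertices[OF c])
  show "bd (bd c) \<tau> = 0"
  proof (cases m)
    case 0
    have "bd c \<tau> = 0" for \<tau>
    proof (rule ccontr)
      assume "bd c \<tau> \<noteq> 0"
      then obtain x where "c (insert x \<tau>) \<noteq> 0" using bd_support[OF c] by blast
      then show False using card_chainsD(2,3)[OF c, of "insert x \<tau>"] 0 by simp
    qed
    then have "bd c = (\<lambda>_. 0)" by (rule ext)
    then show ?thesis by (simp add: bd_zero)
  next
    case (Suc m')
    have bc: "bd c \<in> card_chains m' UNIV" using c Suc by (auto intro: bd_in_chains_faces)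
    have "\<Union>{\<sigma>. bd c \<sigma> \<noteq> 0} \<subseteq> ?A" using bd_support[OF c] by blast
    then have "bd (bd c) \<tau> = (\<Sum>x\<in>?A - \<tau>. bd c (insert x \<tau>))"
      by (rule bd_eq_sum[OF bc A])
    also have "\<dots> = (\<Sum>x\<in>?A - \<tau>. \<Sum>y\<in>?A - \<tau>. if x = y then 0 else c (insert x (insert y \<tau>)))"
    proof (intro sum.cong refl)
      fix x assume "x \<in> ?A - \<tau>"
      have "bd c (insert x \<tau>) = (\<Sum>y\<in>?A - insert x \<tau>. c (insert y (insert x \<tau>)))"
        by (rule bd_eq_sum[OF c A order_refl])
      also have "\<dots> = (\<Sum>y\<in>?A - \<tau>. if x = y then 0 else c (insert x (insert y \<tau>)))"
        using A by (intro sum.mono_neutral_cong_left) (auto simp: insert_commute)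
      finally show "bd c (insert x \<tau>) = (\<Sum>y\<in>?A - \<tau>. if x = y then 0 else c (insert x (insert y \<tau>)))" .
    qed
    also have "\<dots> = 0" using A by (intro sum_symmetric_bit) (auto simp: insert_commute)
    finally show ?thesis .
  qed
qed

text \<open>The slice of \<open>c\<close> at a set \<open>w\<close> of \<open>j\<close> vertices in
  \<open>P\<close> consists of the \<open>\<tau>\<close> off \<open>P\<close> with
  \<open>w \<union> \<tau>\<close> in \<open>c\<close>. As no simplex of \<open>c\<close> has more
  than \<open>j\<close> vertices in \<open>P\<close>, the boundary of the slice at
  \<open>\<tau>\<close> is that of \<open>c\<close> at \<open>w \<union> \<tau>\<close>, so the
  slice is a cycle. The join of \<open>w\<close> with a filling of it has, on level
  \<open>j\<close>, the join of \<open>w\<close> with the slice as its boundary; the rest of the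
  boundary has only \<open>j - 1\<close> vertices in \<open>P\<close>.\<close>

lemma peel_step:
  assumes c: "c \<in> card_chains m X" and XY: "X \<subseteq> Y"
    and top: "\<And>\<rho>. c \<rho> \<noteq> 0 \<Longrightarrow> card (\<rho> \<inter> P) \<le> j"
    and rel: "\<And>\<rho>. \<rho> \<inter> P \<noteq> {} \<Longrightarrow> bd c \<rho> = 0"
    and j: "1 \<le> j" "j \<le> m"
    and fill: "\<And>w a. w \<subseteq> P \<Longrightarrow> finite w \<Longrightarrow> card w = j \<Longrightarrow>
      a \<in> card_chains (m - j) {\<tau>. \<tau> \<inter> P = {} \<and> w \<union> \<tau> \<in> X} \<Longrightarrow> bd a = (\<lambda>_. 0) \<Longrightarrow>
      \<exists>e \<in> card_chains (Suc (m - j)) {\<tau>. \<tau> \<inter> P = {} \<and> w \<union> \<tau> \<in> Y}. bd e = a"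
  shows "\<exists>e \<in> card_chains (Suc m) Y. \<forall>\<rho>. c \<rho> + bd e \<rho> \<noteq> 0 \<longrightarrow> card (\<rho> \<inter> P) < j"
proof -
  define s where "s = (\<lambda>w \<tau>. if \<tau> \<inter> P = {} then c (w \<union> \<tau>) else 0)"
  let ?W = "{w. w \<subseteq> P \<and> finite w \<and> card w = j}"
  have cfin: "finite {\<sigma>. c \<sigma> \<noteq> 0}" using c by (auto simp: card_chains_def)
  have s_chain: "s w \<in> card_chains (m - j) {\<tau>. \<tau> \<inter> P = {} \<and> w \<union> \<tau> \<in> X}" if w: "w \<in> ?W" for w
  proof -
    have sub: "{\<tau>. s w \<tau> \<noteq> 0} \<subseteq> (\<lambda>\<sigma>. \<sigma> - P) ` {\<sigma>. c \<sigma> \<noteq> 0}"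
    proof
      fix \<tau> assume "\<tau> \<in> {\<tau>. s w \<tau> \<noteq> 0}"
      then have "\<tau> = (w \<union> \<tau>) - P" "c (w \<union> \<tau>) \<noteq> 0" using w by (auto simp: s_def split: if_splits)
      then show "\<tau> \<in> (\<lambda>\<sigma>. \<sigma> - P) ` {\<sigma>. c \<sigma> \<noteq> 0}" by blast
    qed
    have *: "\<tau> \<inter> P = {} \<and> w \<union> \<tau> \<in> X \<and> finite \<tau> \<and> card \<tau> = m - j" if st: "s w \<tau> \<noteq> 0" for \<tau>
    proof -
      have t: "\<tau> \<inter> P = {}" "c (w \<union> \<tau>) \<noteq> 0" using st by (auto simp: s_def split: if_splits)
      then have "w \<inter> \<tau> = {}" using w by auto
      then show ?thesis using card_chainsD[OF c t(2)] t(1) w by (auto simp: card_Un_disjoint)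
    qed
    have "finite {\<tau>. s w \<tau> \<noteq> 0}" using sub finite_imageI[OF cfin] by (rule finite_subset)
    then show ?thesis unfolding card_chains_def mem_Collect_eq
      by (intro conjI allI impI, assumption) (drule *, elim conjE, assumption)+
  qed
  have s_cycle: "bd (s w) = (\<lambda>_. 0)" if w: "w \<in> ?W" for w
  proof
    fix \<tau>
    let ?A = "\<Union>{\<sigma>. c \<sigma> \<noteq> 0}"
    have A: "finite ?A" by (rule finite_vertices[OF c])
    have "\<Union>{\<sigma>. s w \<sigma> \<noteq> 0} \<subseteq> ?A" by (auto simp: s_def split: if_splits) 
    then have 1: "bd (s w) \<tau> = (\<Sum>x\<in>?A - \<tau>. s w (insert x \<tau>))"
      by (rule bd_eq_sum[OF s_chain[OF w] A])
    show "bd (s w) \<tau> = 0"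
    proof (cases "\<tau> \<inter> P = {}")
      case False
      then show ?thesis unfolding 1 by (intro sum.neutral) (auto simp: s_def)
    next
      case True
      have "w \<noteq> {}" using w j by auto
      then have "(w \<union> \<tau>) \<inter> P \<noteq> {}" using w by auto
      then have "0 = bd c (w \<union> \<tau>)" by (rule rel[symmetric])
      also have "\<dots> = (\<Sum>x\<in>?A - (w \<union> \<tau>). c (insert x (w \<union> \<tau>)))"
        by (rule bd_eq_sum[OF c A order_refl])
      also have "\<dots> = (\<Sum>x\<in>?A - \<tau>. s w (insert x \<tau>))"
      proof (intro sum.mono_neutral_cong_left)
        show "finite (?A - \<tau>)" using A by simp
        show "?A - (w \<union> \<tau>) \<subseteq> ?A - \<tau>" by auto
        show "\<forall>x \<in> ?A - \<tau> - (?A - (w \<union> \<tau>)). s w (insert x \<tau>) = 0" using w by (auto simp: s_def)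
        fix x assume x: "x \<in> ?A - (w \<union> \<tau>)"
        show "c (insert x (w \<union> \<tau>)) = s w (insert x \<tau>)"
        \<comment> \<open>A further vertex in \<open>P\<close> would make \<open>j + 1\<close> of
          them, against \<open>top\<close>.\<close>
        proof (cases "x \<in> P")
          case True
          have "c (insert x (w \<union> \<tau>)) = 0"
          proof (rule ccontr)
            assume nz: "c (insert x (w \<union> \<tau>)) \<noteq> 0"
            have "insert x (w \<union> \<tau>) \<inter> P = insert x w" using True \<open>\<tau> \<inter> P = {}\<close> w by auto
            then show False using top[OF nz] w x by auto
          qed
          then show ?thesis using True by (simp add: s_def)
        qed (use True in \<open>auto simp: s_def\<close>)
      qed
      finally show ?thesis unfolding 1 by simp
    qed
  qed
  \<comment> \<open>Trivial slices receive the zero filling. Only finitely many slices are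
    non-trivial, so the chain assembled from the fillings has finite support even if
    \<open>P\<close> is infinite.\<close>
  have "\<exists>e. e \<in> card_chains (Suc (m - j)) {\<tau>. \<tau> \<inter> P = {} \<and> w \<union> \<tau> \<in> Y} \<and> bd e = s w \<and>
    (s w = (\<lambda>_. 0) \<longrightarrow> e = (\<lambda>_. 0))" if w: "w \<in> ?W" for w
  proof (cases "s w = (\<lambda>_. 0)")
    case True
    then show ?thesis by (intro exI[of _ "\<lambda>_. 0"]) (simp add: zero_in_chains bd_zero)
  qed (use fill[OF _ _ _ s_chain[OF w] s_cycle[OF w]] w in auto)
  then have "\<exists>E. \<forall>w\<in>?W. E w \<in> card_chains (Suc (m - j)) {\<tau>. \<tau> \<inter> P = {} \<and> w \<union> \<tau> \<in> Y} \<and>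
    bd (E w) = s w \<and> (s w = (\<lambda>_. 0) \<longrightarrow> E w = (\<lambda>_. 0))" by (intro bchoice ballI)
  then obtain E where "\<forall>w\<in>?W. E w \<in> card_chains (Suc (m - j)) {\<tau>. \<tau> \<inter> P = {} \<and> w \<union> \<tau> \<in> Y} \<and>
    bd (E w) = s w \<and> (s w = (\<lambda>_. 0) \<longrightarrow> E w = (\<lambda>_. 0))" ..
  then have E: "\<And>w. w \<in> ?W \<Longrightarrow> E w \<in> card_chains (Suc (m - j)) {\<tau>. \<tau> \<inter> P = {} \<and> w \<union> \<tau> \<in> Y}"
    "\<And>w. w \<in> ?W \<Longrightarrow> bd (E w) = s w" "\<And>w. w \<in> ?W \<Longrightarrow> s w = (\<lambda>_. 0) \<Longrightarrow> E w = (\<lambda>_. 0)"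
    by simp_all
  define e where "e = (\<lambda>\<rho>. if finite \<rho> \<and> card (\<rho> \<inter> P) = j then E (\<rho> \<inter> P) (\<rho> - P) else 0)"
  have e_chain: "e \<in> card_chains (Suc m) Y"
  proof -
    let ?V = "(\<lambda>\<sigma>. \<sigma> \<inter> P) ` {\<sigma>. c \<sigma> \<noteq> 0} \<inter> ?W"
    have *: "\<rho> \<in> (\<Union>w\<in>?V. (\<lambda>\<tau>. w \<union> \<tau>) ` {\<tau>. E w \<tau> \<noteq> 0}) \<and> \<rho> \<in> Y \<and> finite \<rho> \<and> card \<rho> = Suc m"
      if "e \<rho> \<noteq> 0" for \<rho>
    proof -
      have h: "finite \<rho>" "card (\<rho> \<inter> P) = j" "E (\<rho> \<inter> P) (\<rho> - P) \<noteq> 0"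
        using that by (auto simp: e_def split: if_splits)
      then have W: "\<rho> \<inter> P \<in> ?W" by auto
      have un: "(\<rho> \<inter> P) \<union> (\<rho> - P) = \<rho>" by auto
      have "s (\<rho> \<inter> P) \<noteq> (\<lambda>_. 0)" using E(3)[OF W] h(3) by auto
      then obtain \<tau> where "s (\<rho> \<inter> P) \<tau> \<noteq> 0" by auto
      then have "c ((\<rho> \<inter> P) \<union> \<tau>) \<noteq> 0" "((\<rho> \<inter> P) \<union> \<tau>) \<inter> P = \<rho> \<inter> P"
        by (auto simp: s_def split: if_splits)
      then have V: "\<rho> \<inter> P \<in> ?V" using W
        by (intro IntI image_eqI[of _ _ "(\<rho> \<inter> P) \<union> \<tau>"]) simp_all
      have "card (\<rho> - P) = Suc (m - j)" "\<rho> \<in> Y"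
        using card_chainsD[OF E(1)[OF W] h(3)] by (simp_all add: un)
      moreover have "card \<rho> = card (\<rho> \<inter> P) + card (\<rho> - P)"
        using h(1) card_Int_Diff by metis
      moreover have "\<rho> \<in> (\<Union>w\<in>?V. (\<lambda>\<tau>. w \<union> \<tau>) ` {\<tau>. E w \<tau> \<noteq> 0})"
        using h(3) by (intro UN_I[OF V] image_eqI[of _ _ "\<rho> - P"]) (auto simp: un)
      ultimately show ?thesis using h(1,2) j by simp
    qed
    then have "{\<rho>. e \<rho> \<noteq> 0} \<subseteq> (\<Union>w\<in>?V. (\<lambda>\<tau>. w \<union> \<tau>) ` {\<tau>. E w \<tau> \<noteq> 0})" by blast
    moreover have "finite (\<Union>w\<in>?V. (\<lambda>\<tau>. w \<union> \<tau>) ` {\<tau>. E w \<tau> \<noteq> 0})"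
    proof (intro finite_UN_I finite_imageI)
      show "finite ?V" using cfin by simp
      show "finite {\<tau>. E w \<tau> \<noteq> 0}" if "w \<in> ?V" for w
        using E(1)[OF IntD2[OF that]] unfolding card_chains_def mem_Collect_eq by (rule conjunct1)
    qed
    ultimately have "finite {\<rho>. e \<rho> \<noteq> 0}" by (rule finite_subset)
    then show ?thesis unfolding card_chains_def mem_Collect_eq
      by (intro conjI allI impI, assumption) (drule *, elim conjE, assumption)+
  qed
  have "card (\<rho> \<inter> P) < j" if nz: "c \<rho> + bd e \<rho> \<noteq> 0" for \<rho>
  proof (rule ccontr)
    assume nl: "\<not> card (\<rho> \<inter> P) < j"
    show False
    proof (cases "finite \<rho> \<and> card (\<rho> \<inter> P) = j")
      case True
      then have W: "\<rho> \<inter> P \<in> ?W" by auto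
      let ?A = "\<Union>{\<sigma>. e \<sigma> \<noteq> 0} \<union> \<Union>{\<sigma>. E (\<rho> \<inter> P) \<sigma> \<noteq> 0}"
      have A: "finite ?A" using finite_vertices[OF e_chain] finite_vertices[OF E(1)[OF W]] by simp
      have "bd e \<rho> = (\<Sum>x\<in>?A - \<rho>. e (insert x \<rho>))"
        by (rule bd_eq_sum[OF e_chain A]) auto
      also have "\<dots> = (\<Sum>x\<in>?A - (\<rho> - P). E (\<rho> \<inter> P) (insert x (\<rho> - P)))"
      proof (rule sum.mono_neutral_cong_left)
        show "finite (?A - (\<rho> - P))" using A by simp
        show "?A - \<rho> \<subseteq> ?A - (\<rho> - P)" by auto
        have off: "E (\<rho> \<inter> P) (insert x (\<rho> - P)) = 0" if "x \<in> P" for x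
          using card_chainsD(1)[OF E(1)[OF W], of "insert x (\<rho> - P)"] that by blast
        then show "\<forall>x\<in>?A - (\<rho> - P) - (?A - \<rho>). E (\<rho> \<inter> P) (insert x (\<rho> - P)) = 0" by auto
        fix x assume x: "x \<in> ?A - \<rho>"
        show "e (insert x \<rho>) = E (\<rho> \<inter> P) (insert x (\<rho> - P))"
        proof (cases "x \<in> P")
          case True
          then have "insert x \<rho> \<inter> P = insert x (\<rho> \<inter> P)" by auto
          then show ?thesis using x W off[OF True] by (simp add: e_def)
        next
          case False
          then have "insert x \<rho> \<inter> P = \<rho> \<inter> P" "insert x \<rho> - P = insert x (\<rho> - P)" by auto
          then show ?thesis using \<open>finite \<rho> \<and> card (\<rho> \<inter> P) = j\<close> by (simp add: e_def)
        qed
      qed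
      also have "\<dots> = bd (E (\<rho> \<inter> P)) (\<rho> - P)"
        by (rule bd_eq_sum[OF E(1)[OF W] A, symmetric]) auto
      also have "\<dots> = s (\<rho> \<inter> P) (\<rho> - P)" using E(2)[OF W] by simp
      also have "\<dots> = c \<rho>"
      proof -
        have "(\<rho> - P) \<inter> P = {}" "(\<rho> \<inter> P) \<union> (\<rho> - P) = \<rho>" by auto
        then show ?thesis by (simp add: s_def)
      qed
      finally show False using nz by simp
    next
      case False
      \<comment> \<open>Here \<open>\<rho>\<close> is infinite or has more than \<open>j\<close>
        vertices in \<open>P\<close>, hence is no face of a simplex of \<open>e\<close>: these are
        finite and have exactly \<open>j\<close>.\<close>
      then have "c \<rho> = 0" using nl top[of \<rho>] card_chainsD(2)[OF c, of \<rho>] by force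
      then have "bd e \<rho> \<noteq> 0" using nz by simp
      then obtain x where x: "x \<notin> \<rho>" "e (insert x \<rho>) \<noteq> 0" using bd_support[OF e_chain] by blast
      then have "finite \<rho>" "card (insert x \<rho> \<inter> P) = j" by (auto simp: e_def split: if_splits)
      moreover have "card (\<rho> \<inter> P) \<le> card (insert x \<rho> \<inter> P)"
        using \<open>finite \<rho>\<close> by (intro card_mono) auto
      ultimately show False using False nl by simp
    qed
  qed
  then show ?thesis using e_chain by blast
qed

text \<open>A relative cycle is pushed off the vertex set \<open>P\<close>, one level of \<open>card (\<rho> \<inter> P)\<close> at a time.\<close>

lemma peel:
  assumes cx: "\<And>j. simplicial_complex (Z j)"
    and Z: "\<And>j. 1 \<le> j \<Longrightarrow> j \<le> m \<Longrightarrow> Z (Suc j) \<subseteq> Z j"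
    and fill: "\<And>j w a. 1 \<le> j \<Longrightarrow> j \<le> m \<Longrightarrow> w \<subseteq> P \<Longrightarrow> finite w \<Longrightarrow> card w = j \<Longrightarrow>
      a \<in> card_chains (m - j) {\<tau>. \<tau> \<inter> P = {} \<and> w \<union> \<tau> \<in> Z (Suc j)} \<Longrightarrow> bd a = (\<lambda>_. 0) \<Longrightarrow>
      \<exists>e \<in> card_chains (Suc (m - j)) {\<tau>. \<tau> \<inter> P = {} \<and> w \<union> \<tau> \<in> Z j}. bd e = a"
    and m: "1 \<le> m" and c: "c \<in> card_chains m (Z (Suc m))"
    and rel: "\<And>\<rho>. \<rho> \<inter> P \<noteq> {} \<Longrightarrow> bd c \<rho> = 0"
  shows "\<exists>e \<in> card_chains (Suc m) (Z 1).
    (\<lambda>\<rho>. c \<rho> + bd e \<rho>) \<in> card_chains m {\<rho> \<in> Z 1. \<rho> \<inter> P = {}}"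
proof -
  obtain k where k: "m = Suc k" using m by (cases m) auto
  have bd_chain: "bd e \<in> card_chains m (Z j)" if "e \<in> card_chains (Suc m) (Z j)" for e j
    using bd_in_chains[OF _ cx] that k by simp
  \<comment> \<open>The index runs down from \<open>m\<close> to 0. Chains with at most
    \<open>j\<close> vertices in \<open>P\<close> live in \<open>Z (Suc j)\<close>, and clearing
    level \<open>Suc j\<close> leads from \<open>Z (Suc (Suc j))\<close> to
    \<open>Z (Suc j)\<close>.\<close>
  have "(\<exists>e \<in> card_chains (Suc m) (Z (Suc j)). (\<lambda>\<rho>. c \<rho> + bd e \<rho>) \<in> card_chains m (Z (Suc j)) \<and>
    (\<forall>\<rho>. c \<rho> + bd e \<rho> \<noteq> 0 \<longrightarrow> card (\<rho> \<inter> P) \<le> j))" if "j \<le> m" for j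
    using that
  proof (induction j rule: inc_induct)
    case base
    have "card (\<rho> \<inter> P) \<le> m" if "c \<rho> \<noteq> 0" for \<rho>
      using card_chainsD[OF c that] card_mono[of \<rho> "\<rho> \<inter> P"] by auto
    then show ?case using c by (intro bexI[of _ "\<lambda>_. 0"]) (auto simp: bd_zero zero_in_chains)
  next
    case (step j)
    then obtain e where e: "e \<in> card_chains (Suc m) (Z (Suc (Suc j)))"
      "(\<lambda>\<rho>. c \<rho> + bd e \<rho>) \<in> card_chains m (Z (Suc (Suc j)))"
      "\<And>\<rho>. c \<rho> + bd e \<rho> \<noteq> 0 \<Longrightarrow> card (\<rho> \<inter> P) \<le> Suc j" by blast
    have sub: "Z (Suc (Suc j)) \<subseteq> Z (Suc j)" using step Z by simp
    \<comment> \<open>Adding a boundary leaves the boundary as it was, so the chain is still a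
      relative cycle.\<close>
    have bdc: "bd (\<lambda>\<rho>. c \<rho> + bd e \<rho>) = bd c"
      using bd_add[OF c bd_chain[OF e(1)]] bd_bd[OF e(1)] by simp
    have "\<exists>e' \<in> card_chains (Suc m) (Z (Suc j)). \<forall>\<rho>. (c \<rho> + bd e \<rho>) + bd e' \<rho> \<noteq> 0 \<longrightarrow> card (\<rho> \<inter> P) < Suc j"
      using step fill rel by (intro peel_step[OF e(2) sub e(3)]) (auto simp: bdc)
    then obtain e' where e': "e' \<in> card_chains (Suc m) (Z (Suc j))"
      "\<And>\<rho>. (c \<rho> + bd e \<rho>) + bd e' \<rho> \<noteq> 0 \<Longrightarrow> card (\<rho> \<inter> P) < Suc j" by blast
    have e1: "e \<in> card_chains (Suc m) (Z (Suc j))" using e(1) card_chains_mono[OF sub] by blast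
    have "(\<lambda>\<rho>. (c \<rho> + bd e \<rho>) + bd e' \<rho>) \<in> card_chains m (Z (Suc j))"
      by (rule add_in_chains[OF subsetD[OF card_chains_mono[OF sub] e(2)] bd_chain[OF e'(1)]])
    then show ?case
      using e'(2) add_in_chains[OF e1 e'(1)]
      by (intro bexI[of _ "\<lambda>\<sigma>. e \<sigma> + e' \<sigma>"]) (auto simp: bd_add[OF e1 e'(1)] add.assoc less_Suc_eq_le)
  qed
  from this[of 0] obtain e where e: "e \<in> card_chains (Suc m) (Z 1)"
    "(\<lambda>\<rho>. c \<rho> + bd e \<rho>) \<in> card_chains m (Z 1)" "\<And>\<rho>. c \<rho> + bd e \<rho> \<noteq> 0 \<Longrightarrow> card (\<rho> \<inter> P) = 0" by auto
  have "\<rho> \<inter> P = {}" if "c \<rho> + bd e \<rho> \<noteq> 0" for \<rho>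
    using e(3)[OF that] card_chainsD(2)[OF e(2) that] by simp
  then have "(\<lambda>\<rho>. c \<rho> + bd e \<rho>) \<in> card_chains m {\<rho> \<in> Z 1. \<rho> \<inter> P = {}}"
    using e(2) by (auto simp: card_chains_def)
  then show ?thesis using e(1) by blast
qed

section \<open>Transport of chains along an injective vertex map\<close>

definition push :: "('a \<Rightarrow> 'b) \<Rightarrow> ('a set \<Rightarrow> bit) \<Rightarrow> 'b set \<Rightarrow> bit" where
  "push g c = (\<lambda>\<rho>. if \<rho> \<subseteq> range g then c (g -` \<rho>) else 0)"

lemma push_image: "inj g \<Longrightarrow> push g c (g ` \<sigma>) = c \<sigma>"
  by (auto simp: push_def inj_vimage_image_eq)

lemma push_nonzeroE:
  assumes "push g c \<rho> \<noteq> 0"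
  obtains \<sigma> where "\<rho> = g ` \<sigma>" "c \<sigma> \<noteq> 0"
proof -
  have "\<rho> \<subseteq> range g" "c (g -` \<rho>) \<noteq> 0" using assms by (auto simp: push_def split: if_splits)
  moreover have "\<rho> = g ` (g -` \<rho>)" using \<open>\<rho> \<subseteq> range g\<close> by auto
  ultimately show thesis using that by blast
qed

lemma inj_push: "inj g \<Longrightarrow> inj (push g)"
  by (rule injI) (metis push_image ext)

lemma push_zero: "push g (\<lambda>_. 0) = (\<lambda>_. 0)"
  by (auto simp: push_def)

lemma push_add: "push g (\<lambda>\<sigma>. c \<sigma> + d \<sigma>) = (\<lambda>\<rho>. push g c \<rho> + push g d \<rho>)"
  by (auto simp: push_def)

lemma push_in_chains:
  assumes g: "inj g" and c: "c \<in> card_chains m X"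
  shows "push g c \<in> card_chains m ((`) g ` X)"
proof -
  have "{\<rho>. push g c \<rho> \<noteq> 0} \<subseteq> (`) g ` {\<sigma>. c \<sigma> \<noteq> 0}" by (auto elim: push_nonzeroE)
  moreover have "finite ((`) g ` {\<sigma>. c \<sigma> \<noteq> 0})" using c unfolding card_chains_def by simp
  ultimately have "finite {\<rho>. push g c \<rho> \<noteq> 0}" by (rule finite_subset)
  moreover have "\<rho> \<in> (`) g ` X \<and> finite \<rho> \<and> card \<rho> = m" if nz: "push g c \<rho> \<noteq> 0" for \<rho>
  proof -
    obtain \<sigma> where "\<rho> = g ` \<sigma>" "c \<sigma> \<noteq> 0" using push_nonzeroE[OF nz] .
    then show ?thesis
      using card_chainsD[OF c] card_image[OF inj_on_subset[OF g subset_UNIV], of \<sigma>] by auto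
  qed
  ultimately show ?thesis unfolding card_chains_def by simp
qed

lemma card_chains_image:
  assumes g: "inj g"
  shows "card_chains m ((`) g ` X) = push g ` card_chains m X"
proof (intro equalityI subsetI)
  fix d assume d: "d \<in> card_chains m ((`) g ` X)"
  let ?c = "\<lambda>\<sigma>. d (g ` \<sigma>)"
  have inj: "inj ((`) g)" by (rule injI) (simp add: inj_image_eq_iff[OF g])
  have "(`) g ` {\<sigma>. ?c \<sigma> \<noteq> 0} \<subseteq> {\<rho>. d \<rho> \<noteq> 0}" by auto
  moreover have "finite {\<rho>. d \<rho> \<noteq> 0}" using d unfolding card_chains_def by simp
  ultimately have "finite ((`) g ` {\<sigma>. ?c \<sigma> \<noteq> 0})" by (rule finite_subset)
  then have "finite {\<sigma>. ?c \<sigma> \<noteq> 0}"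
    by (rule finite_imageD[OF _ inj_on_subset[OF inj subset_UNIV]])
  moreover have "\<sigma> \<in> X \<and> finite \<sigma> \<and> card \<sigma> = m" if nz: "?c \<sigma> \<noteq> 0" for \<sigma>
  proof -
    have ig: "inj_on g \<sigma>" by (rule inj_on_subset[OF g subset_UNIV])
    have "\<sigma> \<in> X" using card_chainsD(1)[OF d nz] by (rule inj_image_mem_iff[OF inj, THEN iffD1])
    moreover have "finite \<sigma>" using card_chainsD(2)[OF d nz] ig by (rule finite_imageD)
    moreover have "card \<sigma> = m" using card_chainsD(3)[OF d nz] card_image[OF ig] by metis
    ultimately show ?thesis by iprover
  qed
  ultimately have c: "?c \<in> card_chains m X" unfolding card_chains_def by (intro CollectI conjI allI impI) iprover+
  have "d = push g ?c"
  proof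
    fix \<rho>
    show "d \<rho> = push g ?c \<rho>"
    proof (cases "\<rho> \<subseteq> range g")
      case True
      then have "g ` (g -` \<rho>) = \<rho>" by auto
      then show ?thesis using True by (simp add: push_def)
    next
      case False
      then have "d \<rho> = 0" using card_chainsD(1)[OF d, of \<rho>] by blast
      then show ?thesis using False by (simp add: push_def)
    qed
  qed
  then show "d \<in> push g ` card_chains m X" using c by (rule image_eqI)
qed (auto intro: push_in_chains[OF g])

lemma bd_push:
  assumes g: "inj g" and c: "c \<in> card_chains m X"
  shows "bd (push g c) = push g (bd c)"
proof
  fix \<rho>
  let ?A = "\<Union>{\<sigma>. c \<sigma> \<noteq> 0}"
  have A: "finite ?A" by (rule finite_vertices[OF c])
  have "\<Union>{\<rho>. push g c \<rho> \<noteq> 0} \<subseteq> g ` ?A" by (auto elim!: push_nonzeroE)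
  then have 1: "bd (push g c) \<rho> = (\<Sum>y\<in>g ` ?A - \<rho>. push g c (insert y \<rho>))"
    by (rule bd_eq_sum[OF push_in_chains[OF g c] finite_imageI[OF A]])
  show "bd (push g c) \<rho> = push g (bd c) \<rho>"
  proof (cases "\<rho> \<subseteq> range g")
    case True
    define \<sigma> where "\<sigma> = g -` \<rho>"
    have \<rho>: "\<rho> = g ` \<sigma>" using True by (auto simp: \<sigma>_def)
    have "bd (push g c) \<rho> = (\<Sum>y\<in>g ` (?A - \<sigma>). push g c (insert y \<rho>))"
      using 1 unfolding \<rho> image_set_diff[OF g, symmetric] .
    also have "\<dots> = (\<Sum>x\<in>?A - \<sigma>. push g c (insert (g x) \<rho>))"
      using g by (intro sum.reindex_cong[of g]) (auto intro: inj_on_subset)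
    also have "\<dots> = (\<Sum>x\<in>?A - \<sigma>. c (insert x \<sigma>))"
      unfolding \<rho> image_insert[symmetric] push_image[OF g] ..
    also have "\<dots> = bd c \<sigma>" by (rule bd_eq_sum[OF c A order_refl, symmetric])
    finally show ?thesis unfolding \<rho> push_image[OF g] .
  next
    case False
    then show ?thesis unfolding 1 by (simp add: push_def)
  qed
qed

lemma bd_push_eq_zero:
  assumes "inj g" "c \<in> card_chains m X"
  shows "bd (push g c) = (\<lambda>_. 0) \<longleftrightarrow> bd c = (\<lambda>_. 0)"
  using inj_eq[OF inj_push[OF assms(1)], of "bd c" "\<lambda>_. 0"] by (simp add: bd_push[OF assms] push_zero)

lemma cycles_image:
  assumes "inj g"
  shows "cycles k ((`) g ` X) = push g ` cycles k X"
  unfolding cycles_def simplicial_chains_eq card_chains_image[OF assms]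
  using bd_push_eq_zero[OF assms] by auto

lemma boundaries_image:
  assumes "inj g"
  shows "boundaries k ((`) g ` X) = push g ` boundaries k X"
  unfolding boundaries_def simplicial_chains_eq card_chains_image[OF assms] image_image
  by (intro image_cong refl) (simp add: bd_push[OF assms])

section \<open>Fillings from goodness and from cones\<close>

lemma zero_in_boundaries: "(\<lambda>_. 0) \<in> boundaries k X"
  unfolding boundaries_def simplicial_chains_eq
  by (rule image_eqI[where x = "\<lambda>_. 0"]) (simp_all add: bd_zero zero_in_chains)

text \<open>The class of \<open>z\<close> is sent to the coset that consists of the boundaries of
  the later intersection, and \<open>z\<close> lies in the image of its own class because the zero
  chain is a boundary.\<close>

lemma reduced_cycle_bounds:
  fixes U :: "nat \<Rightarrow> real \<Rightarrow> 'a set set"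
  assumes "eps_good_cover \<epsilon> n U" "v \<noteq> {}" "v \<subseteq> {..n}" "0 \<le> \<alpha>"
    and z: "z \<in> reduced_cycles k (\<Inter>i\<in>v. U i \<alpha>)"
  shows "z \<in> boundaries k (\<Inter>i\<in>v. U i (\<alpha> + \<epsilon>))"
proof -
  let ?A = "\<Inter>i\<in>v. U i \<alpha>" and ?B = "\<Inter>i\<in>v. U i (\<alpha> + \<epsilon>)"
  let ?C = "boundaries k ?A +>\<^bsub>function_space (reduced_cycles k ?A)\<^esub> z"
  have C: "?C = (\<Union>b\<in>boundaries k ?A. {\<lambda>\<sigma>. b \<sigma> + z \<sigma>})"
    by (simp add: function_space_def a_r_coset_def r_coset_def)
  have "?C \<in> carrier (reduced_homology k ?A)"
    using z by (auto simp: reduced_homology_def quotient_space_def function_space_def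
        A_RCOSETS_def RCOSETS_def a_r_coset_def)
  then have "inclusion_map k ?B ?C = boundaries k ?B"
    using assms(1-4) unfolding eps_good_cover_def
    by (simp add: reduced_homology_def quotient_space_def)
  moreover note zero = zero_in_boundaries
  have "z \<in> ?C" unfolding C by (rule UN_I[OF zero]) simp
  then have "z \<in> inclusion_map k ?B ?C"
    unfolding inclusion_map_def set_add_def set_mult_def
    by (intro UN_I[OF zero] UN_I[of z]) (simp_all add: function_space_def)
  ultimately show ?thesis by simp
qed

lemma bd_point: "bd (\<lambda>\<rho>. if \<rho> = {x} then 1 else 0) = (\<lambda>\<rho>. if \<rho> = {} then 1 else 0)"
proof
  fix \<tau> :: "'a set"
  have *: "{\<sigma>. (if \<sigma> = {x} then 1 else 0) \<noteq> (0::bit)} = {{x}}" by auto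
  show "bd (\<lambda>\<rho>. if \<rho> = {x} then 1 else 0) \<tau> = (if \<tau> = {} then 1 else 0)"
    unfolding bd_def * by auto
qed

text \<open>\<open>a\<close> may contain simplices through the apex; only those avoiding it are
  coned, since \<open>\<rho> - {x}\<close> never contains \<open>x\<close>. Away from
  \<open>x\<close> the boundary of \<open>e\<close> is plainly \<open>a\<close>; on a simplex
  through \<open>x\<close> the equation is the vanishing of the boundary of \<open>a\<close> on the
  face opposite \<open>x\<close>.\<close>

lemma bd_cone:
  fixes x :: 'a
  assumes a: "a \<in> card_chains m X" and cyc: "bd a = (\<lambda>_. 0)"
  defines "e \<equiv> \<lambda>\<rho>. if x \<in> \<rho> then a (\<rho> - {x}) else 0"
  shows "e \<in> card_chains (Suc m) {\<rho>. x \<in> \<rho> \<and> \<rho> - {x} \<in> X}" "bd e = a"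
proof -
  have "{\<rho>. e \<rho> \<noteq> 0} \<subseteq> insert x ` {\<sigma>. a \<sigma> \<noteq> 0}"
  proof
    fix \<rho> assume "\<rho> \<in> {\<rho>. e \<rho> \<noteq> 0}"
    then have "\<rho> = insert x (\<rho> - {x})" "a (\<rho> - {x}) \<noteq> 0" by (auto simp: e_def split: if_splits)
    then show "\<rho> \<in> insert x ` {\<sigma>. a \<sigma> \<noteq> 0}" by blast
  qed
  moreover have fin: "finite {\<sigma>. a \<sigma> \<noteq> 0}" using a unfolding card_chains_def by simp
  ultimately have "finite {\<rho>. e \<rho> \<noteq> 0}" using finite_subset[OF _ finite_imageI] by metis
  moreover have "(x \<in> \<rho> \<and> \<rho> - {x} \<in> X) \<and> finite \<rho> \<and> card \<rho> = Suc m" if nz: "e \<rho> \<noteq> 0" for \<rho>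
  proof -
    have x: "x \<in> \<rho>" "a (\<rho> - {x}) \<noteq> 0" using nz by (auto simp: e_def split: if_splits)
    then show ?thesis using card_chainsD[OF a x(2)] card_Suc_Diff1[of \<rho> x] by auto
  qed
  ultimately show e: "e \<in> card_chains (Suc m) {\<rho>. x \<in> \<rho> \<and> \<rho> - {x} \<in> X}"
    unfolding card_chains_def by simp
  show "bd e = a"
  proof
    fix \<rho>
    let ?A = "insert x (\<Union>{\<sigma>. a \<sigma> \<noteq> 0} \<union> \<Union>{\<sigma>. e \<sigma> \<noteq> 0})"
    have A: "finite ?A" using finite_vertices[OF a] finite_vertices[OF e] by simp
    have 1: "bd e \<rho> = (\<Sum>y\<in>?A - \<rho>. e (insert y \<rho>))" by (rule bd_eq_sum[OF e A]) auto
    show "bd e \<rho> = a \<rho>"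
    proof (cases "x \<in> \<rho>")
      case False
      have "bd e \<rho> = (\<Sum>y\<in>?A - \<rho>. if y = x then a \<rho> else 0)"
        unfolding 1 using False by (intro sum.cong refl) (auto simp: e_def)
      then show ?thesis using A False by simp
    next
      case True
      have "0 = bd a (\<rho> - {x})" using cyc by simp
      also have "\<dots> = (\<Sum>y\<in>?A - (\<rho> - {x}). a (insert y (\<rho> - {x})))"
        by (rule bd_eq_sum[OF a A]) auto
      also have "?A - (\<rho> - {x}) = insert x (?A - \<rho>)" using True by auto
      also have "(\<Sum>y\<in>insert x (?A - \<rho>). a (insert y (\<rho> - {x}))) =
        a \<rho> + (\<Sum>y\<in>?A - \<rho>. a (insert y (\<rho> - {x})))"
        using A True by (subst sum.insert) (auto simp: insert_absorb)
      also have "(\<Sum>y\<in>?A - \<rho>. a (insert y (\<rho> - {x}))) = bd e \<rho>"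
        unfolding 1
      proof (intro sum.cong refl)
        fix y assume "y \<in> ?A - \<rho>"
        then have "insert y \<rho> - {x} = insert y (\<rho> - {x})" using True by auto
        then show "a (insert y (\<rho> - {x})) = e (insert y \<rho>)" using True by (simp add: e_def)
      qed
      finally have "a \<rho> + bd e \<rho> = 0" by simp
      then show ?thesis by (cases "a \<rho>"; cases "bd e \<rho>") auto
    qed
  qed
qed

section \<open>Ranks of quotient spaces\<close>

text \<open>Over the field with two elements closure under scalars is automatic.\<close>

definition bit_subspace :: "('a \<Rightarrow> bit) set \<Rightarrow> bool" where
  "bit_subspace S \<longleftrightarrow> (\<lambda>_. 0) \<in> S \<and> (\<forall>a\<in>S. \<forall>b\<in>S. (\<lambda>x. a x + b x) \<in> S)"

definition coset :: "('a \<Rightarrow> bit) set \<Rightarrow> ('a \<Rightarrow> bit) \<Rightarrow> ('a \<Rightarrow> bit) set" where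
  "coset B z = (\<lambda>b x. b x + z x) ` B"

definition quotient_image :: "('a \<Rightarrow> bit) set \<Rightarrow> ('a \<Rightarrow> bit) set \<Rightarrow> ('a \<Rightarrow> bit) set \<Rightarrow>
    (bit, ('a \<Rightarrow> bit) set) module" where
  "quotient_image Z B S = quotient_space (function_space Z) B \<lparr>carrier := coset B ` S\<rparr>"

text \<open>The dimension of (S + B)/B. With the cycles of one complex for \<open>S\<close> and the
  boundaries of a larger one for \<open>B\<close>, it is the rank of the map induced in homology.
  The ambient space is that of all functions, so that the number depends on \<open>S\<close> and
  \<open>B\<close> only.\<close>

definition quotient_rank :: "('a \<Rightarrow> bit) set \<Rightarrow> ('a \<Rightarrow> bit) set \<Rightarrow> nat" where
  "quotient_rank S B = vectorspace.dim class_ring (quotient_image UNIV B S)"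

definition sum_space :: "('a \<Rightarrow> bit) set \<Rightarrow> ('a \<Rightarrow> bit) set \<Rightarrow> ('a \<Rightarrow> bit) set" where
  "sum_space S T = {\<lambda>x. a x + b x | a b. a \<in> S \<and> b \<in> T}"

lemma sum_spaceI: "a \<in> S \<Longrightarrow> b \<in> T \<Longrightarrow> w = (\<lambda>x. a x + b x) \<Longrightarrow> w \<in> sum_space S T"
  by (auto simp: sum_space_def)

lemma sum_spaceE:
  assumes "w \<in> sum_space S T"
  obtains a b where "a \<in> S" "b \<in> T" "w = (\<lambda>x. a x + b x)"
  using assms by (auto simp: sum_space_def)

lemma set_add_function_space: "S <+>\<^bsub>function_space Z\<^esub> T = sum_space S T"
  unfolding set_add_def set_mult_def sum_space_def by (auto simp: function_space_def)

lemma bit_subspace_zero: "bit_subspace S \<Longrightarrow> (\<lambda>_. 0) \<in> S"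
  and bit_subspace_add: "bit_subspace S \<Longrightarrow> a \<in> S \<Longrightarrow> b \<in> S \<Longrightarrow> (\<lambda>x. a x + b x) \<in> S"
  by (auto simp: bit_subspace_def)

lemma bit_subspace_Int: "bit_subspace S \<Longrightarrow> bit_subspace T \<Longrightarrow> bit_subspace (S \<inter> T)"
  by (auto simp: bit_subspace_def)

lemma bit_add_cancel [simp]: "a + (a + b) = b" "(b + a) + a = b" for a b :: bit
  by (simp_all add: add.assoc flip: add.assoc[of a a b])

lemma mem_coset: "y \<in> coset B z \<longleftrightarrow> (\<lambda>x. y x + z x) \<in> B"
proof
  assume "(\<lambda>x. y x + z x) \<in> B"
  then show "y \<in> coset B z"
    unfolding coset_def by (rule image_eqI[rotated]) simp
qed (auto simp: coset_def)

lemma coset_eq_iff: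
  assumes "bit_subspace B"
  shows "coset B z = coset B z' \<longleftrightarrow> (\<lambda>x. z x + z' x) \<in> B"
proof
  have "z \<in> coset B z" using bit_subspace_zero[OF assms] by (simp add: mem_coset)
  moreover assume "coset B z = coset B z'"
  ultimately show "(\<lambda>x. z x + z' x) \<in> B" by (simp add: mem_coset)
next
  assume h: "(\<lambda>x. z x + z' x) \<in> B"
  have *: "(\<lambda>x. y x + z x) \<in> B \<longleftrightarrow> (\<lambda>x. y x + z' x) \<in> B" for y
  proof
    assume "(\<lambda>x. y x + z x) \<in> B"
    from bit_subspace_add[OF assms this h] show "(\<lambda>x. y x + z' x) \<in> B" by (simp add: add.assoc)
  next
    assume "(\<lambda>x. y x + z' x) \<in> B"
    from bit_subspace_add[OF assms this h] show "(\<lambda>x. y x + z x) \<in> B"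
      by (simp add: add.assoc add.commute[of "z _"])
  qed
  show "coset B z = coset B z'" by (auto simp: mem_coset *)
qed

lemma coset_zero: "coset B (\<lambda>_. 0) = B"
  by (simp add: coset_def)

lemma set_add_coset:
  assumes "bit_subspace B"
  shows "coset B y <+>\<^bsub>function_space Z\<^esub> coset B z = coset B (\<lambda>x. y x + z x)"
  unfolding set_add_function_space
proof (intro equalityI subsetI)
  fix w assume "w \<in> sum_space (coset B y) (coset B z)"
  then obtain a b where "a \<in> coset B y" "b \<in> coset B z" and w: "w = (\<lambda>x. a x + b x)"
    by (rule sum_spaceE)
  then have "(\<lambda>x. a x + y x) \<in> B" "(\<lambda>x. b x + z x) \<in> B" by (simp_all add: mem_coset)
  from bit_subspace_add[OF assms this] show "w \<in> coset B (\<lambda>x. y x + z x)"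
    by (simp add: mem_coset w ac_simps)
next
  fix w assume "w \<in> coset B (\<lambda>x. y x + z x)"
  then have "(\<lambda>x. w x + z x) \<in> coset B y" by (simp add: mem_coset ac_simps)
  moreover have "z \<in> coset B z" using bit_subspace_zero[OF assms] by (simp add: mem_coset)
  ultimately show "w \<in> sum_space (coset B y) (coset B z)" by (rule sum_spaceI) simp
qed

lemma a_r_coset_function_space: "B +>\<^bsub>function_space Z\<^esub> z = coset B z"
  by (auto simp: a_r_coset_def r_coset_def function_space_def coset_def)

lemma smult_coset:
  assumes "bit_subspace B"
  shows "a \<odot>\<^bsub>quotient_image Z B S\<^esub> coset B z = coset B (\<lambda>x. a * z x)"
proof -
  have "a \<odot>\<^bsub>quotient_image Z B S\<^esub> coset B z = (\<Union>y\<in>coset B z. coset B (\<lambda>x. a * y x))"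
    unfolding quotient_image_def quotient_space_def
    by (simp add: a_r_coset_function_space) (simp add: function_space_def)
  also have "\<dots> = coset B (\<lambda>x. a * z x)"
  proof -
    have "coset B (\<lambda>x. a * y x) = coset B (\<lambda>x. a * z x)" if "y \<in> coset B z" for y
    proof (subst coset_eq_iff[OF assms])
      show "(\<lambda>x. a * y x + a * z x) \<in> B"
        using that bit_subspace_zero[OF assms] by (cases a) (auto simp: mem_coset)
    qed
    moreover have "z \<in> coset B z" using bit_subspace_zero[OF assms] by (simp add: mem_coset)
    ultimately show ?thesis by blast
  qed
  finally show ?thesis .
qed

section \<open>Dimensions by counting elements\<close>

lemma vectorspace_quotient_image:
  assumes B: "bit_subspace B" and S: "bit_subspace S"
  shows "vectorspace class_ring (quotient_image Z B S)"
proof -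
  let ?G = "quotient_image Z B S"
  have car: "carrier ?G = coset B ` S" by (simp add: quotient_image_def)
  have zero: "\<zero>\<^bsub>?G\<^esub> = coset B (\<lambda>_. 0)"
    by (simp add: quotient_image_def quotient_space_def coset_zero)
  have add: "coset B y \<oplus>\<^bsub>?G\<^esub> coset B z = coset B (\<lambda>x. y x + z x)" for y z
    using set_add_coset[OF B] by (simp add: quotient_image_def quotient_space_def)
  have smult: "a \<odot>\<^bsub>?G\<^esub> coset B z = coset B (\<lambda>x. a * z x)" for a z by (rule smult_coset[OF B])
  have mult_S: "(\<lambda>x. a * z x) \<in> S" if "z \<in> S" for a z
    using that bit_subspace_zero[OF S] by (cases a) simp_all
  have grp: "abelian_group ?G"
  proof (rule abelian_groupI; unfold car)
    fix x assume "x \<in> coset B ` S"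
    then obtain y where y: "x = coset B y" "y \<in> S" by blast
    then show "\<exists>y\<in>coset B ` S. y \<oplus>\<^bsub>?G\<^esub> x = \<zero>\<^bsub>?G\<^esub>"
      by (intro bexI[of _ x]) (simp_all add: add zero)
    show "\<zero>\<^bsub>?G\<^esub> \<oplus>\<^bsub>?G\<^esub> x = x" by (simp add: add zero y)
  qed (use bit_subspace_zero[OF S] bit_subspace_add[OF S] in \<open>auto simp: add zero ac_simps\<close>)
  have "module class_ring ?G"
    by (rule moduleI[OF class_cring.is_cring grp]; unfold car)
      (use mult_S in \<open>auto simp: add smult class_ring_simps algebra_simps\<close>)
  then show ?thesis unfolding vectorspace_def using class_field.field_axioms by blast
qed

text \<open>Coordinates with respect to a basis identify the space with the functions from the basis
  to the field. Inequalities between dimensions thereby become inequalities between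
  cardinalities.\<close>

lemma card_vectorspace_bit:
  fixes V :: "(bit, 'b) module"
  assumes "vectorspace class_ring V" and finite_V: "finite (carrier V)"
  shows "card (carrier V) = 2 ^ vectorspace.dim class_ring V"
proof -
  interpret vectorspace class_ring V by fact
  have "gen_set (carrier V)"
    by (intro equalityI span_is_subset2 in_own_span order_refl)
  then have "fin_dim" unfolding fin_dim_def by (intro exI[of _ "carrier V"] conjI finite_V order_refl)
  then obtain A where A: "finite A" "basis A" using finite_basis_exists by blast
  have AV: "A \<subseteq> carrier V" using A(2) unfolding basis_def by blast
  let ?E = "A \<rightarrow>\<^sub>E (UNIV :: bit set)"
  have ex1: "\<exists>!a. a \<in> ?E \<and> lincomb a A = v" if "v \<in> carrier V" for v
    using basis_criterion[OF A(1) AV] A(2) that by simp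
  have "bij_betw (\<lambda>a. lincomb a A) ?E (carrier V)"
    unfolding bij_betw_def
  proof (intro conjI inj_onI equalityI subsetI)
    have cl: "lincomb a A \<in> carrier V" for a by (rule lincomb_closed[OF AV]) simp
    show "a = b" if "a \<in> ?E" "b \<in> ?E" "lincomb a A = lincomb b A" for a b
      using ex1[OF cl[of b]] that by blast
    show "v \<in> carrier V" if "v \<in> (\<lambda>a. lincomb a A) ` ?E" for v using that cl by blast
    show "v \<in> (\<lambda>a. lincomb a A) ` ?E" if "v \<in> carrier V" for v using ex1[OF that] by blast
  qed
  then have "card (carrier V) = card ?E" by (rule bij_betw_same_card[symmetric])
  also have "\<dots> = 2 ^ card A"
  proof -
    have U: "(UNIV :: bit set) = {0, 1}" by (auto intro: bit_not_zero_iff[THEN iffD1])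
    have "card (UNIV :: bit set) = 2" unfolding U by simp
    then show ?thesis using A(1) by (simp add: card_PiE)
  qed
  finally show ?thesis using dim_basis[OF A] by simp
qed

lemma dim_quotient_image:
  assumes "bit_subspace B" "bit_subspace S" "finite S"
  shows "2 ^ vectorspace.dim class_ring (quotient_image Z B S) = card (coset B ` S)"
  using card_vectorspace_bit[OF vectorspace_quotient_image[OF assms(1,2)], of Z] assms(3)
  by (simp add: quotient_image_def)

text \<open>The fibres of the map from \<open>S\<close> to its cosets are translates of
  \<open>S \<inter> B\<close>.\<close>

lemma card_coset_image:
  assumes B: "bit_subspace B" and S: "bit_subspace S" "finite S"
  shows "card S = card (coset B ` S) * card (S \<inter> B)"
proof -
  have "card {z' \<in> S. coset B z' = c} = card (S \<inter> B)" if c: "c \<in> coset B ` S" for c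
  proof -
    obtain z where z: "z \<in> S" "c = coset B z" using c by blast
    have "bij_betw (\<lambda>b x. b x + z x) (S \<inter> B) {z' \<in> S. coset B z' = c}"
    proof (rule bij_betw_byWitness[where f' = "\<lambda>b x. b x + z x"])
      show "(\<lambda>b x. b x + z x) ` (S \<inter> B) \<subseteq> {z' \<in> S. coset B z' = c}"
        using bit_subspace_add[OF S(1) _ z(1)] by (auto simp: z(2) coset_eq_iff[OF B])
      show "(\<lambda>b x. b x + z x) ` {z' \<in> S. coset B z' = c} \<subseteq> S \<inter> B"
        using bit_subspace_add[OF S(1) _ z(1)] by (auto simp: z(2) coset_eq_iff[OF B])
    qed simp_all
    then show ?thesis by (rule bij_betw_same_card[symmetric])
  qed
  then have "(\<Sum>c\<in>coset B ` S. \<Sum>z\<in>{z \<in> S. coset B z = c}. 1) = card (coset B ` S) * card (S \<inter> B)"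
    by simp
  then show ?thesis using sum.image_gen[OF S(2), of "\<lambda>_. 1 :: nat" "coset B"] by simp
qed

text \<open>\<open>P\<close> modulo \<open>P \<inter> Q\<close> embeds into \<open>R\<close> modulo
  \<open>Q\<close>.\<close>

lemma card_subspace_prod_le:
  assumes P: "bit_subspace P" and Q: "bit_subspace Q" and R: "bit_subspace R" "finite R"
    and sub: "P \<subseteq> R" "Q \<subseteq> R"
  shows "card P * card Q \<le> card R * card (P \<inter> Q)"
proof -
  have "finite P" using sub R finite_subset by blast
  then have "card P = card (coset Q ` P) * card (P \<inter> Q)" by (rule card_coset_image[OF Q P])
  moreover have "card R = card (coset Q ` R) * card Q"
    using card_coset_image[OF Q R] sub by (simp add: Int_absorb1)
  moreover have "card (coset Q ` P) \<le> card (coset Q ` R)"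
    using sub R by (intro card_mono) auto
  ultimately show ?thesis by (simp add: mult_le_mono algebra_simps)
qed

text \<open>As the rank is dim S - dim (S \<inter> B), the claim reads dim (S' \<inter> B) + dim (S
  \<inter> B') \<le> dim (S' \<inter> B') + dim (S \<inter> B). Both spaces on the left lie in S'
  \<inter> B', and their intersection lies in S \<inter> B. Asking for
  \<open>S' \<inter> B \<subseteq> B'\<close> instead of \<open>B \<subseteq> B'\<close> makes room
  for the kernel: a boundary of the blowup complex becomes a boundary in the cover only if it is a
  cycle of the cover.\<close>

lemma quotient_rank_exchange:
  assumes S: "bit_subspace S" and S': "bit_subspace S'" "finite S'" "S \<subseteq> S'"
    and B: "bit_subspace B" and B': "bit_subspace B'" and sub: "S' \<inter> B \<subseteq> B'"
  shows "quotient_rank S' B' + quotient_rank S B \<le> quotient_rank S' B + quotient_rank S B'"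
proof -
  have fin: "finite S" using S' finite_subset by blast
  let ?N = "\<lambda>S B. card (coset B ` S)"
  have r: "2 ^ quotient_rank T C = ?N T C" if "bit_subspace C" "bit_subspace T" "finite T"
    for T C :: "('a \<Rightarrow> bit) set"
    unfolding quotient_rank_def by (rule dim_quotient_image[OF that])
  have c: "card S' = ?N S' B' * card (S' \<inter> B')" "card S' = ?N S' B * card (S' \<inter> B)"
    "card S = ?N S B * card (S \<inter> B)" "card S = ?N S B' * card (S \<inter> B')"
    using card_coset_image assms fin by blast+
  have "card (S' \<inter> B) * card (S \<inter> B') \<le> card (S' \<inter> B') * card ((S' \<inter> B) \<inter> (S \<inter> B'))"
    using assms by (intro card_subspace_prod_le bit_subspace_Int) auto
  also have "\<dots> \<le> card (S' \<inter> B') * card (S \<inter> B)"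
    using fin by (intro mult_le_mono2 card_mono) auto
  finally have le: "card (S' \<inter> B) * card (S \<inter> B') \<le> card (S' \<inter> B') * card (S \<inter> B)" .
  have "(\<lambda>_. 0) \<in> S' \<inter> B'" "(\<lambda>_. 0) \<in> S \<inter> B" using assms by (auto intro: bit_subspace_zero)
  then have pos: "0 < card (S' \<inter> B') * card (S \<inter> B)"
    using S'(2) fin by (auto simp: card_gt_0_iff)
  have "(?N S' B' * ?N S B) * (card (S' \<inter> B') * card (S \<inter> B)) = card S' * card S"
    using c(1,3) by (simp add: algebra_simps)
  also have "\<dots> = (?N S' B * ?N S B') * (card (S' \<inter> B) * card (S \<inter> B'))"
    using c(2,4) by (simp add: algebra_simps)
  also have "\<dots> \<le> (?N S' B * ?N S B') * (card (S' \<inter> B') * card (S \<inter> B))"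
    by (rule mult_le_mono2[OF le])
  finally have "?N S' B' * ?N S B \<le> ?N S' B * ?N S B'" using pos by simp
  then have "(2::nat) ^ (quotient_rank S' B' + quotient_rank S B) \<le>
    2 ^ (quotient_rank S' B + quotient_rank S B')"
    using r assms fin by (simp add: power_add)
  then show ?thesis by (simp add: power_increasing_iff)
qed

lemma quotient_rank_cong: "coset B ` S = coset B ` S' \<Longrightarrow> quotient_rank S B = quotient_rank S' B"
  by (simp add: quotient_rank_def quotient_image_def)

lemma bit_subspace_sum:
  assumes "bit_subspace S" "bit_subspace T"
  shows "bit_subspace (sum_space S T)"
  unfolding bit_subspace_def
proof (intro conjI ballI)
  show "(\<lambda>_. 0) \<in> sum_space S T"
    using assms[THEN bit_subspace_zero] by (rule sum_spaceI) simp
  fix u v assume "u \<in> sum_space S T" "v \<in> sum_space S T"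
  then obtain a b a' b' where *: "a \<in> S" "b \<in> T" "u = (\<lambda>x. a x + b x)"
    "a' \<in> S" "b' \<in> T" "v = (\<lambda>x. a' x + b' x)" by (elim sum_spaceE)
  have "(\<lambda>x. a x + a' x) \<in> S" "(\<lambda>x. b x + b' x) \<in> T"
    by (rule bit_subspace_add assms *)+
  then show "(\<lambda>x. u x + v x) \<in> sum_space S T"
    by (rule sum_spaceI) (simp add: *(3,6) ac_simps)
qed

text \<open>Summands from \<open>B\<close> do not change a coset, so a space of cycles may be
  enlarged by boundaries.\<close>

lemma quotient_rank_sum:
  assumes B: "bit_subspace B" and T: "bit_subspace T" "T \<subseteq> B"
  shows "quotient_rank (sum_space S T) B = quotient_rank S B"
proof (rule quotient_rank_cong)
  have *: "coset B (\<lambda>x. a x + b x) = coset B a" if "b \<in> T" for a b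
    using that T by (subst coset_eq_iff[OF B]) (auto simp: ac_simps)
  have 0: "(\<lambda>_. 0) \<in> T" by (rule bit_subspace_zero[OF T(1)])
  show "coset B ` sum_space S T = coset B ` S"
  proof (intro equalityI subsetI)
    fix c assume "c \<in> coset B ` S"
    then obtain a where a: "a \<in> S" "c = coset B a" by blast
    have "a \<in> sum_space S T" using a(1) 0 by (rule sum_spaceI) simp
    then show "c \<in> coset B ` sum_space S T" unfolding a(2) by (rule imageI)
  next
    fix c assume "c \<in> coset B ` sum_space S T"
    then obtain a b where "a \<in> S" "b \<in> T" "c = coset B (\<lambda>x. a x + b x)" by (auto elim: sum_spaceE)
    then show "c \<in> coset B ` S" using *[of b a] by simp
  qed
qed

section \<open>Homology classes as cosets of cycles\<close>

lemma finite_chains: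
  assumes "finite X"
  shows "finite (card_chains m X)"
proof -
  have "inj_on (\<lambda>c. {\<sigma>. c \<sigma> \<noteq> 0}) (card_chains m X)"
  proof (rule inj_onI)
    fix c d :: "'a set \<Rightarrow> bit" assume h: "{\<sigma>. c \<sigma> \<noteq> 0} = {\<sigma>. d \<sigma> \<noteq> 0}"
    show "c = d"
    proof
      fix \<sigma>
      have "c \<sigma> \<noteq> 0 \<longleftrightarrow> d \<sigma> \<noteq> 0" using h by blast
      then show "c \<sigma> = d \<sigma>" by (cases "c \<sigma>"; cases "d \<sigma>") auto
    qed
  qed
  moreover have "(\<lambda>c. {\<sigma>. c \<sigma> \<noteq> 0}) ` card_chains m X \<subseteq> Pow X" by (auto simp: card_chains_def)
  then have "finite ((\<lambda>c. {\<sigma>. c \<sigma> \<noteq> 0}) ` card_chains m X)" using assms finite_subset by blast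
  ultimately show ?thesis using finite_imageD by blast
qed

lemma finite_cycles: "finite X \<Longrightarrow> finite (cycles k X)"
  unfolding cycles_def simplicial_chains_eq by (simp add: finite_chains)

lemma bit_subspace_cycles: "bit_subspace (cycles k X)"
  unfolding bit_subspace_def cycles_def simplicial_chains_eq
  by (auto simp: zero_in_chains add_in_chains bd_zero bd_add)

lemma bit_subspace_boundaries: "bit_subspace (boundaries k X)"
  unfolding bit_subspace_def
proof (intro conjI ballI)
  fix a b assume "a \<in> boundaries k X" "b \<in> boundaries k X"
  then obtain c d where "c \<in> card_chains (Suc (Suc k)) X" "d \<in> card_chains (Suc (Suc k)) X" "a = bd c" "b = bd d"
    by (auto simp: boundaries_def simplicial_chains_eq)
  then show "(\<lambda>x. a x + b x) \<in> boundaries k X"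
    unfolding boundaries_def simplicial_chains_eq
    by (intro image_eqI[of _ _ "\<lambda>\<sigma>. c \<sigma> + d \<sigma>"]) (simp_all add: bd_add add_in_chains)
qed (rule zero_in_boundaries)

lemma inclusion_map_coset:
  assumes "boundaries k X \<subseteq> boundaries k Y"
  shows "inclusion_map k Y (coset (boundaries k X) z) = coset (boundaries k Y) z"
  unfolding inclusion_map_def set_add_function_space
proof (intro equalityI subsetI)
  let ?B = "boundaries k X" and ?C = "boundaries k Y"
  fix w
  show "w \<in> coset ?C z" if h: "w \<in> sum_space ?C (coset ?B z)"
  proof -
    obtain a b where "a \<in> ?C" "b \<in> coset ?B z" and w: "w = (\<lambda>x. a x + b x)"
      using h by (rule sum_spaceE)
    then have "a \<in> ?C" "(\<lambda>x. b x + z x) \<in> ?C" using assms by (auto simp: mem_coset)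
    from bit_subspace_add[OF bit_subspace_boundaries this] show ?thesis
      by (simp add: mem_coset w ac_simps)
  qed
  show "w \<in> sum_space ?C (coset ?B z)" if "w \<in> coset ?C z"
  proof (rule sum_spaceI)
    show "(\<lambda>x. w x + z x) \<in> ?C" using that by (simp add: mem_coset)
    show "z \<in> coset ?B z" using zero_in_boundaries by (simp add: mem_coset)
  qed simp
qed

lemma boundaries_mono: "X \<subseteq> Y \<Longrightarrow> boundaries k X \<subseteq> boundaries k Y"
  unfolding boundaries_def simplicial_chains_eq by (intro image_mono card_chains_mono)

lemma cycles_mono: "X \<subseteq> Y \<Longrightarrow> cycles k X \<subseteq> cycles k Y"
  unfolding cycles_def simplicial_chains_eq using card_chains_mono by blast

lemma pm_rank_homology:
  assumes "0 \<le> \<alpha>" "\<alpha> \<le> \<beta>" "F \<alpha> \<subseteq> F \<beta>" "finite (F \<alpha>)"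
  shows "pm_rank (\<lambda>\<alpha>. homology K (F \<alpha>)) (\<lambda>\<alpha> \<beta>. inclusion_map K (F \<beta>)) \<alpha> (ereal \<beta>) =
    quotient_rank (cycles K (F \<alpha>)) (boundaries K (F \<beta>))"
proof -
  let ?Z = "cycles K (F \<alpha>)" and ?B = "boundaries K (F \<alpha>)" and ?C = "boundaries K (F \<beta>)"
  have "carrier (homology K (F \<alpha>)) = coset ?B ` ?Z"
    unfolding homology_def quotient_space_def A_RCOSETS_def RCOSETS_def
    by (auto simp: a_r_coset_function_space a_r_coset_def[symmetric]) (auto simp: function_space_def)
  then have "inclusion_map K (F \<beta>) ` carrier (homology K (F \<alpha>)) = coset ?C ` ?Z"
    using inclusion_map_coset[OF boundaries_mono[OF assms(3)], of K] by (simp add: image_image)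
  then have "(homology K (F \<beta>)) \<lparr>carrier := inclusion_map K (F \<beta>) ` carrier (homology K (F \<alpha>))\<rparr> =
    quotient_image (cycles K (F \<beta>)) ?C ?Z"
    by (simp add: homology_def quotient_image_def)
  then have "pm_rank (\<lambda>\<alpha>. homology K (F \<alpha>)) (\<lambda>\<alpha> \<beta>. inclusion_map K (F \<beta>)) \<alpha> (ereal \<beta>) =
    vectorspace.dim class_ring (quotient_image (cycles K (F \<beta>)) ?C ?Z)"
    using assms by (simp add: pm_rank_def)
  \<comment> \<open>The ambient spaces \<open>cycles K (F \<beta>)\<close> and \<open>UNIV\<close>
    are exchanged by counting: both dimensions are determined by the number of the same
    cosets.\<close>
  also have "(2::nat) ^ \<dots> = 2 ^ quotient_rank ?Z ?C"
    unfolding quotient_rank_def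
    by (simp add: dim_quotient_image bit_subspace_cycles bit_subspace_boundaries finite_cycles assms)
  then have "vectorspace.dim class_ring (quotient_image (cycles K (F \<beta>)) ?C ?Z) = quotient_rank ?Z ?C"
    by simp
  finally show ?thesis .
qed

lemma quotient_rank_image:
  assumes g: "inj g" and "finite X"
  shows "quotient_rank (cycles k ((`) g ` X)) (boundaries k ((`) g ` Y)) =
    quotient_rank (cycles k X) (boundaries k Y)"
proof -
  let ?Z = "cycles k X" and ?B = "boundaries k Y"
  have c: "coset (push g ` ?B) (push g z) = push g ` coset ?B z" for z
    unfolding coset_def image_image push_add ..
  have "coset (push g ` ?B) ` (push g ` ?Z) = (`) (push g) ` (coset ?B ` ?Z)"
    unfolding image_image c ..
  moreover have "inj ((`) (push g))"
    by (rule injI) (simp add: inj_image_eq_iff[OF inj_push[OF g]])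
  ultimately have "card (coset (push g ` ?B) ` (push g ` ?Z)) = card (coset ?B ` ?Z)"
    using card_image inj_on_subset by (metis subset_UNIV)
  then have "(2::nat) ^ quotient_rank (cycles k ((`) g ` X)) (boundaries k ((`) g ` Y)) =
    2 ^ quotient_rank ?Z ?B"
    unfolding quotient_rank_def cycles_image[OF g, symmetric] boundaries_image[OF g, symmetric]
    using assms(2)
    by (simp add: dim_quotient_image bit_subspace_cycles bit_subspace_boundaries finite_cycles)
  then show ?thesis by simp
qed

section \<open>The blowup complex\<close>

text \<open>The simplex \<open>Inl ` v \<union> Inr ` \<tau>\<close> belongs to the blowup complex if \<open>\<tau>\<close> is a face of a simplex
  that lies in all the \<open>U i\<close> with \<open>i \<in> v\<close>. It contains the cover (\<open>v = {}\<close>) and its nerve (\<open>\<tau> = {}\<close>).\<close>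

definition blowup :: "nat \<Rightarrow> (nat \<Rightarrow> real \<Rightarrow> 'v set set) \<Rightarrow> real \<Rightarrow> (nat + 'v) set set" where
  "blowup n U \<alpha> = {\<rho>. \<rho> \<noteq> {} \<and> Inl -` \<rho> \<subseteq> {..n} \<and>
     (\<exists>i\<le>n. \<exists>\<sigma>\<in>U i \<alpha>. Inr -` \<rho> \<subseteq> \<sigma> \<and> (\<forall>i\<in>Inl -` \<rho>. \<sigma> \<in> U i \<alpha>))}"

lemma blowupE:
  assumes "\<rho> \<in> blowup n U \<alpha>"
  obtains i \<sigma> where "\<rho> \<noteq> {}" "Inl -` \<rho> \<subseteq> {..n}" "i \<le> n" "\<sigma> \<in> U i \<alpha>" "Inr -` \<rho> \<subseteq> \<sigma>"
    "\<forall>k\<in>Inl -` \<rho>. \<sigma> \<in> U k \<alpha>"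
proof -
  note * = assms[unfolded blowup_def mem_Collect_eq]
  show thesis by (rule exE[OF conjunct2[OF conjunct2[OF *]]], elim conjE bexE, rule that)
      (use * in \<open>iprover+\<close>)
qed

lemma blowupI:
  assumes "\<rho> \<noteq> {}" "Inl -` \<rho> \<subseteq> {..n}" "i \<le> n" "\<sigma> \<in> U i \<alpha>" "Inr -` \<rho> \<subseteq> \<sigma>"
    "\<forall>k\<in>Inl -` \<rho>. \<sigma> \<in> U k \<alpha>"
  shows "\<rho> \<in> blowup n U \<alpha>"
  unfolding blowup_def by (intro CollectI conjI exI[of _ i] bexI[of _ \<sigma>] assms)

lemma sum_set_split: "\<rho> = Inl ` (Inl -` \<rho>) \<union> Inr ` (Inr -` \<rho>)"
proof (intro equalityI subsetI)
  fix x assume "x \<in> \<rho>"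
  then show "x \<in> Inl ` (Inl -` \<rho>) \<union> Inr ` (Inr -` \<rho>)" by (cases x) auto
qed auto

lemma disjoint_range_InlE:
  assumes "\<rho> \<inter> range Inl = {}"
  obtains \<tau> where "\<rho> = Inr ` \<tau>"
proof -
  have "Inl -` \<rho> = {}" using assms by auto
  then have "\<rho> = Inr ` (Inr -` \<rho>)" using sum_set_split[of \<rho>] by (metis image_empty sup_bot_left)
  then show thesis by (rule that)
qed

lemma disjoint_range_InrE:
  assumes "\<rho> \<inter> range Inr = {}"
  obtains v where "\<rho> = Inl ` v"
proof -
  have "Inr -` \<rho> = {}" using assms by auto
  then have "\<rho> = Inl ` (Inl -` \<rho>)" using sum_set_split[of \<rho>] by (metis image_empty sup_bot_right)
  then show thesis by (rule that)
qed

lemma vimage_Inl_Inr [simp]: "Inl -` Inl ` v = v" "Inr -` Inr ` \<tau> = \<tau>" "Inl -` Inr ` \<tau> = {}" "Inr -` Inl ` v = {}"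
  by auto

locale good_cover =
  fixes \<epsilon> :: real and n :: nat and U :: "nat \<Rightarrow> real \<Rightarrow> 'v set set"
  assumes eps: "0 \<le> \<epsilon>"
    and filtration: "i \<le> n \<Longrightarrow> finite_simplicial_filtration (U i)"
    and good: "eps_good_cover \<epsilon> n U"
begin

lemma U_simplex:
  assumes "i \<le> n" "0 \<le> \<alpha>" "\<sigma> \<in> U i \<alpha>"
  shows "finite \<sigma>" "\<sigma> \<noteq> {}" "\<tau> \<subseteq> \<sigma> \<Longrightarrow> \<tau> \<noteq> {} \<Longrightarrow> \<tau> \<in> U i \<alpha>"
  using filtration[OF assms(1)] assms(2,3)
  unfolding finite_simplicial_filtration_def simplicial_complex_def by blast+

lemma U_mono: "i \<le> n \<Longrightarrow> 0 \<le> \<alpha> \<Longrightarrow> \<alpha> \<le> \<beta> \<Longrightarrow> U i \<alpha> \<subseteq> U i \<beta>"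
  using filtration unfolding finite_simplicial_filtration_def by blast

lemma blowup_mono:
  assumes "0 \<le> \<alpha>" "\<alpha> \<le> \<beta>"
  shows "blowup n U \<alpha> \<subseteq> blowup n U \<beta>"
proof
  fix \<rho> assume "\<rho> \<in> blowup n U \<alpha>"
  then obtain i \<sigma> where *: "\<rho> \<noteq> {}" "Inl -` \<rho> \<subseteq> {..n}" "i \<le> n" "\<sigma> \<in> U i \<alpha>" "Inr -` \<rho> \<subseteq> \<sigma>"
    "\<forall>k\<in>Inl -` \<rho>. \<sigma> \<in> U k \<alpha>" by (rule blowupE)
  have "\<sigma> \<in> U i \<beta>" using U_mono[OF *(3) assms] *(4) by (rule subsetD)
  moreover have "\<forall>k\<in>Inl -` \<rho>. \<sigma> \<in> U k \<beta>"
  proof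
    fix k assume k: "k \<in> Inl -` \<rho>"
    then have "k \<le> n" using *(2) by auto
    then show "\<sigma> \<in> U k \<beta>" using U_mono[OF _ assms] bspec[OF *(6) k] by blast
  qed
  ultimately show "\<rho> \<in> blowup n U \<beta>" using * by (intro blowupI[of \<rho> n i \<sigma>])
qed

lemma simplicial_complex_blowup:
  assumes "0 \<le> \<alpha>"
  shows "simplicial_complex (blowup n U \<alpha>)"
  unfolding simplicial_complex_def
proof (intro ballI conjI allI impI)
  fix \<rho> assume "\<rho> \<in> blowup n U \<alpha>"
  then obtain i \<sigma> where *: "\<rho> \<noteq> {}" "Inl -` \<rho> \<subseteq> {..n}" "i \<le> n" "\<sigma> \<in> U i \<alpha>" "Inr -` \<rho> \<subseteq> \<sigma>"
    "\<forall>k\<in>Inl -` \<rho>. \<sigma> \<in> U k \<alpha>" by (rule blowupE)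
  show "\<rho> \<noteq> {}" by fact
  have "finite (Inl -` \<rho>)" "finite (Inr -` \<rho>)"
    using *(2,5) U_simplex(1)[OF *(3) assms *(4)] finite_subset by blast+
  then show "finite \<rho>" using sum_set_split[of \<rho>] by (metis finite_Un finite_imageI)
  fix \<rho>' assume "\<rho>' \<subseteq> \<rho> \<and> \<rho>' \<noteq> {}"
  then have "Inl -` \<rho>' \<subseteq> Inl -` \<rho>" "Inr -` \<rho>' \<subseteq> Inr -` \<rho>" "\<rho>' \<noteq> {}" by auto
  then show "\<rho>' \<in> blowup n U \<alpha>"
    using *(2-6) by (intro blowupI[of \<rho>' n i \<sigma>]) (assumption | erule order_trans | blast)+
qed

lemma finite_blowup:
  assumes "0 \<le> \<alpha>"
  shows "finite (blowup n U \<alpha>)"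
proof -
  let ?V = "\<Union>i\<le>n. \<Union>(U i \<alpha>)"
  have "finite ?V"
  proof (intro finite_UN_I finite_atMost)
    fix i assume "i \<in> {..n}"
    then have i: "i \<le> n" by simp
    then have "finite (U i \<alpha>)"
      using filtration assms unfolding finite_simplicial_filtration_def by blast
    then show "finite (\<Union>(U i \<alpha>))" by (rule finite_Union) (rule U_simplex(1)[OF i assms])
  qed
  moreover have "blowup n U \<alpha> \<subseteq> Pow (Inl ` {..n} \<union> Inr ` ?V)"
  proof
    fix \<rho> assume "\<rho> \<in> blowup n U \<alpha>"
    then have "Inl -` \<rho> \<subseteq> {..n}" "Inr -` \<rho> \<subseteq> ?V" by (auto elim!: blowupE)
    then have "Inl ` (Inl -` \<rho>) \<union> Inr ` (Inr -` \<rho>) \<subseteq> Inl ` {..n} \<union> Inr ` ?V"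
      by (intro Un_mono image_mono)
    then show "\<rho> \<in> Pow (Inl ` {..n} \<union> Inr ` ?V)" unfolding sum_set_split[symmetric] by (rule PowI)
  qed
  ultimately show ?thesis by (meson finite_Pow_iff finite_UnI finite_atMost finite_imageI finite_subset)
qed

lemma blowup_cover:
  assumes "0 \<le> \<alpha>"
  shows "{\<rho> \<in> blowup n U \<alpha>. \<rho> \<inter> range Inl = {}} = (`) Inr ` (\<Union>i\<le>n. U i \<alpha>)"
proof (intro equalityI subsetI)
  fix \<rho> assume "\<rho> \<in> {\<rho> \<in> blowup n U \<alpha>. \<rho> \<inter> range Inl = {}}"
  then have b: "\<rho> \<in> blowup n U \<alpha>" "\<rho> \<inter> range Inl = {}" by auto
  obtain \<tau> where \<rho>: "\<rho> = Inr ` \<tau>" using b(2) by (rule disjoint_range_InlE)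
  obtain i \<sigma> where "\<rho> \<noteq> {}" and *: "i \<le> n" "\<sigma> \<in> U i \<alpha>" "Inr -` \<rho> \<subseteq> \<sigma>"
    using b(1) by (rule blowupE)
  then have \<tau>: "\<tau> \<subseteq> \<sigma>" "\<tau> \<noteq> {}" unfolding \<rho> by auto
  have "\<tau> \<in> U i \<alpha>" by (rule U_simplex(3)[OF *(1) assms *(2) \<tau>])
  then show "\<rho> \<in> (`) Inr ` (\<Union>i\<le>n. U i \<alpha>)" using *(1) unfolding \<rho> by blast
next
  fix \<rho> :: "(nat + 'v) set" assume "\<rho> \<in> (`) Inr ` (\<Union>i\<le>n. U i \<alpha>)"
  then obtain i \<sigma> where *: "i \<le> n" "\<sigma> \<in> U i \<alpha>" "\<rho> = Inr ` \<sigma>" by auto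
  then have "Inl -` \<rho> = {}" "Inr -` \<rho> = \<sigma>" "\<rho> \<inter> range Inl = {}" "\<rho> \<noteq> {}"
    using U_simplex(2)[OF *(1) assms *(2)] by auto
  then show "\<rho> \<in> {\<rho> \<in> blowup n U \<alpha>. \<rho> \<inter> range Inl = {}}"
    using *(1,2) by (auto intro!: blowupI[of \<rho> n i \<sigma>])
qed

lemma blowup_nerve:
  assumes "0 \<le> \<alpha>"
  shows "{\<rho> \<in> blowup n U \<alpha>. \<rho> \<inter> range Inr = {}} = (`) Inl ` nerve n U \<alpha>"
proof (intro equalityI subsetI)
  fix \<rho> assume "\<rho> \<in> {\<rho> \<in> blowup n U \<alpha>. \<rho> \<inter> range Inr = {}}"
  then have b: "\<rho> \<in> blowup n U \<alpha>" "\<rho> \<inter> range Inr = {}" by auto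
  obtain v where \<rho>: "\<rho> = Inl ` v" using b(2) by (rule disjoint_range_InrE)
  obtain i \<sigma> where *: "\<rho> \<noteq> {}" "Inl -` \<rho> \<subseteq> {..n}" "\<forall>i\<in>Inl -` \<rho>. \<sigma> \<in> U i \<alpha>"
    using b(1) by (rule blowupE)
  then have "v \<noteq> {}" "v \<subseteq> {..n}" "\<forall>i\<in>v. \<sigma> \<in> U i \<alpha>" unfolding \<rho> by simp_all
  then have "v \<in> nerve n U \<alpha>" unfolding nerve_def by blast
  then show "\<rho> \<in> (`) Inl ` nerve n U \<alpha>" unfolding \<rho> by (rule imageI)
next
  fix \<rho> :: "(nat + 'v) set" assume "\<rho> \<in> (`) Inl ` nerve n U \<alpha>"
  then obtain v \<sigma> where *: "v \<noteq> {}" "v \<subseteq> {..n}" "\<And>i. i \<in> v \<Longrightarrow> \<sigma> \<in> U i \<alpha>" "\<rho> = Inl ` v"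
    unfolding nerve_def by blast
  then have "Inl -` \<rho> = v" "Inr -` \<rho> = {}" "\<rho> \<inter> range Inr = {}" "\<rho> \<noteq> {}" by auto
  moreover obtain i where "i \<in> v" "i \<le> n" using *(1,2) by auto
  ultimately show "\<rho> \<in> {\<rho> \<in> blowup n U \<alpha>. \<rho> \<inter> range Inr = {}}"
    using *(1-3) by (auto intro!: blowupI[of \<rho> n i \<sigma>])
qed

text \<open>The link of \<open>v\<close> in the cover vertices is a copy of the intersection over
  \<open>v\<close>, except that it also has the empty simplex, which carries the
  augmentation.\<close>

lemma blowup_slice:
  assumes "0 \<le> \<alpha>" and v: "v \<noteq> {}" "v \<subseteq> {..n}"
  shows "{\<tau>. \<tau> \<inter> range Inl = {} \<and> Inl ` v \<union> \<tau> \<in> blowup n U \<alpha>} - {{}} = (`) Inr ` (\<Inter>i\<in>v. U i \<alpha>)"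
proof (intro equalityI subsetI)
  fix \<tau> assume "\<tau> \<in> {\<tau>. \<tau> \<inter> range Inl = {} \<and> Inl ` v \<union> \<tau> \<in> blowup n U \<alpha>} - {{}}"
  then have b: "\<tau> \<inter> range Inl = {}" "Inl ` v \<union> \<tau> \<in> blowup n U \<alpha>" "\<tau> \<noteq> {}" by auto
  obtain t where \<tau>: "\<tau> = Inr ` t" using b(1) by (rule disjoint_range_InlE)
  obtain i \<sigma> where "Inr -` (Inl ` v \<union> \<tau>) \<subseteq> \<sigma>" "\<forall>i\<in>Inl -` (Inl ` v \<union> \<tau>). \<sigma> \<in> U i \<alpha>"
    using b(2) by (rule blowupE)
  then have *: "t \<noteq> {}" "t \<subseteq> \<sigma>" "\<forall>i\<in>v. \<sigma> \<in> U i \<alpha>"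
    using b(3) unfolding \<tau> by (simp_all add: vimage_Un)
  have "t \<in> U i \<alpha>" if "i \<in> v" for i
    using U_simplex(3)[OF _ assms(1) bspec[OF *(3) that] *(2,1)] v(2) that by auto
  then show "\<tau> \<in> (`) Inr ` (\<Inter>i\<in>v. U i \<alpha>)" unfolding \<tau> by blast
next
  fix \<tau> :: "(nat + 'v) set" assume "\<tau> \<in> (`) Inr ` (\<Inter>i\<in>v. U i \<alpha>)"
  then obtain \<sigma> where *: "\<tau> = Inr ` \<sigma>" "\<And>i. i \<in> v \<Longrightarrow> \<sigma> \<in> U i \<alpha>" by blast
  obtain i where i: "i \<in> v" "i \<le> n" using v by auto
  have "\<sigma> \<noteq> {}" by (rule U_simplex(2)[OF i(2) assms(1) *(2)[OF i(1)]])
  moreover have "Inl -` (Inl ` v \<union> \<tau>) = v" "Inr -` (Inl ` v \<union> \<tau>) = \<sigma>" using *(1) by auto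
  ultimately have "Inl ` v \<union> \<tau> \<in> blowup n U \<alpha>"
    using i *(2) v by (intro blowupI[of _ n i \<sigma>]) auto
  then show "\<tau> \<in> {\<tau>. \<tau> \<inter> range Inl = {} \<and> Inl ` v \<union> \<tau> \<in> blowup n U \<alpha>} - {{}}"
    using \<open>\<sigma> \<noteq> {}\<close> *(1) by auto
qed

section \<open>Filling cycles in the links of the blowup complex\<close>

lemma card_chains_Suc_diff_empty: "card_chains (Suc m) (X - {{}}) = card_chains (Suc m) X"
  unfolding card_chains_def by force

text \<open>\<open>q\<close> counts vertices. For \<open>q > 0\<close> the chain is a reduced cycle
  of degree \<open>q - 1\<close> in an intersection of the cover, and goodness fills it \<epsilon>
  later. For \<open>q = 0\<close> it is zero or the empty simplex, which a vertex of the
  intersection bounds at once.\<close>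

lemma fill_cover:
  assumes \<alpha>: "0 \<le> \<alpha>" and w: "w \<subseteq> range Inl" "w \<noteq> {}"
    and a: "a \<in> card_chains q {\<tau>. \<tau> \<inter> range Inl = {} \<and> w \<union> \<tau> \<in> blowup n U \<alpha>}"
    and cyc: "bd a = (\<lambda>_. 0)"
  shows "\<exists>e \<in> card_chains (Suc q) {\<tau>. \<tau> \<inter> range Inl = {} \<and> w \<union> \<tau> \<in> blowup n U
    (if q = 0 then \<alpha> else \<alpha> + \<epsilon>)}. bd e = a"
proof (cases "a = (\<lambda>_. 0)")
  case True
  then show ?thesis by (intro bexI[of _ "\<lambda>_. 0"]) (simp_all add: bd_zero zero_in_chains)
next
  case False
  \<comment> \<open>A simplex of \<open>a\<close> is what shows that \<open>w\<close> comes from a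
    simplex of the nerve: its indices are in range and their intersection is non-empty.\<close>
  then obtain \<tau> where "a \<tau> \<noteq> 0" by auto
  then have \<tau>: "\<tau> \<inter> range Inl = {}" "w \<union> \<tau> \<in> blowup n U \<alpha>" "finite \<tau>" "card \<tau> = q"
    using card_chainsD[OF a] by auto
  obtain v where wv: "w = Inl ` v" using w(1) by (auto simp: subset_image_iff)
  have "Inl -` (w \<union> \<tau>) \<subseteq> {..n}" using \<tau>(2) by (rule blowupE)
  then have v: "v \<noteq> {}" "v \<subseteq> {..n}" using w(2) unfolding wv by (simp_all add: vimage_Un)
  show ?thesis
  proof (cases q)
    case 0
    then have "\<tau> = {}" using \<tau>(3,4) by simp
    have only: "a \<rho> = (if \<rho> = {} then 1 else 0)" for \<rho>
    proof (cases "\<rho> = {}")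
      case True
      then show ?thesis using \<open>a \<tau> \<noteq> 0\<close> \<open>\<tau> = {}\<close> by (cases "a {}") auto
    next
      case False
      then show ?thesis using card_chainsD(2,3)[OF a, of \<rho>] 0 by force
    qed
    obtain \<sigma> where "\<forall>i\<in>Inl -` (w \<union> \<tau>). \<sigma> \<in> U i \<alpha>" using \<tau>(2) by (rule blowupE)
    then have \<sigma>: "\<sigma> \<in> U i \<alpha>" if "i \<in> v" for i using that unfolding wv by simp
    obtain i where i: "i \<in> v" "i \<le> n" using v by auto
    obtain x where x: "x \<in> \<sigma>" using U_simplex(2)[OF i(2) \<alpha> \<sigma>[OF i(1)]] by auto
    have "{x} \<in> (\<Inter>i\<in>v. U i \<alpha>)"
    proof
      fix i assume "i \<in> v"
      then show "{x} \<in> U i \<alpha>" using U_simplex(3)[OF _ \<alpha> \<sigma>] v x by auto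
    qed
    then have "{Inr x} \<in> (`) Inr ` (\<Inter>i\<in>v. U i \<alpha>)" by (intro image_eqI[of _ _ "{x}"]) auto
    then have "{Inr x} \<in> {\<tau>. \<tau> \<inter> range Inl = {} \<and> w \<union> \<tau> \<in> blowup n U \<alpha>} - {{}}"
      unfolding blowup_slice[OF \<alpha> v] wv .
    then have "(\<lambda>\<rho>. if \<rho> = {Inr x} then 1 else 0) \<in>
      card_chains (Suc q) {\<tau>. \<tau> \<inter> range Inl = {} \<and> w \<union> \<tau> \<in> blowup n U \<alpha>}"
      unfolding card_chains_def 0 by simp
    moreover have "bd (\<lambda>\<rho>. if \<rho> = {Inr x} then 1 else 0) = a"
      unfolding bd_point using only by auto
    ultimately show ?thesis unfolding 0 by auto
  next
    case (Suc k)
    have inr: "inj (Inr :: 'v \<Rightarrow> nat + 'v)" by (rule inj_Inr)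
    have "a \<in> card_chains (Suc k) ((`) Inr ` (\<Inter>i\<in>v. U i \<alpha>))"
      using a unfolding blowup_slice[OF \<alpha> v, symmetric] card_chains_Suc_diff_empty Suc wv .
    then obtain a' where a': "a = push Inr a'" "a' \<in> card_chains (Suc k) (\<Inter>i\<in>v. U i \<alpha>)"
      unfolding card_chains_image[OF inr] by blast
    have "bd a' = (\<lambda>_. 0)" using bd_push_eq_zero[OF inr a'(2)] cyc a'(1) by simp
    then have "a' \<in> reduced_cycles k (\<Inter>i\<in>v. U i \<alpha>)"
      using a'(2) by (simp add: reduced_cycles_def simplicial_chains_eq)
    from reduced_cycle_bounds[OF good v \<alpha> this]
    obtain e where e: "e \<in> card_chains (Suc (Suc k)) (\<Inter>i\<in>v. U i (\<alpha> + \<epsilon>))" "a' = bd e"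
      by (auto simp: boundaries_def simplicial_chains_eq)
    have \<alpha>': "0 \<le> \<alpha> + \<epsilon>" using \<alpha> eps by simp
    have "push Inr e \<in> card_chains (Suc q) {\<tau>. \<tau> \<inter> range Inl = {} \<and> w \<union> \<tau> \<in> blowup n U (\<alpha> + \<epsilon>)}"
      using push_in_chains[OF inr e(1)]
      unfolding blowup_slice[OF \<alpha>' v, symmetric] card_chains_Suc_diff_empty Suc wv .
    moreover have "bd (push Inr e) = a" using bd_push[OF inr e(1)] e(2) a'(1) by simp
    ultimately show ?thesis unfolding Suc by auto
  qed
qed

text \<open>With \<open>t\<close> the vertex set of \<open>w\<close> in the cover, the apex is any
  \<open>i\<close> with \<open>t\<close> in \<open>U i \<alpha>\<close>. A simplex whose cover
  vertices are exactly those of \<open>t\<close> can take \<open>t\<close> itself as its witness in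
  \<open>blowup\<close>, so adding the apex never leaves the complex, and the cone needs no
  shift.\<close>

lemma fill_nerve:
  assumes \<alpha>: "0 \<le> \<alpha>" and w: "w \<subseteq> range Inr" "w \<noteq> {}"
    and a: "a \<in> card_chains q {\<tau>. \<tau> \<inter> range Inr = {} \<and> w \<union> \<tau> \<in> blowup n U \<alpha>}"
    and cyc: "bd a = (\<lambda>_. 0)"
  shows "\<exists>e \<in> card_chains (Suc q) {\<tau>. \<tau> \<inter> range Inr = {} \<and> w \<union> \<tau> \<in> blowup n U \<alpha>}. bd e = a"
proof (cases "a = (\<lambda>_. 0)")
  case True
  then show ?thesis by (intro bexI[of _ "\<lambda>_. 0"]) (simp_all add: bd_zero zero_in_chains)
next
  case False
  let ?X = "{\<tau>. \<tau> \<inter> range Inr = {} \<and> w \<union> \<tau> \<in> blowup n U \<alpha>}"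
  obtain t where wt: "w = Inr ` t" using w(1) by (auto simp: subset_image_iff)
  have t0: "t \<noteq> {}" using wt w(2) by auto
  obtain \<tau> where "a \<tau> \<noteq> 0" using False by auto
  then have "w \<union> \<tau> \<in> blowup n U \<alpha>" using card_chainsD(1)[OF a] by blast
  then obtain i \<sigma> where i: "i \<le> n" "\<sigma> \<in> U i \<alpha>" "Inr -` (w \<union> \<tau>) \<subseteq> \<sigma>"
    by (rule blowupE)
  then have "t \<subseteq> \<sigma>" by (auto simp: wt)
  then have ti: "t \<in> U i \<alpha>" using U_simplex(3)[OF i(1) \<alpha> i(2)] t0 by blast
  have "{\<rho>. Inl i \<in> \<rho> \<and> \<rho> - {Inl i} \<in> ?X} \<subseteq> ?X"
  proof
    fix \<rho> assume "\<rho> \<in> {\<rho>. Inl i \<in> \<rho> \<and> \<rho> - {Inl i} \<in> ?X}"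
    then have \<rho>: "Inl i \<in> \<rho>" "(\<rho> - {Inl i}) \<inter> range Inr = {}" "w \<union> (\<rho> - {Inl i}) \<in> blowup n U \<alpha>"
      by auto
    then have disj: "\<rho> \<inter> range Inr = {}" by auto
    obtain \<sigma> where \<sigma>: "Inr -` (w \<union> (\<rho> - {Inl i})) \<subseteq> \<sigma>"
      "\<forall>k \<in> Inl -` (w \<union> (\<rho> - {Inl i})). k \<le> n \<and> \<sigma> \<in> U k \<alpha>"
      using \<rho>(3) by (elim blowupE) blast
    have "t \<subseteq> \<sigma>" using \<sigma>(1) by (auto simp: wt)
    have "k \<le> n \<and> t \<in> U k \<alpha>" if k: "k \<in> Inl -` (w \<union> \<rho>)" for k
    proof (cases "k = i")
      case False
      then have "k \<in> Inl -` (w \<union> (\<rho> - {Inl i}))" using k by auto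
      from bspec[OF \<sigma>(2) this] show ?thesis using U_simplex(3)[OF _ \<alpha> _ \<open>t \<subseteq> \<sigma>\<close> t0] by blast
    qed (use i(1) ti in auto)
    moreover have "Inr -` (w \<union> \<rho>) = t" using disj by (auto simp: wt)
    ultimately have "w \<union> \<rho> \<in> blowup n U \<alpha>"
      using ti i(1) \<rho>(1) by (intro blowupI[of _ n i t]) auto
    then show "\<rho> \<in> ?X" using disj by blast
  qed
  then show ?thesis using bd_cone[OF a cyc, of "Inl i"] card_chains_mono by blast
qed

lemma relative_cycle_cover:
  assumes \<alpha>: "0 \<le> \<alpha>" and m: "1 \<le> m" and c: "c \<in> card_chains m (blowup n U \<alpha>)"
    and rel: "\<And>\<rho>. \<rho> \<inter> range Inl \<noteq> {} \<Longrightarrow> bd c \<rho> = 0"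
    and \<beta>: "\<alpha> + real (m - 1) * \<epsilon> \<le> \<beta>"
  shows "\<exists>e \<in> card_chains (Suc m) (blowup n U \<beta>).
    (\<lambda>\<rho>. c \<rho> + bd e \<rho>) \<in> card_chains m ((`) Inr ` (\<Union>i\<le>n. U i \<beta>))"
proof -
  \<comment> \<open>Level \<open>j\<close> is filled in the complex at \<open>?s j\<close>. By
    truncated subtraction \<open>?s (Suc m)\<close> and \<open>?s m\<close> are both \<alpha>, in
    accordance with level \<open>m\<close> being free; each lower level adds \<epsilon>, which makes
    \<open>(m - 1)\<close> times \<epsilon> at \<open>?s 1\<close>.\<close>
  let ?s = "\<lambda>j. \<alpha> + real (m - j) * \<epsilon>"
  let ?Z = "\<lambda>j. blowup n U (?s j)"
  have s: "0 \<le> ?s j" for j using \<alpha> eps by simp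
  have "\<exists>e \<in> card_chains (Suc m) (?Z 1). (\<lambda>\<rho>. c \<rho> + bd e \<rho>) \<in> card_chains m {\<rho> \<in> ?Z 1. \<rho> \<inter> range Inl = {}}"
  proof (rule peel[where Z = ?Z])
    show "simplicial_complex (?Z j)" for j by (rule simplicial_complex_blowup[OF s])
    show "?Z (Suc j) \<subseteq> ?Z j" for j
      using eps by (intro blowup_mono[OF s] add_left_mono mult_right_mono) auto
    show "c \<in> card_chains m (?Z (Suc m))" using c by simp
    show "1 \<le> m" by fact
    show "\<And>\<rho>. \<rho> \<inter> range Inl \<noteq> {} \<Longrightarrow> bd c \<rho> = 0" by fact
  next
    fix j w and a :: "(nat + 'v) set \<Rightarrow> bit"
    assume h: "1 \<le> j" "j \<le> m" "w \<subseteq> range Inl" "finite w" "card w = j"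
      "a \<in> card_chains (m - j) {\<tau>. \<tau> \<inter> range Inl = {} \<and> w \<union> \<tau> \<in> ?Z (Suc j)}" "bd a = (\<lambda>_. 0)"
    have "w \<noteq> {}" using h(1,5) by auto
    moreover have "(if m - j = 0 then ?s (Suc j) else ?s (Suc j) + \<epsilon>) = ?s j"
    proof (cases "j = m")
      case False
      then have "real (m - j) = real (m - Suc j) + 1" using h(2) by simp
      then show ?thesis using False h(2) by (simp add: algebra_simps)
    qed simp
    ultimately show "\<exists>e \<in> card_chains (Suc (m - j)) {\<tau>. \<tau> \<inter> range Inl = {} \<and> w \<union> \<tau> \<in> ?Z j}. bd e = a"
      using fill_cover[OF s[of "Suc j"] h(3) _ h(6,7)] by simp
  qed
  then obtain e where e: "e \<in> card_chains (Suc m) (?Z 1)"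
    "(\<lambda>\<rho>. c \<rho> + bd e \<rho>) \<in> card_chains m {\<rho> \<in> ?Z 1. \<rho> \<inter> range Inl = {}}" by blast
  have sub: "?Z 1 \<subseteq> blowup n U \<beta>" by (rule blowup_mono[OF s \<beta>])
  have \<beta>0: "0 \<le> \<beta>" using s[of 1] \<beta> by linarith
  have "{\<rho> \<in> ?Z 1. \<rho> \<inter> range Inl = {}} \<subseteq> (`) Inr ` (\<Union>i\<le>n. U i \<beta>)"
    unfolding blowup_cover[OF \<beta>0, symmetric] using sub by blast
  then show ?thesis using e card_chains_mono[OF sub] card_chains_mono by blast
qed

lemma relative_cycle_nerve:
  assumes \<alpha>: "0 \<le> \<alpha>" and m: "1 \<le> m" and c: "c \<in> card_chains m (blowup n U \<alpha>)"
    and rel: "\<And>\<rho>. \<rho> \<inter> range Inr \<noteq> {} \<Longrightarrow> bd c \<rho> = 0"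
  shows "\<exists>e \<in> card_chains (Suc m) (blowup n U \<alpha>).
    (\<lambda>\<rho>. c \<rho> + bd e \<rho>) \<in> card_chains m ((`) Inl ` nerve n U \<alpha>)"
  unfolding blowup_nerve[OF \<alpha>, symmetric]
proof (rule peel[where Z = "\<lambda>_. blowup n U \<alpha>"])
  fix j w and a :: "(nat + 'v) set \<Rightarrow> bit"
  assume h: "1 \<le> j" "w \<subseteq> range Inr" "card w = j"
    "a \<in> card_chains (m - j) {\<tau>. \<tau> \<inter> range Inr = {} \<and> w \<union> \<tau> \<in> blowup n U \<alpha>}" "bd a = (\<lambda>_. 0)"
  have "w \<noteq> {}" using h(1,3) by auto
  then show "\<exists>e \<in> card_chains (Suc (m - j)) {\<tau>. \<tau> \<inter> range Inr = {} \<and> w \<union> \<tau> \<in> blowup n U \<alpha>}. bd e = a"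
    using fill_nerve[OF \<alpha> h(2) _ h(4,5)] by simp
qed (use simplicial_complex_blowup[OF \<alpha>] m c rel in auto)

end

section \<open>The interleaving\<close>

lemma bit_subspace_trivial: "bit_subspace {\<lambda>_. 0}" "bit_subspace UNIV"
  by (simp_all add: bit_subspace_def)

lemma quotient_rank_eq_zero:
  assumes "bit_subspace B" "bit_subspace S" "finite S" "S \<subseteq> B"
  shows "quotient_rank S B = 0"
proof -
  have "coset B z = B" if "z \<in> S" for z
    using that assms(4) coset_eq_iff[OF assms(1), of z "\<lambda>_. 0"] by (auto simp: coset_zero)
  then have "coset B ` S = {B}" using bit_subspace_zero[OF assms(2)] by auto
  then have "(2::nat) ^ quotient_rank S B = 1"
    unfolding quotient_rank_def using dim_quotient_image[OF assms(1-3), of UNIV] by simp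
  then show ?thesis by simp
qed

lemma quotient_rank_mono:
  assumes "bit_subspace B" "bit_subspace S" "bit_subspace S'" "finite S'" "S \<subseteq> S'"
  shows "quotient_rank S B \<le> quotient_rank S' B"
proof -
  have "quotient_rank S' UNIV + quotient_rank S B \<le> quotient_rank S' B + quotient_rank S UNIV"
    by (intro quotient_rank_exchange assms bit_subspace_trivial subset_UNIV)
  moreover have "quotient_rank S UNIV = 0"
    by (intro quotient_rank_eq_zero assms bit_subspace_trivial subset_UNIV finite_subset[OF assms(5)])
  ultimately show ?thesis by linarith
qed

lemma quotient_rank_antimono:
  assumes "bit_subspace S" "finite S" "bit_subspace B" "bit_subspace B'" "S \<inter> B \<subseteq> B'"
  shows "quotient_rank S B' \<le> quotient_rank S B"
proof -
  have "quotient_rank S B' + quotient_rank {\<lambda>_. 0} B \<le>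
    quotient_rank S B + quotient_rank {\<lambda>_. 0} B'"
    using bit_subspace_zero[OF assms(1)]
    by (intro quotient_rank_exchange assms bit_subspace_trivial) simp
  moreover have "quotient_rank {\<lambda>_. 0} B' = 0"
    using bit_subspace_zero[OF assms(4)]
    by (intro quotient_rank_eq_zero assms bit_subspace_trivial) simp_all
  ultimately show ?thesis by linarith
qed

lemma finite_sum_space:
  assumes "finite S" "finite T"
  shows "finite (sum_space S T)"
proof -
  have "sum_space S T \<subseteq> (\<lambda>(a, b) x. a x + b x) ` (S \<times> T)" by (auto elim!: sum_spaceE)
  then show ?thesis using finite_subset finite_imageI[OF finite_cartesian_product[OF assms]] by metis
qed

lemma finite_boundaries: "finite X \<Longrightarrow> finite (boundaries k X)"
  unfolding boundaries_def simplicial_chains_eq by (intro finite_imageI finite_chains)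

text \<open>If a cycle of \<open>C0\<close> bounds \<open>c\<close>, then \<open>c\<close> is a
  relative cycle, as its boundary avoids \<open>P\<close>. Pushing it off \<open>P\<close> changes
  it by a boundary only, so the result still bounds the same cycle.\<close>

lemma relative_injective:
  assumes rel: "\<And>c. c \<in> card_chains (Suc (Suc K)) X \<Longrightarrow> (\<And>\<rho>. \<rho> \<inter> P \<noteq> {} \<Longrightarrow> bd c \<rho> = 0) \<Longrightarrow>
      \<exists>e \<in> card_chains (Suc (Suc (Suc K))) Y. (\<lambda>\<rho>. c \<rho> + bd e \<rho>) \<in> card_chains (Suc (Suc K)) C"
    and Y: "simplicial_complex Y"
    and C0: "\<And>\<rho>. \<rho> \<in> C0 \<Longrightarrow> \<rho> \<inter> P = {}"
  shows "cycles K C0 \<inter> boundaries K X \<subseteq> boundaries K C"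
proof
  fix z assume z: "z \<in> cycles K C0 \<inter> boundaries K X"
  then obtain c where c: "c \<in> card_chains (Suc (Suc K)) X" "z = bd c"
    by (auto simp: boundaries_def simplicial_chains_eq)
  have zC: "z \<in> card_chains (Suc K) C0" using z by (auto simp: cycles_def simplicial_chains_eq)
  have "bd c \<rho> = 0" if "\<rho> \<inter> P \<noteq> {}" for \<rho>
    using card_chainsD(1)[OF zC, of \<rho>] C0[of \<rho>] that c(2) by auto
  then obtain e where e: "e \<in> card_chains (Suc (Suc (Suc K))) Y"
    "(\<lambda>\<rho>. c \<rho> + bd e \<rho>) \<in> card_chains (Suc (Suc K)) C" using rel[OF c(1)] by blast
  have "bd (\<lambda>\<rho>. c \<rho> + bd e \<rho>) = z"
    using bd_add[OF c(1) bd_in_chains[OF e(1) Y]] bd_bd[OF e(1)] c(2) by simp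
  then show "z \<in> boundaries K C"
    using e(2) unfolding boundaries_def simplicial_chains_eq by auto
qed

lemma relative_surjective:
  assumes rel: "\<And>c. c \<in> card_chains (Suc K) X \<Longrightarrow> (\<And>\<rho>. \<rho> \<inter> P \<noteq> {} \<Longrightarrow> bd c \<rho> = 0) \<Longrightarrow>
      \<exists>e \<in> card_chains (Suc (Suc K)) Y. (\<lambda>\<rho>. c \<rho> + bd e \<rho>) \<in> card_chains (Suc K) C"
    and Y: "simplicial_complex Y"
  shows "cycles K X \<subseteq> sum_space (cycles K C) (boundaries K Y)"
proof
  fix z assume z: "z \<in> cycles K X"
  then have zX: "z \<in> card_chains (Suc K) X" and cyc: "K = 0 \<or> bd z = (\<lambda>_. 0)"
    by (auto simp: cycles_def simplicial_chains_eq)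
  have "bd z \<rho> = 0" if "\<rho> \<inter> P \<noteq> {}" for \<rho>
  proof (cases "K = 0")
    \<comment> \<open>Every 0-chain counts as a cycle, but its boundary lives on the empty simplex
      alone, which does not meet \<open>P\<close>.\<close>
    case True
    show ?thesis
    proof (rule ccontr)
      assume "bd z \<rho> \<noteq> 0"
      then obtain x where x: "x \<notin> \<rho>" "z (insert x \<rho>) \<noteq> 0" using bd_support[OF zX] by blast
      have "finite \<rho>" "card \<rho> = 0" using card_chainsD(2,3)[OF zX x(2)] x(1) True by auto
      then show False using that by auto
    qed
  qed (use cyc in simp)
  then obtain e where e: "e \<in> card_chains (Suc (Suc K)) Y" "(\<lambda>\<rho>. z \<rho> + bd e \<rho>) \<in> card_chains (Suc K) C"
    using rel[OF zX] by blast
  show "z \<in> sum_space (cycles K C) (boundaries K Y)"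
  proof (rule sum_spaceI)
    have "bd (\<lambda>\<rho>. z \<rho> + bd e \<rho>) = bd z"
      using bd_add[OF zX bd_in_chains[OF e(1) Y]] bd_bd[OF e(1)] by simp
    then show "(\<lambda>\<rho>. z \<rho> + bd e \<rho>) \<in> cycles K C"
      using e(2) cyc by (simp add: cycles_def simplicial_chains_eq)
    show "bd e \<in> boundaries K Y" using e(1) by (simp add: boundaries_def simplicial_chains_eq)
  qed (simp add: add.assoc)
qed

text \<open>The zero space for \<open>s < 0\<close> and all of the space for \<open>t = \<infinity>\<close> extend persistent homology by zero.\<close>

definition cycles_at :: "nat \<Rightarrow> (real \<Rightarrow> 'v set set) \<Rightarrow> real \<Rightarrow> ('v set \<Rightarrow> bit) set" where
  "cycles_at K F s = (if s < 0 then {\<lambda>_. 0} else cycles K (F s))"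

definition boundaries_at :: "nat \<Rightarrow> (real \<Rightarrow> 'v set set) \<Rightarrow> ereal \<Rightarrow> ('v set \<Rightarrow> bit) set" where
  "boundaries_at K G t = (if t = \<infinity> then UNIV else boundaries K (G (real_of_ereal t)))"

text \<open>The two filtrations provide for the image: cycles come from \<open>F\<close> and
  boundaries from \<open>G\<close>. The value 0 off \<open>s \<le> t\<close> agrees with
  \<open>pm_rank\<close>.\<close>

definition homology_rank ::
    "nat \<Rightarrow> (real \<Rightarrow> 'v set set) \<Rightarrow> (real \<Rightarrow> 'v set set) \<Rightarrow> real \<Rightarrow> ereal \<Rightarrow> nat" where
  "homology_rank K F G s t =
     (if ereal s \<le> t then quotient_rank (cycles_at K F s) (boundaries_at K G t) else 0)"

lemma bit_subspace_cycles_at: "bit_subspace (cycles_at K F s)"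
  by (simp add: cycles_at_def bit_subspace_trivial bit_subspace_cycles)

lemma bit_subspace_boundaries_at: "bit_subspace (boundaries_at K G t)"
  by (simp add: boundaries_at_def bit_subspace_trivial bit_subspace_boundaries)

lemma homology_rank_neg: "s < 0 \<Longrightarrow> homology_rank K F G s t = 0"
  unfolding homology_rank_def
  by (simp add: cycles_at_def quotient_rank_eq_zero bit_subspace_boundaries_at bit_subspace_trivial
      bit_subspace_zero)

locale filtration =
  fixes F :: "real \<Rightarrow> 'v set set"
  assumes mono: "0 \<le> \<alpha> \<Longrightarrow> \<alpha> \<le> \<beta> \<Longrightarrow> F \<alpha> \<subseteq> F \<beta>"
    and finite: "0 \<le> \<alpha> \<Longrightarrow> finite (F \<alpha>)"
begin

lemma finite_cycles_at: "finite (cycles_at K F s)"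
  using finite by (auto simp: cycles_at_def intro!: finite_cycles)

lemma cycles_at_mono:
  assumes "s \<le> s'"
  shows "cycles_at K F s \<subseteq> cycles_at K F s'"
proof (cases "s < 0")
  case True
  then show ?thesis using bit_subspace_zero[OF bit_subspace_cycles_at] by (simp add: cycles_at_def[of K F s])
next
  case False
  then show ?thesis using assms cycles_mono[OF mono[of s s']] by (simp add: cycles_at_def)
qed

lemma boundaries_at_mono:
  assumes "0 \<le> t" "t \<le> t'"
  shows "boundaries_at K F t \<subseteq> boundaries_at K F t'"
proof (cases "t' = \<infinity>")
  case False
  then obtain u u' where "t = ereal u" "t' = ereal u'" using assms by (cases t; cases t') auto
  then show ?thesis using assms boundaries_mono[OF mono[of u u']] by (simp add: boundaries_at_def)
qed (simp add: boundaries_at_def)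

lemma homology_rank_infinity: "homology_rank K F G s \<infinity> = 0"
  unfolding homology_rank_def
  by (simp add: boundaries_at_def quotient_rank_eq_zero bit_subspace_cycles_at bit_subspace_trivial
      finite_cycles_at)

lemma homology_rank_outside:
  assumes "\<not> (0 \<le> s \<and> ereal s \<le> t \<and> t \<noteq> \<infinity>)"
  shows "homology_rank K F G s t = 0"
proof -
  consider "s < 0" | "t = \<infinity>" | "\<not> ereal s \<le> t" using assms by force
  then show ?thesis
  proof cases
    case 3
    then show ?thesis by (simp add: homology_rank_def)
  qed (simp_all add: homology_rank_neg homology_rank_infinity)
qed

lemma rank_function_homology_rank:
  assumes G: "filtration G"
  shows "rank_function (homology_rank K F G)"
proof
  fix s s' :: real and t t' :: ereal
  assume h: "s \<le> s'" "ereal s' \<le> t" "t \<le> t'"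
  show "homology_rank K F G s t + homology_rank K F G s' t' \<le>
    homology_rank K F G s' t + homology_rank K F G s t'"
  proof (cases "s' < 0")
    \<comment> \<open>Here \<open>t\<close> may be negative, where nothing is known about the
      filtrations, but all four ranks vanish.\<close>
    case True
    then show ?thesis using h(1) by (simp add: homology_rank_neg)
  next
    case False
    then have "0 \<le> t" using h(2) by (cases t) auto
    then have "cycles_at K F s' \<inter> boundaries_at K G t \<subseteq> boundaries_at K G t'"
      using filtration.boundaries_at_mono[OF G _ h(3)] by blast
    moreover have "ereal s \<le> t" using h(1,2) by (cases t) auto
    moreover have "ereal s \<le> t'" "ereal s' \<le> t'" using \<open>ereal s \<le> t\<close> h(2,3) by order+
    ultimately show ?thesis
      using quotient_rank_exchange[OF bit_subspace_cycles_at bit_subspace_cycles_at finite_cycles_at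
          cycles_at_mono[OF h(1)] bit_subspace_boundaries_at bit_subspace_boundaries_at] h(2)
      by (simp add: homology_rank_def add.commute)
  qed
qed (simp_all add: homology_rank_neg homology_rank_infinity)

lemma pm_rank_eq_homology_rank:
  "pm_rank (\<lambda>\<alpha>. homology K (F \<alpha>)) (\<lambda>\<alpha> \<beta>. inclusion_map K (F \<beta>)) = homology_rank K F F"
proof (intro ext)
  fix s t
  show "pm_rank (\<lambda>\<alpha>. homology K (F \<alpha>)) (\<lambda>\<alpha> \<beta>. inclusion_map K (F \<beta>)) s t =
    homology_rank K F F s t"
  proof (cases "0 \<le> s \<and> ereal s \<le> t \<and> t \<noteq> \<infinity>")
    case True
    then obtain t' where "t = ereal t'" by (cases t) auto
    then show ?thesis
      using pm_rank_homology[of s t' F K] mono finite True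
      by (simp add: homology_rank_def cycles_at_def boundaries_at_def)
  next
    case False
    then show ?thesis unfolding homology_rank_outside[OF False] by (auto simp: pm_rank_def)
  qed
qed

end

lemma homology_rank_cong:
  assumes "filtration F" "filtration F'"
    and eq: "\<And>s t. 0 \<le> s \<Longrightarrow> s \<le> t \<Longrightarrow>
      quotient_rank (cycles K (F s)) (boundaries K (G t)) =
      quotient_rank (cycles K (F' s)) (boundaries K (G' t))"
  shows "homology_rank K F G = homology_rank K F' G'"
proof (intro ext)
  fix s t
  show "homology_rank K F G s t = homology_rank K F' G' s t"
  proof (cases "0 \<le> s \<and> ereal s \<le> t \<and> t \<noteq> \<infinity>")
    case True
    then obtain t' where "t = ereal t'" by (cases t) auto
    then show ?thesis
      using eq[of s t'] True by (simp add: homology_rank_def cycles_at_def boundaries_at_def)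
  next
    case False
    show ?thesis
      unfolding filtration.homology_rank_outside[OF assms(1) False]
        filtration.homology_rank_outside[OF assms(2) False] ..
  qed
qed

lemma filtration_image: "filtration F \<Longrightarrow> filtration (\<lambda>\<alpha>. (`) g ` F \<alpha>)"
  unfolding filtration_def by (auto intro!: image_mono)

lemma homology_rank_image:
  assumes "filtration F" "inj g"
  shows "homology_rank K (\<lambda>\<alpha>. (`) g ` F \<alpha>) (\<lambda>\<alpha>. (`) g ` F \<alpha>) = homology_rank K F F"
  by (rule homology_rank_cong[OF filtration_image assms(1)])
    (simp_all add: assms quotient_rank_image filtration.finite)

section \<open>Diagrams and their distance in terms of ranks\<close>

lemma diagram_points_pm_diagram:
  "diagram_points (pm_diagram M f) = rank_points (pm_rank M f) \<union> diagonal_points"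
proof -
  have *: "pm_multiplicity M f = rank_multiplicity (pm_rank M f)"
    unfolding pm_multiplicity_def rank_multiplicity_def pm_rectangle_def beyond_def by (intro ext) simp
  show ?thesis
    unfolding diagram_points_def pm_diagram_def rank_points_def diagonal_points_def *
    by (auto split: if_splits)
qed

lemma bottleneck_dist_le:
  assumes "bij_betw \<phi> (diagram_points D) (diagram_points D')"
    and "\<And>x. x \<in> diagram_points D \<Longrightarrow> linf_dist (fst x) (fst (\<phi> x)) \<le> \<delta>"
  shows "bottleneck_dist D D' \<le> \<delta>"
  unfolding bottleneck_dist_def
  by (rule INF_lower2[of \<phi>]) (use assms in \<open>auto intro!: SUP_least\<close>)

section \<open>Persistent ranks of the cover, the blowup complex and the nerve\<close>

context good_cover
begin

abbreviation "J \<equiv> blowup n U"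
abbreviation "cover_part \<alpha> \<equiv> (`) Inr ` (\<Union>i\<le>n. U i \<alpha>) :: (nat + 'v) set set"
abbreviation "nerve_part \<alpha> \<equiv> (`) Inl ` nerve n U \<alpha> :: (nat + 'v) set set"

lemma cover_part_subset: "0 \<le> \<alpha> \<Longrightarrow> cover_part \<alpha> \<subseteq> J \<alpha>"
  using blowup_cover by blast

lemma nerve_part_subset: "0 \<le> \<alpha> \<Longrightarrow> nerve_part \<alpha> \<subseteq> J \<alpha>"
  using blowup_nerve by blast

lemma filtration_blowup: "filtration J"
  by unfold_locales (auto intro: finite_blowup subsetD[OF blowup_mono])

lemma filtration_cover: "filtration (\<lambda>\<alpha>. \<Union>i\<le>n. U i \<alpha>)"
proof
  show "(\<Union>i\<le>n. U i \<alpha>) \<subseteq> (\<Union>i\<le>n. U i \<beta>)" if "0 \<le> \<alpha>" "\<alpha> \<le> \<beta>" for \<alpha> \<beta>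
    using U_mono[OF _ that] by (intro UN_mono) auto
  show "finite (\<Union>i\<le>n. U i \<alpha>)" if "0 \<le> \<alpha>" for \<alpha>
    using filtration that unfolding finite_simplicial_filtration_def by (intro finite_UN_I) auto
qed

lemma filtration_nerve: "filtration (nerve n U)"
proof
  show "nerve n U \<alpha> \<subseteq> nerve n U \<beta>" if "0 \<le> \<alpha>" "\<alpha> \<le> \<beta>" for \<alpha> \<beta>
  proof
    fix v assume "v \<in> nerve n U \<alpha>"
    then obtain \<sigma> where v: "v \<noteq> {}" "v \<subseteq> {..n}" "\<forall>i\<in>v. \<sigma> \<in> U i \<alpha>" by (auto simp: nerve_def)
    then have "\<forall>i\<in>v. \<sigma> \<in> U i \<beta>" using U_mono[OF _ that] by blast
    then show "v \<in> nerve n U \<beta>" using v(1,2) by (auto simp: nerve_def)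
  qed
  show "finite (nerve n U \<alpha>)" for \<alpha>
    by (rule finite_subset[of _ "Pow {..n}"]) (auto simp: nerve_def)
qed

text \<open>The simplices of a chain bounding a \<open>K\<close>-cycle have \<open>K + 2\<close>
  vertices, so clearing the nerve vertices costs exactly \<open>K + 1\<close> shifts.\<close>

lemma kernel_condition:
  assumes "0 \<le> s" "s \<le> t"
  shows "cycles K (cover_part s) \<inter> boundaries K (J t) \<subseteq> boundaries K (cover_part (t + (real K + 1) * \<epsilon>))"
proof (rule relative_injective[where P = "range Inl"])
  have t: "0 \<le> t" using assms by simp
  show "simplicial_complex (J (t + (real K + 1) * \<epsilon>))"
    using t eps by (intro simplicial_complex_blowup) simp
  show "\<rho> \<inter> range Inl = {}" if "\<rho> \<in> cover_part s" for \<rho> using that by auto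
  show "\<exists>e \<in> card_chains (Suc (Suc (Suc K))) (J (t + (real K + 1) * \<epsilon>)).
      (\<lambda>\<rho>. c \<rho> + bd e \<rho>) \<in> card_chains (Suc (Suc K)) (cover_part (t + (real K + 1) * \<epsilon>))"
    if "c \<in> card_chains (Suc (Suc K)) (J t)" "\<And>\<rho>. \<rho> \<inter> range Inl \<noteq> {} \<Longrightarrow> bd c \<rho> = 0" for c
    by (rule relative_cycle_cover[OF t _ that]) (simp_all add: add.commute)
qed

text \<open>The simplices have \<open>K + 1\<close> vertices and are cleared after \<open>K\<close>
  shifts; the result is stated with the shift of the kernel, so that one \<delta> serves
  both.\<close>

lemma cokernel_condition:
  assumes s: "0 \<le> s"
  shows "cycles K (J s) \<subseteq>
    sum_space (cycles K (cover_part (s + (real K + 1) * \<epsilon>))) (boundaries K (J (s + (real K + 1) * \<epsilon>)))"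
proof (rule relative_surjective[where P = "range Inl"])
  show "simplicial_complex (J (s + (real K + 1) * \<epsilon>))"
    using s eps by (intro simplicial_complex_blowup) simp
  show "\<exists>e \<in> card_chains (Suc (Suc K)) (J (s + (real K + 1) * \<epsilon>)).
      (\<lambda>\<rho>. c \<rho> + bd e \<rho>) \<in> card_chains (Suc K) (cover_part (s + (real K + 1) * \<epsilon>))"
    if "c \<in> card_chains (Suc K) (J s)" "\<And>\<rho>. \<rho> \<inter> range Inl \<noteq> {} \<Longrightarrow> bd c \<rho> = 0" for c
    by (rule relative_cycle_cover[OF s _ that]) (use eps in \<open>simp_all add: algebra_simps\<close>)
qed

text \<open>Clearing the cover vertices needs no shift. Injectivity at \<open>t\<close> allows the
  boundaries to be exchanged, and surjectivity at \<open>s\<close> then the cycles.\<close>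

lemma homology_rank_nerve: "homology_rank K (nerve n U) (nerve n U) = homology_rank K J J"
proof -
  have inj_Inl: "inj (Inl :: nat \<Rightarrow> nat + 'v)" by (rule inj_Inl)
  interpret J: filtration J by (rule filtration_blowup)
  interpret N: filtration nerve_part by (rule filtration_image[OF filtration_nerve])
  have "homology_rank K nerve_part nerve_part = homology_rank K J J"
  proof (rule homology_rank_cong[OF N.filtration_axioms J.filtration_axioms])
    fix s t :: real assume st: "0 \<le> s" "s \<le> t"
    then have t: "0 \<le> t" by simp
    let ?Z = "cycles K (nerve_part s)" and ?B = "boundaries K (nerve_part t)"
    let ?ZJ = "cycles K (J s)" and ?BJ = "boundaries K (J t)"
    have fin: "finite ?Z" "finite ?ZJ" using N.finite J.finite st(1) by (simp_all add: finite_cycles)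
    have surj: "?ZJ \<subseteq> sum_space ?Z (boundaries K (J s))"
      by (rule relative_surjective[where P = "range Inr", OF relative_cycle_nerve[OF st(1)] simplicial_complex_blowup[OF st(1)]])
        simp_all
    have inj: "?Z \<inter> ?BJ \<subseteq> ?B"
      by (rule relative_injective[where P = "range Inr", OF relative_cycle_nerve[OF t] simplicial_complex_blowup[OF t]])
        auto
    have "?B \<subseteq> ?BJ" by (rule boundaries_mono[OF nerve_part_subset[OF t]])
    then have "quotient_rank ?Z ?B = quotient_rank ?Z ?BJ"
      using inj fin by (intro antisym quotient_rank_antimono bit_subspace_cycles bit_subspace_boundaries) auto
    also have "\<dots> = quotient_rank ?ZJ ?BJ"
    proof (rule antisym)
      show "quotient_rank ?Z ?BJ \<le> quotient_rank ?ZJ ?BJ"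
        by (intro quotient_rank_mono bit_subspace_cycles bit_subspace_boundaries fin
            cycles_mono nerve_part_subset st)
      have sub: "boundaries K (J s) \<subseteq> ?BJ" by (rule boundaries_mono[OF J.mono[OF st]])
      have "quotient_rank ?ZJ ?BJ \<le> quotient_rank (sum_space ?Z (boundaries K (J s))) ?BJ"
        by (intro quotient_rank_mono bit_subspace_cycles bit_subspace_boundaries bit_subspace_sum surj
            finite_sum_space fin(1) finite_boundaries J.finite[OF st(1)])
      also have "\<dots> = quotient_rank ?Z ?BJ"
        by (rule quotient_rank_sum[OF bit_subspace_boundaries bit_subspace_boundaries sub])
      finally show "quotient_rank ?ZJ ?BJ \<le> quotient_rank ?Z ?BJ" .
    qed
    finally show "quotient_rank ?Z ?B = quotient_rank ?ZJ ?BJ" .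
  qed
  then show ?thesis unfolding homology_rank_image[OF filtration_nerve inj_Inl] .
qed

lemma homology_rank_exchange:
  assumes F': "filtration F'" and "cycles_at K F s \<subseteq> cycles_at K F' s'"
    and "cycles_at K F' s' \<inter> boundaries_at K G t \<subseteq> boundaries_at K G' t'"
    and "ereal s \<le> t" "ereal s' \<le> t" "ereal s \<le> t'" "ereal s' \<le> t'"
  shows "homology_rank K F' G' s' t' + homology_rank K F G s t \<le>
    homology_rank K F' G s' t + homology_rank K F G' s t'"
  using quotient_rank_exchange[OF bit_subspace_cycles_at bit_subspace_cycles_at
      filtration.finite_cycles_at[OF F'] assms(2) bit_subspace_boundaries_at
      bit_subspace_boundaries_at assms(3)] assms(4-7)
  by (simp add: homology_rank_def)

text \<open>Cycles of \<open>J\<close> at \<open>s\<close> are cycles of the cover at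
  \<open>s'\<close> only modulo boundaries of \<open>J\<close> at \<open>s'\<close>. These are
  therefore added to the larger space of the exchange; they are boundaries at \<open>t\<close> and
  \<open>t'\<close> too, since \<open>s' \<le> t\<close>, so the ranks stay the same.\<close>

lemma cokernel_rank:
  assumes t: "s + (real K + 1) * \<epsilon> \<le> t" and t': "ereal t \<le> t'"
  defines "s' \<equiv> s + (real K + 1) * \<epsilon>"
  shows "homology_rank K J J s (ereal t) + homology_rank K cover_part J s' t' \<le>
    homology_rank K cover_part J s' (ereal t) + homology_rank K J J s t'"
proof (cases "s' < 0")
  case True
  moreover have "s < 0" using True eps unfolding s'_def by (smt (verit) mult_nonneg_nonneg of_nat_0_le_iff)
  ultimately show ?thesis by (simp add: homology_rank_neg)
next
  case False
  interpret J: filtration J by (rule filtration_blowup)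
  interpret C: filtration cover_part by (rule filtration_image[OF filtration_cover])
  let ?B = "boundaries K (J s')"
  let ?S = "sum_space (cycles_at K cover_part s') ?B"
  have ss': "s \<le> s'" using eps unfolding s'_def by simp
  have le: "ereal s' \<le> ereal t" "ereal s' \<le> t'" "ereal s \<le> ereal t" "ereal s \<le> t'"
    using t t' ss' unfolding s'_def[symmetric] by (auto elim: order_trans[rotated])
  have sub: "?B \<subseteq> boundaries_at K J u" if "ereal s' \<le> u" for u
    using J.boundaries_at_mono[of "ereal s'" u K] that False by (simp add: boundaries_at_def)
  have sumB: "quotient_rank ?S (boundaries_at K J u) =
      quotient_rank (cycles_at K cover_part s') (boundaries_at K J u)" if "ereal s' \<le> u" for u
    by (rule quotient_rank_sum[OF bit_subspace_boundaries_at bit_subspace_boundaries sub[OF that]])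
  have S: "bit_subspace ?S" by (intro bit_subspace_sum bit_subspace_cycles_at bit_subspace_boundaries)
  have fin: "finite ?S"
    by (rule finite_sum_space[OF C.finite_cycles_at finite_boundaries[OF J.finite]]) (use False in simp)
  have "cycles_at K J s \<subseteq> ?S"
  proof (cases "s < 0")
    case True
    then show ?thesis using bit_subspace_zero[OF S] by (simp add: cycles_at_def[of K J])
  next
    case s: False
    then show ?thesis using cokernel_condition[of s K] False
      by (simp add: cycles_at_def s'_def)
  qed
  moreover have "?S \<inter> boundaries_at K J (ereal t) \<subseteq> boundaries_at K J t'"
    using J.boundaries_at_mono[OF _ t', of K] le(1) False by fastforce
  ultimately have "quotient_rank ?S (boundaries_at K J t') +
      quotient_rank (cycles_at K J s) (boundaries_at K J (ereal t)) \<le>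
    quotient_rank ?S (boundaries_at K J (ereal t)) +
      quotient_rank (cycles_at K J s) (boundaries_at K J t')"
    by (intro quotient_rank_exchange bit_subspace_cycles_at bit_subspace_boundaries_at S fin)
  then show ?thesis
    unfolding sumB[OF le(1)] sumB[OF le(2)] homology_rank_def using le by simp
qed

lemma rank_interleaving_cover:
  "rank_interleaving (homology_rank K cover_part cover_part) (homology_rank K cover_part J)
    (homology_rank K J J) ((real K + 1) * \<epsilon>)"
proof -
  have FJ: "filtration J" by (rule filtration_blowup)
  have FC: "filtration cover_part" by (rule filtration_image[OF filtration_cover])
  let ?\<delta> = "(real K + 1) * \<epsilon>"
  have \<delta>: "0 \<le> ?\<delta>" using eps by simp
  have sub: "boundaries K (cover_part t) \<subseteq> boundaries K (J t)" if "0 \<le> t" for t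
    by (rule boundaries_mono[OF cover_part_subset[OF that]])
  show ?thesis
  proof (intro rank_interleaving.intro rank_interleaving_axioms.intro
      filtration.rank_function_homology_rank FJ FC \<delta> cokernel_rank)
    fix s s' t :: real assume h: "s \<le> s'" "s' \<le> t"
    have cyc: "cycles_at K cover_part s \<subseteq> cycles_at K cover_part s'"
      by (rule filtration.cycles_at_mono[OF FC h(1)])
    show "homology_rank K cover_part J s' (ereal t) + homology_rank K cover_part cover_part s (ereal t) \<le>
      homology_rank K cover_part cover_part s' (ereal t) + homology_rank K cover_part J s (ereal t)"
    proof (cases "s' < 0")
      case False
      have "boundaries_at K cover_part (ereal t) \<subseteq> boundaries_at K J (ereal t)"
        using sub[of t] False h by (simp add: boundaries_at_def)
      then show ?thesis
        using h by (intro homology_rank_exchange FC cyc) auto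
    qed (use h in \<open>simp add: homology_rank_neg\<close>)
    show "homology_rank K cover_part cover_part s' (ereal (t + ?\<delta>)) + homology_rank K cover_part J s (ereal t) \<le>
      homology_rank K cover_part J s' (ereal t) + homology_rank K cover_part cover_part s (ereal (t + ?\<delta>))"
    proof (cases "s' < 0")
      case False
      then have "cycles_at K cover_part s' \<inter> boundaries_at K J (ereal t) \<subseteq>
          boundaries_at K cover_part (ereal (t + ?\<delta>))"
        using kernel_condition[of s' t K] h by (simp add: cycles_at_def boundaries_at_def)
      then show ?thesis
        using h \<delta> by (intro homology_rank_exchange FC cyc) auto
    qed (use h in \<open>simp add: homology_rank_neg\<close>)
  next
    fix s t and t' :: ereal assume h: "s \<le> t" "ereal t \<le> t'"
    show "homology_rank K cover_part J s (ereal t) + homology_rank K J J s t' \<le>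
      homology_rank K J J s (ereal t) + homology_rank K cover_part J s t'"
    proof (cases "s < 0")
      case False
      then have "boundaries_at K J (ereal t) \<subseteq> boundaries_at K J t'"
        using filtration.boundaries_at_mono[OF FJ _ h(2), of K] h by simp
      moreover have "cycles_at K cover_part s \<subseteq> cycles_at K J s"
        using False cycles_mono[OF cover_part_subset[of s]] by (simp add: cycles_at_def)
      moreover have "ereal s \<le> t'" using h by (auto elim: order_trans[rotated])
      ultimately have "homology_rank K J J s t' + homology_rank K cover_part J s (ereal t) \<le>
          homology_rank K J J s (ereal t) + homology_rank K cover_part J s t'"
        using h(1) by (intro homology_rank_exchange FJ) auto
      then show ?thesis by (simp add: add.commute)
    qed (simp add: homology_rank_neg)
  qed
qed

theorem bottleneck_dist_nerve:
  "bottleneck_dist (Dgm K (\<lambda>\<alpha>. \<Union>i\<le>n. U i \<alpha>)) (Dgm K (nerve n U)) \<le> ereal ((real K + 1) * \<epsilon>)"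
proof -
  have inj: "inj (Inr :: 'v \<Rightarrow> nat + 'v)" by (rule inj_Inr)
  have W: "diagram_points (Dgm K (\<lambda>\<alpha>. \<Union>i\<le>n. U i \<alpha>)) =
      rank_points (homology_rank K cover_part cover_part) \<union> diagonal_points"
    unfolding Dgm_def diagram_points_pm_diagram filtration.pm_rank_eq_homology_rank[OF filtration_cover]
      homology_rank_image[OF filtration_cover inj] ..
  have N: "diagram_points (Dgm K (nerve n U)) = rank_points (homology_rank K J J) \<union> diagonal_points"
    unfolding Dgm_def diagram_points_pm_diagram filtration.pm_rank_eq_homology_rank[OF filtration_nerve]
      homology_rank_nerve ..
  have "\<exists>\<phi>. bij_betw \<phi> (diagram_points (Dgm K (\<lambda>\<alpha>. \<Union>i\<le>n. U i \<alpha>)))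
      (diagram_points (Dgm K (nerve n U))) \<and>
    (\<forall>x \<in> diagram_points (Dgm K (\<lambda>\<alpha>. \<Union>i\<le>n. U i \<alpha>)).
      linf_dist (fst x) (fst (\<phi> x)) \<le> ereal ((real K + 1) * \<epsilon>))"
    unfolding W N by (rule rank_interleaving.bottleneck_bijection[OF rank_interleaving_cover])
  then show ?thesis using bottleneck_dist_le by blast
qed

end

text \<open>The union \<open>W\<close> is prescribed at non-negative parameters only. The ranks, and
  hence the diagram, read no other values.\<close>

lemma Dgm_cong:
  assumes "filtration F" "\<And>\<alpha>. 0 \<le> \<alpha> \<Longrightarrow> F \<alpha> = G \<alpha>"
  shows "Dgm K F = Dgm K G"
proof -
  have G: "filtration G"
  proof
    show "G \<alpha> \<subseteq> G \<beta>" if "0 \<le> \<alpha>" "\<alpha> \<le> \<beta>" for \<alpha> \<beta>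
      using filtration.mono[OF assms(1) that] assms(2)[of \<alpha>] assms(2)[of \<beta>] that by simp
    show "finite (G \<alpha>)" if "0 \<le> \<alpha>" for \<alpha>
      using filtration.finite[OF assms(1) that] assms(2)[OF that] by simp
  qed
  have "homology_rank K F F = homology_rank K G G"
    by (rule homology_rank_cong[OF assms(1) G]) (simp add: assms(2))
  then have r: "pm_rank (\<lambda>\<alpha>. homology K (F \<alpha>)) (\<lambda>\<alpha> \<beta>. inclusion_map K (F \<beta>)) =
      pm_rank (\<lambda>\<alpha>. homology K (G \<alpha>)) (\<lambda>\<alpha> \<beta>. inclusion_map K (G \<beta>))"
    unfolding filtration.pm_rank_eq_homology_rank[OF assms(1)] filtration.pm_rank_eq_homology_rank[OF G] .
  show ?thesis
    unfolding Dgm_def pm_diagram_def pm_multiplicity_def pm_rectangle_def r ..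
qed

theorem theorem7:
  fixes \<epsilon> :: real and n :: nat
    and X :: "'v set set"
    and U :: "nat \<Rightarrow> real \<Rightarrow> 'v set set"
    and W :: "real \<Rightarrow> 'v set set"
  assumes "0 \<le> \<epsilon>"
    and "\<And>i. i \<le> n \<Longrightarrow> finite_simplicial_filtration (U i)"
    and "simplicial_complex X"
    and "\<And>i \<alpha>. i \<le> n \<Longrightarrow> 0 \<le> \<alpha> \<Longrightarrow> subcomplex (U i \<alpha>) X"
    and "\<And>\<alpha>. 0 \<le> \<alpha> \<Longrightarrow> W \<alpha> = (\<Union>i\<le>n. U i \<alpha>)"
    and "eps_good_cover \<epsilon> n U"
  shows "\<forall>K::nat. bottleneck_dist (Dgm K W) (Dgm K (nerve n U)) \<le> ereal ((real K + 1) * \<epsilon>)"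
proof
  fix K
  interpret good_cover \<epsilon> n U
    using assms(1,2,6) by unfold_locales
  have "Dgm K (\<lambda>\<alpha>. \<Union>i\<le>n. U i \<alpha>) = Dgm K W"
    by (rule Dgm_cong[OF filtration_cover]) (simp add: assms(5))
  then show "bottleneck_dist (Dgm K W) (Dgm K (nerve n U)) \<le> ereal ((real K + 1) * \<epsilon>)"
    using bottleneck_dist_nerve[of K] by simp
qed

end
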